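(* Fix an integer $m\ge2$ and $a\in(0,1)$ such that $\alpha=2ma-2>-1$. Suppose that for every $N\ge0$ and every finite-section Boyd extremizer $c=(c_0,\dots,c_N)>0$ for the parameter pair $(m,a)$ there is a polynomial $P_c$ with $\deg P_c\le m-1$ such that the sequence \[ h_{c,j}=[z^j]\,(1-z)^{-m}P_c(1-z) \] is positive and satisfies, entrywise on the section, \[ \mathcal L_ch_c\le\mathrm B(a,1-a)\,Dh_c, \] i.e. $\sum_{k=0}^N(\mathcal L_c)_{jk}h_{c,k}\le\mathrm B(a,1-a)D_jh_{c,j}$ for $0\le j\le N$. Then \[ \|\mathcal H\|_{A^{2m}_{2ma-2}\to A^{2m}_{2ma-2}}=\mathrm B(a,1-a). \] If the hypothesis holds for every $a$ in an interval, the same conclusion holds for every $a$ in that interval, i.e. throughout the corresponding interval of weights $\alpha=2ma-2$.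
   Context: Let $\mathbb D$ be the open unit disk and $dA(z)=\pi^{-1}\,dx\,dy$. For $\alpha>-1$ put $dA_\alpha(z)=(\alpha+1)(1-|z|^2)^\alpha\,dA(z)$. The weighted Bergman space $A^p_\alpha$ consists of analytic functions $f$ on $\mathbb D$ with $\|f\|_{A^p_\alpha}^p=\int_{\mathbb D}|f|^p\,dA_\alpha<\infty$. The Hilbert matrix operator is $\mathcal Hf(z)=\int_0^1\frac{f(t)}{1-tz}\,dt$, equivalently $\mathcal Hf(z)=\sum_{n\ge0}\big(\sum_{k\ge0}\frac{a_k}{n+k+1}\big)z^n$ for $f(z)=\sum_{k\ge0}a_kz^k$ (initially for polynomials, which are dense in $A^p_\alpha$), and $\|\mathcal H\|_{A^p_\alpha\to A^p_\alpha}$ is its operator norm. $\mathrm B(x,y)=\int_0^1t^{x-1}(1-t)^{y-1}dt$ is the beta function, $(x)_n=x(x+1)\cdots(x+n-1)$, and $[z^j]F(z)$ is the coefficient of $z^j$ in the power series of $F$ at $0$. Given $m$ and $a$, put $\gamma=2ma$. Let $D=\operatorname{diag}(D_j)$ with $D_j=\frac{j!}{(\gamma)_j}$ and, for $0<y<1$, let $B_y$ be the matrix with entries \[ (B_y)_{jk}=y^{j+k}\sum_{n=0}^\infty\frac{(m+j)_n(m+k)_n}{(\gamma)_n\,n!}(1-y)^{2n}. \] For $N\ge0$ restrict $D$ and $B_y$ to indices $0\le j,k\le N$ and set \[ \Phi_N(c)=\int_0^1(c^*B_yc)^{1/(2m)}\,dy,\qquad \Lambda_N=\max_{c^*Dc=1}\Phi_N(c).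 \] A finite-section Boyd extremizer $c>0$ is a vector $c=(c_0,\dots,c_N)$ with all entries strictly positive, $c^*Dc=1$ and $\Phi_N(c)=\Lambda_N$ (for some $N$). For such $c$ the nonlinear Boyd–Perron matrix is the $(N+1)\times(N+1)$ matrix \[ \mathcal L_c=\int_0^1(c^*B_yc)^{1/(2m)-1}B_y\,dy . \] *)

theory Defs
  imports "HOL-Complex_Analysis.Complex_Analysis"
begin

text \<open>
  The measure is carried by the disk itself, so values of a function outside the disk are irrelevant
  for measurability, integrability and norms.
\<close>

definition dA :: "real \<Rightarrow> complex measure" where
  "dA \<alpha> = density (restrict_space lborel (ball 0 1))
     (\<lambda>z. ennreal ((\<alpha> + 1) / pi * (1 - (cmod z)\<^sup>2) powr \<alpha>))"

definition bergman_space :: "real \<Rightarrow> real \<Rightarrow> (complex \<Rightarrow> complex) set" where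
  "bergman_space p \<alpha> =
     {f. f holomorphic_on ball 0 1 \<and> integrable (dA \<alpha>) (\<lambda>z. cmod (f z) powr p)}"

definition bergman_norm :: "real \<Rightarrow> real \<Rightarrow> (complex \<Rightarrow> complex) \<Rightarrow> real" where
  "bergman_norm p \<alpha> f = (\<integral>z. cmod (f z) powr p \<partial>dA \<alpha>) powr (1 / p)"

text \<open>
  For \<open>f\<close> in the Bergman space with \<open>-1 < \<alpha>\<close> and \<open>\<alpha> + 2 < p\<close> one has
  \<open>f(t) = O((1 - t) powr (-(\<alpha> + 2) / p))\<close> as \<open>t\<close> tends to \<open>1\<close>, so the integral below converges
  absolutely on the whole space, and not only for polynomials.
\<close>

definition hilbert_op :: "(complex \<Rightarrow> complex) \<Rightarrow> complex \<Rightarrow> complex" where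
  "hilbert_op f z = (LBINT t:{0<..<1}. f (of_real t) / (1 - of_real t * z))"

text \<open>The value is \<open>\<infinity>\<close> if \<open>T\<close> does not map the space boundedly into itself.\<close>

definition bergman_opnorm ::
    "real \<Rightarrow> real \<Rightarrow> ((complex \<Rightarrow> complex) \<Rightarrow> complex \<Rightarrow> complex) \<Rightarrow> ennreal" where
  "bergman_opnorm p \<alpha> T =
     Inf (ennreal ` {C. 0 \<le> C \<and> (\<forall>f\<in>bergman_space p \<alpha>.
        T f \<in> bergman_space p \<alpha> \<and> bergman_norm p \<alpha> (T f) \<le> C * bergman_norm p \<alpha> f)})"

text \<open>
  Vectors and matrices of the section of order \<open>N\<close> are functions on \<open>nat\<close> of which only the
  entries with indices at most \<open>N\<close> matter. Throughout, \<open>\<gamma> = 2 m a\<close>.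
\<close>

definition D_entry :: "nat \<Rightarrow> real \<Rightarrow> nat \<Rightarrow> real" where
  "D_entry m a j = fact j / pochhammer (2 * real m * a) j"

definition D_mat :: "nat \<Rightarrow> real \<Rightarrow> nat \<Rightarrow> nat \<Rightarrow> real" where
  "D_mat m a j k = (if j = k then D_entry m a j else 0)"

definition B_mat :: "nat \<Rightarrow> real \<Rightarrow> real \<Rightarrow> nat \<Rightarrow> nat \<Rightarrow> real" where
  "B_mat m a y j k = y ^ (j + k) *
     (\<Sum>n. pochhammer (real (m + j)) n * pochhammer (real (m + k)) n
            / (pochhammer (2 * real m * a) n * fact n) * (1 - y) ^ (2 * n))"

definition quad_form :: "nat \<Rightarrow> (nat \<Rightarrow> nat \<Rightarrow> real) \<Rightarrow> (nat \<Rightarrow> complex) \<Rightarrow> complex" where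
  "quad_form N M c = (\<Sum>j\<le>N. \<Sum>k\<le>N. cnj (c j) * of_real (M j k) * c k)"

text \<open>
  The matrices are real symmetric, so \<open>quad_form\<close> is real-valued on them; \<open>Re\<close> only adjusts
  the type.
\<close>

definition Phi :: "nat \<Rightarrow> real \<Rightarrow> nat \<Rightarrow> (nat \<Rightarrow> complex) \<Rightarrow> real" where
  "Phi m a N c =
     (LBINT y:{0<..<1}. Re (quad_form N (B_mat m a y) c) powr (1 / (2 * real m)))"

definition Lambda :: "nat \<Rightarrow> real \<Rightarrow> nat \<Rightarrow> real" where
  "Lambda m a N = (GREATEST x. x \<in> Phi m a N ` {c. quad_form N (D_mat m a) c = 1})"

definition boyd_extremizer :: "nat \<Rightarrow> real \<Rightarrow> nat \<Rightarrow> (nat \<Rightarrow> real) \<Rightarrow> bool" where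
  "boyd_extremizer m a N c \<longleftrightarrow>
     (\<forall>j\<le>N. 0 < c j) \<and>
     quad_form N (D_mat m a) (\<lambda>j. of_real (c j)) = 1 \<and>
     Phi m a N (\<lambda>j. of_real (c j)) = Lambda m a N"

definition boyd_perron_mat ::
    "nat \<Rightarrow> real \<Rightarrow> nat \<Rightarrow> (nat \<Rightarrow> real) \<Rightarrow> nat \<Rightarrow> nat \<Rightarrow> real" where
  "boyd_perron_mat m a N c j k =
     (LBINT y:{0<..<1}.
        Re (quad_form N (B_mat m a y) (\<lambda>i. of_real (c i))) powr (1 / (2 * real m) - 1)
        * B_mat m a y j k)"

definition h_seq :: "nat \<Rightarrow> real poly \<Rightarrow> nat \<Rightarrow> real" where
  "h_seq m P j = fps_nth (inverse ((1 - fps_X) ^ m) * fps_of_poly (pcompose P [:1, -1:])) j"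

definition boyd_supersolutions :: "nat \<Rightarrow> real \<Rightarrow> bool" where
  "boyd_supersolutions m a \<longleftrightarrow>
     (\<forall>N c. boyd_extremizer m a N c \<longrightarrow>
        (\<exists>P :: real poly. degree P \<le> m - 1 \<and>
           (\<forall>j. 0 < h_seq m P j) \<and>
           (\<forall>j\<le>N. (\<Sum>k\<le>N. boyd_perron_mat m a N c j k * h_seq m P k)
                     \<le> Beta a (1 - a) * D_entry m a j * h_seq m P j)))"

end

theory Submission
  imports Defs
begin

text \<open>
  Replacing the segment from 0 to 1 by the arc \<open>t / (1 - (1 - t) z)\<close> writes \<open>hilbert_op f z\<close> as the
  integral over \<open>t\<close> of weighted compositions, whose \<open>m\<close>-th powers are the operators \<open>weighted_comp t\<close>
  applied to \<open>f ^ m\<close>. Monomials are orthogonal in \<open>L\<^sup>2\<close> of the disk with squared norms \<open>D_entry m a j\<close>, so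
  the squared \<open>L\<^sup>2\<close> norm of \<open>weighted_comp t F\<close> is the quadratic form of \<open>B_mat m a t\<close> in the Taylor
  coefficients of \<open>F\<close>. By Minkowski's inequality and Fatou's lemma the operator norm is thus at most
  the supremum of the section maxima.

  A section maximum is attained at a nonnegative vector \<open>c\<close> because \<open>B_mat\<close> is entrywise positive, and a
  perturbation in a coordinate direction shows that \<open>c\<close> is strictly positive. Perturbing \<open>c\<close> in the direction
  \<open>-h\<close> of a supersolution gives \<open>\<Lambda> h\<^sup>T D c \<le> h\<^sup>T L c \<le> Beta a (1 - a) h\<^sup>T D c\<close>, where \<open>L\<close> is symmetric.

  For the lower bound one lets \<open>b\<close> increase to \<open>a\<close> in \<open>(1 - z) powr (- b)\<close>. The norms of these functions tend to
  infinity, and by log-convexity of \<open>Gamma\<close> the Taylor coefficients of their images are asymptotically at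
  least \<open>Beta b (1 - b)\<close> times their own.
\<close>

section \<open>The weighted area measure on the disk\<close>

text \<open>With an even exponent the norm is quadratic in \<open>f ^ m\<close>, but the partial
  sums of \<open>f ^ m\<close> are in general not m-th powers, so \<open>hilbert_op\<close> cannot
  be applied to a truncation. The estimates are therefore made for the averages over
  \<open>t\<close> of \<open>cmod (weighted_comp t F z) powr (1 / real m)\<close>, which make sense
  for every polynomial \<open>F\<close>; only moduli survive, and Fatou's lemma suffices for the
  limit. The hypothesis speaks of strictly positive extremizers alone, so existence and strict
  positivity of a maximizer must be proved before it can be used. Of the stationarity of a maximizer
  only one inequality is needed, and the sign of the perturbation \<open>-h\<close> selects it. The
  number \<open>a\<close> is the order of growth at the circle: members of the space are O((1 - |z|)
  powr (- a)), and the forms raised to the power 1 / (2 m) are O(y powr (a - 1)). Since 0 < a < 1,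
  both are integrable, which allows paths to be moved and limits to be taken. The function (1 - z)
  powr (- a) just fails to belong to the space, its norm series exceeding a multiple of the harmonic
  one; this is why its subcritical neighbours detect the norm.\<close>

lemma distr_lborel_Complex:
  "distr lborel borel (\<lambda>x::real^2. Complex (x$1) (x$2)) = (lborel :: complex measure)"
proof (rule lborel_eqI[symmetric])
  let ?g = "\<lambda>x::real^2. Complex (x$1) (x$2)"
  have [measurable]: "?g \<in> borel_measurable borel"
    by (simp add: Complex_eq)
  fix l u :: complex assume le: "\<And>b. b \<in> Basis \<Longrightarrow> l \<bullet> b \<le> u \<bullet> b"
  define l' u' :: "real^2" where "l' = vector [Re l, Im l]" and "u' = vector [Re u, Im u]"
  have eq: "?g -` box l u = box l' u'"
    by (auto simp: mem_box_cart forall_2 l'_def u'_def in_box_complex_iff)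
  have le': "l' \<bullet> b \<le> u' \<bullet> b" if "b \<in> Basis" for b
    using that le[of 1] le[of \<i>] by (auto simp: Basis_vec_def exhaust_2 inner_axis l'_def u'_def
         Basis_complex_def UNIV_2 elim!: ballE)
  have "emeasure (distr lborel borel ?g) (box l u) = emeasure lborel (box l' u')"
    by (subst emeasure_distr) (auto simp: eq)
  also have "\<dots> = (\<Prod>b\<in>Basis. (u' - l') \<bullet> b)"
    by (rule emeasure_lborel_box[OF le'])
  also have "(\<Prod>b\<in>Basis. (u' - l') \<bullet> b) = (\<Prod>b\<in>Basis. (u - l) \<bullet> b)"
  proof -
    have "(Basis :: (real^2) set) = {axis 1 1, axis 2 1}"
      by (auto simp: Basis_vec_def UNIV_2)
    moreover have "axis 1 1 \<noteq> (axis 2 1 :: real^2)"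
      by (simp add: axis_eq_axis)
    moreover have "(\<Prod>b\<in>{axis 1 1, axis 2 1}. (u' - l') \<bullet> b) = (u' - l') $ 1 * (u' - l') $ 2"
      using calculation(2) by (subst prod.insert) (auto simp: inner_axis)
    ultimately show ?thesis
      by (simp add: Basis_complex_def l'_def u'_def)
  qed
  finally show "emeasure (distr lborel borel ?g) (box l u) = (\<Prod>b\<in>Basis. (u - l) \<bullet> b)" .
qed simp

text \<open>Read on \<open>real^2\<close> through \<open>Complex\<close>, multiplication by a
  unimodular number is an orthogonal transformation, and the preimage of a box under such a map has
  the measure of the box.\<close>

lemma distr_lborel_rotation:
  fixes w :: complex
  assumes "cmod w = 1"
  shows "distr lborel borel (\<lambda>z. w * z) = lborel"
proof -
  let ?g = "\<lambda>x::real^2. Complex (x$1) (x$2)"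
  define R :: "real^2 \<Rightarrow> real^2" where "R x = vector [Re (w * ?g x), Im (w * ?g x)]" for x
  have [measurable]: "?g \<in> borel_measurable borel"
    by (simp add: Complex_eq)
  have gR: "?g (R x) = w * ?g x" for x
    by (simp add: R_def complex_eq_iff)
  have lin: "linear R"
    by (rule linearI) (simp_all add: R_def vec_eq_iff forall_2 algebra_simps)
  have "norm (R x) = norm x" for x
  proof -
    have 1: "norm y = cmod (?g y)" for y
      by (simp add: norm_vec_def L2_set_def cmod_def sum_2)
    show ?thesis
      unfolding 1 gR using assms by (simp add: norm_mult)
  qed
  then have orth: "orthogonal_transformation R"
    using lin by (simp add: orthogonal_transformation)
  have [measurable]: "R \<in> borel_measurable borel"
    by (rule borel_measurable_continuous_onI)
       (rule linear_continuous_on[OF linear_conv_bounded_linear[THEN iffD1, OF lin]])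
  have distrR: "distr lborel borel R = lborel"
  proof (rule lborel_eqI[symmetric])
    fix l u :: "real^2" assume le: "\<And>b. b \<in> Basis \<Longrightarrow> l \<bullet> b \<le> u \<bullet> b"
    obtain S where S: "orthogonal_transformation S" "\<And>x. R (S x) = x" "\<And>x. S (R x) = x"
      using orth by (metis bij_is_surj inv_f_f orthogonal_transformation_bij
        orthogonal_transformation_inj orthogonal_transformation_inv surj_f_inv_f)
    have eq: "R -` box l u = S ` box l u"
      using S by (auto simp: image_iff) metis
    have "emeasure (distr lborel borel R) (box l u) = emeasure lborel (R -` box l u)"
      by (subst emeasure_distr) auto
    also have "\<dots> = emeasure lebesgue (S ` box l u)"
      unfolding eq[symmetric]
      using measurable_sets_borel[OF \<open>R \<in> borel_measurable borel\<close>, of "box l u"] by simp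
    also have "\<dots> = ennreal (measure lebesgue (S ` box l u))"
      by (rule emeasure_eq_measure2[OF measurable_orthogonal_image[OF S(1)]]) simp
    also have "\<dots> = ennreal (measure lebesgue (box l u))"
      by (subst measure_orthogonal_image[OF S(1)]) auto
    also have "\<dots> = (\<Prod>b\<in>Basis. (u - l) \<bullet> b)"
      using le by (simp add: measure_lborel_box)
    finally show "emeasure (distr lborel borel R) (box l u) = (\<Prod>b\<in>Basis. (u - l) \<bullet> b)" .
  qed simp
  have "distr lborel borel (\<lambda>z. w * z) = distr (distr lborel borel ?g) borel (\<lambda>z. w * z)"
    by (simp add: distr_lborel_Complex)
  also have "\<dots> = distr lborel borel (\<lambda>x. w * ?g x)"
    by (subst distr_distr) (auto simp: o_def)
  also have "\<dots> = distr lborel borel (\<lambda>x. ?g (R x))"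
    by (simp add: gR)
  also have "\<dots> = distr (distr lborel borel R) borel ?g"
    by (subst distr_distr) (auto simp: o_def)
  also have "\<dots> = lborel"
    by (simp add: distrR distr_lborel_Complex)
  finally show ?thesis .
qed

section \<open>Rotation invariance and radial moments of \<open>dA\<close>\<close>

lemma sets_dA [measurable_cong]: "sets (dA \<alpha>) = sets (restrict_space borel (ball 0 1))"
  by (simp add: dA_def sets_restrict_space)

lemma space_dA [simp]: "space (dA \<alpha>) = ball 0 1"
  by (simp add: dA_def space_restrict_space)

lemma borel_measurable_dA [measurable (raw)]:
  "f \<in> borel_measurable borel \<Longrightarrow> f \<in> borel_measurable (dA \<alpha>)"
  by (simp add: measurable_cong_sets[OF sets_dA refl] measurable_restrict_space1)

lemma nn_integral_dA:
  assumes "f \<in> borel_measurable borel"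
  shows "(\<integral>\<^sup>+z. f z \<partial>dA \<alpha>) =
    (\<integral>\<^sup>+z. ennreal ((\<alpha> + 1) / pi * (1 - (cmod z)\<^sup>2) powr \<alpha>) * f z * indicator (ball 0 1) z \<partial>lborel)"
  unfolding dA_def using assms
  by (subst nn_integral_density)
     (auto simp: measurable_restrict_space1 nn_integral_restrict_space)

lemma nn_integral_dA_rotation:
  assumes [measurable]: "f \<in> borel_measurable borel" and w: "cmod w = 1"
  shows "(\<integral>\<^sup>+z. f (w * z) \<partial>dA \<alpha>) = (\<integral>\<^sup>+z. f z \<partial>dA \<alpha>)"
proof -
  let ?F = "\<lambda>z. ennreal ((\<alpha> + 1) / pi * (1 - (cmod z)\<^sup>2) powr \<alpha>) * f z * indicator (ball 0 1) z"
  have "(\<integral>\<^sup>+z. f z \<partial>dA \<alpha>) = (\<integral>\<^sup>+z. ?F z \<partial>distr lborel borel (\<lambda>z. w * z))"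
    unfolding distr_lborel_rotation[OF w] by (rule nn_integral_dA) fact
  also have "\<dots> = (\<integral>\<^sup>+z. ?F (w * z) \<partial>lborel)"
    by (rule nn_integral_distr) (auto intro!: borel_measurable_times_ennreal borel_measurable_indicator)
  also have "\<dots> = (\<integral>\<^sup>+z. f (w * z) \<partial>dA \<alpha>)"
    by (subst nn_integral_dA) (auto simp: norm_mult w indicator_def intro!: nn_integral_cong)
  finally show ?thesis ..
qed

text \<open>The disk of squared radius x has area pi * x, so the squared modulus is uniformly
  distributed with total mass pi. In the variable s = |z|^2 a radial integral against
  \<open>dA\<close> becomes an integral over {0..1}, and for monomials a Beta integral.\<close>

lemma distr_norm_square_ball:
  "distr (restrict_space lborel (ball 0 1)) borel (\<lambda>z::complex. (cmod z)\<^sup>2)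
     = density lborel (\<lambda>x. ennreal pi * indicator {0..1} x)" (is "?M = ?N")
proof (rule measure_eqI_lessThan)
  have m: "(\<lambda>z::complex. (cmod z)\<^sup>2) \<in> restrict_space lborel (ball 0 1) \<rightarrow>\<^sub>M borel"
    by (intro measurable_restrict_space1) measurable
  have area: "emeasure lborel (ball (0::complex) 1) = ennreal pi"
    using emeasure_ball[of 1 "0::complex"] by (simp add: unit_ball_vol_2)
  have carea: "emeasure lborel (cball (0::complex) r) = ennreal (pi * r\<^sup>2)" if "r \<ge> 0" for r
    using emeasure_cball[of r "0::complex"] that by (simp add: unit_ball_vol_2)
  have L: "emeasure ?M {x<..} = emeasure lborel {z \<in> ball (0::complex) 1. x < (cmod z)\<^sup>2}" for x
    using m by (subst emeasure_distr)
      (auto simp: emeasure_restrict_space space_restrict_space intro!: arg_cong[where f = "emeasure lborel"])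
  have R: "emeasure ?N {x<..} = ennreal pi * emeasure lborel ({0..1} \<inter> {x<..})" for x
    by (subst emeasure_density)
       (auto simp: nn_integral_cmult indicator_inter_arith mult.assoc
         simp flip: nn_integral_indicator indicator_inter_arith)
  show "emeasure ?M {x<..} = emeasure ?N {x<..}" for x
  proof -
    consider "x < 0" | "0 \<le> x" "x < 1" | "x \<ge> 1" by linarith
    then show ?thesis
    proof cases
      case 1
      then have "{z \<in> ball (0::complex) 1. x < (cmod z)\<^sup>2} = ball 0 1"
        by (auto intro: less_le_trans)
      moreover have "{0..1} \<inter> {x<..} = {0..1}" using 1 by auto
      ultimately show ?thesis unfolding L R by (simp add: area)
    next
      case 2
      have sx: "sqrt x < 1" using 2 by simp
      have *: "x < (cmod z)\<^sup>2 \<longleftrightarrow> sqrt x < cmod z" for z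
        using real_sqrt_less_iff[of x "(cmod z)\<^sup>2"] by simp
      have "{z \<in> ball (0::complex) 1. x < (cmod z)\<^sup>2} = ball 0 1 - cball 0 (sqrt x)"
        unfolding * by (auto simp: not_le)
      also have "emeasure lborel \<dots> = emeasure lborel (ball (0::complex) 1) - emeasure lborel (cball (0::complex) (sqrt x))"
        using 2 by (intro emeasure_Diff) (auto simp: carea intro: le_less_trans[OF _ sx])
      also have "\<dots> = ennreal pi - ennreal (pi * x)"
        using carea[of "sqrt x"] 2 by (simp only: area) simp
      also have "\<dots> = ennreal (pi - pi * x)"
        using 2 by (intro ennreal_minus) simp
      finally have l: "emeasure ?M {x<..} = ennreal (pi - pi * x)" unfolding L .
      have "{0..1} \<inter> {x<..} = {x<..1}" using 2 by auto
      then show ?thesis unfolding l R using 2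
        by (simp add: ennreal_mult[symmetric] algebra_simps)
    next
      case 3
      have "(cmod z)\<^sup>2 < 1" if "z \<in> ball 0 1" for z
        using that by (simp add: abs_square_less_1)
      then have "{z \<in> ball (0::complex) 1. x < (cmod z)\<^sup>2} = {}"
        using 3 by fastforce
      moreover have "{0..1} \<inter> {x<..} = {}" using 3 by auto
      ultimately show ?thesis unfolding L R by (simp only:) simp
    qed
  qed
  show "emeasure ?M {x<..} < \<infinity>" for x
  proof -
    have "emeasure ?M {x<..} \<le> emeasure lborel (ball (0::complex) 1)"
      unfolding L by (rule emeasure_mono) auto
    also have "\<dots> < \<infinity>"
      unfolding area by simp
    finally show ?thesis .
  qed
qed auto

lemma nn_integral_dA_moment:
  assumes "\<alpha> > -1"
  shows "(\<integral>\<^sup>+z. ennreal (cmod z ^ (2 * j)) \<partial>dA \<alpha>) = ennreal (fact j / pochhammer (\<alpha> + 2) j)"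
proof -
  let ?h = "\<lambda>s. ennreal ((\<alpha> + 1) / pi * (1 - s) powr \<alpha>) * ennreal (s ^ j)"
  have "(\<integral>\<^sup>+z. ennreal (cmod z ^ (2 * j)) \<partial>dA \<alpha>) =
    (\<integral>\<^sup>+z. ?h ((cmod z)\<^sup>2) \<partial>restrict_space lborel (ball 0 1))"
    unfolding dA_def
    by (subst nn_integral_density) (auto intro!: measurable_restrict_space1 simp: power_mult)
  also have "\<dots> = (\<integral>\<^sup>+s. ?h s \<partial>distr (restrict_space lborel (ball 0 1)) borel (\<lambda>z::complex. (cmod z)\<^sup>2))"
    by (subst nn_integral_distr) (auto intro!: measurable_restrict_space1)
  also have "\<dots> = (\<integral>\<^sup>+s. ennreal pi * indicator {0..1} s * ?h s \<partial>lborel)"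
    unfolding distr_norm_square_ball by (subst nn_integral_density) auto
  also have "\<dots> = (\<integral>\<^sup>+s. ennreal ((\<alpha> + 1) * (s powr (real j + 1 - 1) * (1 - s) powr (\<alpha> + 1 - 1))) * indicator {0..1} s \<partial>lborel)"
  \<comment> \<open>The point s = 0 must be excluded: for j = 0 the left side has
    \<open>0 ^ 0 = 1\<close>, the right side \<open>0 powr 0 = 0\<close>.\<close>
  proof (rule nn_integral_cong_AE, rule AE_mp[OF AE_lborel_singleton[of 0]], intro AE_I2 impI)
    fix s :: real assume s: "s \<noteq> 0"
    show "ennreal pi * indicator {0..1} s * ?h s =
      ennreal ((\<alpha> + 1) * (s powr (real j + 1 - 1) * (1 - s) powr (\<alpha> + 1 - 1))) * indicator {0..1} s"
    proof (cases "s \<in> {0..1}")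
      case True
      then have "s > 0" using s by auto
      then show ?thesis using True assms
        by (simp add: ennreal_mult[symmetric] powr_realpow mult_ac)
    qed simp
  qed
  also have "\<dots> = ennreal ((\<alpha> + 1) * Beta (real j + 1) (\<alpha> + 1))"
  proof (rule nn_integral_has_integral_lebesgue')
    show "((\<lambda>s. (\<alpha> + 1) * (s powr (real j + 1 - 1) * (1 - s) powr (\<alpha> + 1 - 1))) has_integral
      (\<alpha> + 1) * Beta (real j + 1) (\<alpha> + 1)) {0..1}"
      using assms by (intro has_integral_mult_right has_integral_Beta_real) auto
  qed (use assms in auto)
  also have "(\<alpha> + 1) * Beta (real j + 1) (\<alpha> + 1) = fact j / pochhammer (\<alpha> + 2) j"
  proof -
    have "Gamma (\<alpha> + 2) = (\<alpha> + 1) * Gamma (\<alpha> + 1)"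
      using Gamma_plus1[of "\<alpha> + 1"] assms by (auto simp: nonpos_Ints_def add_ac)
    moreover have "pochhammer (\<alpha> + 2) j = Gamma (\<alpha> + 2 + j) / Gamma (\<alpha> + 2)"
      using assms by (intro pochhammer_Gamma) (auto simp: nonpos_Ints_def)
    moreover have "Gamma (real j + 1) = fact j"
      using Gamma_fact[of j, where 'a = real] by (simp add: add_ac)
    ultimately show ?thesis by (simp add: Beta_def add_ac)
  qed
  finally show ?thesis .
qed

lemma emeasure_dA_ball: "\<alpha> > -1 \<Longrightarrow> emeasure (dA \<alpha>) (ball 0 1) = 1"
  using nn_integral_dA_moment[of \<alpha> 0] by simp

text \<open>Averaging over the K-th roots of unity removes the cross terms with i different from j,
  because a geometric sum of powers of a nontrivial K-th root of unity vanishes. This discrete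
  orthogonality takes the place of integration over the angle; all indices lie below
  \<open>K\<close>, so distinct indices give distinct roots.\<close>

lemma sum_norm_square_rotations:
  fixes c :: "nat \<Rightarrow> complex" and z :: complex
  assumes K: "K > 0"
  shows "(\<Sum>k<K. (cmod (\<Sum>j<K. c j * (cis (2 * pi * real k / real K) * z) ^ j))\<^sup>2)
    = real K * (\<Sum>j<K. (cmod (c j))\<^sup>2 * cmod z ^ (2 * j))"
proof -
  define w where "w k = cis (2 * pi * real k / real K)" for k
  have bij: "bij_betw w {..<K} {z. z ^ K = 1}"
    unfolding w_def using Complex.bij_betw_roots_unity[OF K] by simp
  \<comment> \<open>Exchanging the two indices makes the sum over the rotations a geometric sum with
    ratio \<open>w i * cnj (w j)\<close>.\<close>
  have wpow: "w k ^ j = w j ^ k" for j k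
    unfolding w_def Complex.DeMoivre by (simp add: mult_ac)
  have wcnjpow: "cnj (w k) ^ j = cnj (w j) ^ k" for j k
    using wpow[of k j] by (metis complex_cnj_power)
  have wcnj: "w j * cnj (w j) = 1" for j
    by (simp add: w_def complex_eq_iff)
  have geo: "(\<Sum>k<K. (w i * cnj (w j)) ^ k) = (if i = j then of_nat K else 0)"
    if ij: "i < K" "j < K" for i j
  proof (cases "i = j")
    case False
    have "w i \<noteq> w j"
      using bij ij False by (auto simp: bij_betw_def inj_on_def)
    then have ne: "w i * cnj (w j) \<noteq> 1"
      using wcnj[of j] by (metis mult.assoc mult.commute mult.right_neutral)
    have "w i ^ K = 1" "w j ^ K = 1"
      using bij ij by (auto simp: bij_betw_def)
    then have "(w i * cnj (w j)) ^ K = 1"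
      by (simp add: power_mult_distrib flip: complex_cnj_power)
    then show ?thesis
      using ne False by (simp add: geometric_sum)
  qed (simp add: wcnj)
  have "complex_of_real (\<Sum>k<K. (cmod (\<Sum>j<K. c j * (w k * z) ^ j))\<^sup>2)
    = (\<Sum>k<K. \<Sum>i<K. \<Sum>j<K. c i * z ^ i * cnj (c j * z ^ j) * (w i * cnj (w j)) ^ k)"
    unfolding of_real_sum complex_norm_square cnj_sum sum_product
    by (simp add: power_mult_distrib wpow wcnjpow mult_ac)
  also have "\<dots> = (\<Sum>i<K. \<Sum>k<K. \<Sum>j<K. c i * z ^ i * cnj (c j * z ^ j) * (w i * cnj (w j)) ^ k)"
    by (rule sum.swap)
  also have "\<dots> = (\<Sum>i<K. \<Sum>j<K. \<Sum>k<K. c i * z ^ i * cnj (c j * z ^ j) * (w i * cnj (w j)) ^ k)"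
    by (intro sum.cong refl sum.swap)
  also have "\<dots> = (\<Sum>i<K. \<Sum>j<K. if i = j then of_nat K * (c i * z ^ i * cnj (c i * z ^ i)) else 0)"
    by (intro sum.cong refl) (auto simp: geo simp flip: sum_distrib_left)
  also have "\<dots> = (\<Sum>i<K. of_nat K * (c i * z ^ i * cnj (c i * z ^ i)))"
    by (intro sum.cong refl) simp
  also have "\<dots> = complex_of_real (real K * (\<Sum>j<K. (cmod (c j))\<^sup>2 * cmod z ^ (2 * j)))"
  proof -
    have "complex_of_real (cmod x ^ (2 * i)) = x ^ i * cnj x ^ i" for x i
    proof -
      have "complex_of_real (cmod x ^ (2 * i)) = (complex_of_real ((cmod x)\<^sup>2)) ^ i"
        by (simp add: power_mult)
      then show ?thesis
        by (simp only: complex_norm_square power_mult_distrib)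
    qed
    from this[of z] this[of _ 1] show ?thesis
      by (simp add: sum_distrib_left mult_ac power2_eq_square)
  qed
  finally show ?thesis
    unfolding w_def by (simp only: of_real_eq_iff)
qed

text \<open>The rotations by K-th roots of unity preserve \<open>dA\<close> and the ball, so
  \<open>K\<close> copies of the integral can be added under the integral sign. The cutoff at radius
  \<open>r\<close> is kept because the partial sums of a power series are uniformly bounded only on
  smaller disks.\<close>

lemma nn_integral_dA_polynomial:
  fixes c :: "nat \<Rightarrow> complex"
  shows "(\<integral>\<^sup>+z. ennreal ((cmod (\<Sum>j<K. c j * z ^ j))\<^sup>2) * indicator (ball 0 r) z \<partial>dA \<alpha>)
    = (\<Sum>j<K. ennreal ((cmod (c j))\<^sup>2) * (\<integral>\<^sup>+z. ennreal (cmod z ^ (2 * j)) * indicator (ball 0 r) z \<partial>dA \<alpha>))"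
    (is "?I = ?S")
proof (cases "K = 0")
  case False
  let ?f = "\<lambda>z. ennreal ((cmod (\<Sum>j<K. c j * z ^ j))\<^sup>2) * indicator (ball 0 r) z"
  let ?w = "\<lambda>k. cis (2 * pi * real k / real K)"
  have [measurable]: "?f \<in> borel_measurable borel"
    by (intro borel_measurable_times_ennreal borel_measurable_indicator) auto
  have [measurable]: "(\<lambda>z. ?f (v * z)) \<in> borel_measurable borel" for v
    by (rule measurable_compose[of "\<lambda>z. v * z" borel borel ?f]) simp_all
  have "of_nat K * ?I = (\<Sum>k<K. \<integral>\<^sup>+z. ?f (?w k * z) \<partial>dA \<alpha>)"
    by (subst nn_integral_dA_rotation) auto
  also have "\<dots> = (\<integral>\<^sup>+z. (\<Sum>k<K. ?f (?w k * z)) \<partial>dA \<alpha>)"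
    by (rule nn_integral_sum[symmetric]) auto
  also have "\<dots> = (\<integral>\<^sup>+z. (\<Sum>j<K. of_nat K * (ennreal ((cmod (c j))\<^sup>2) * (ennreal (cmod z ^ (2 * j)) * indicator (ball 0 r) z))) \<partial>dA \<alpha>)"
  proof (rule nn_integral_cong)
    fix z
    have "(\<Sum>k<K. ?f (?w k * z)) =
      (\<Sum>k<K. ennreal ((cmod (\<Sum>j<K. c j * (?w k * z) ^ j))\<^sup>2)) * indicator (ball 0 r) z"
      unfolding sum_distrib_right
      by (intro sum.cong refl arg_cong2[where f = times]) (auto simp: norm_mult indicator_def)
    also have "\<dots> = ennreal (real K * (\<Sum>j<K. (cmod (c j))\<^sup>2 * cmod z ^ (2 * j))) * indicator (ball 0 r) z"
      using False by (subst sum_ennreal) (auto simp: sum_norm_square_rotations)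
    also have "\<dots> = (\<Sum>j<K. of_nat K * (ennreal ((cmod (c j))\<^sup>2) * (ennreal (cmod z ^ (2 * j)) * indicator (ball 0 r) z)))"
      by (simp add: sum_distrib_left sum_distrib_right ennreal_mult mult_ac sum_nonneg
          ennreal_of_nat_eq_real_of_nat flip: sum_ennreal)
    finally show "(\<Sum>k<K. ?f (?w k * z)) = \<dots>" .
  qed
  also have "\<dots> = of_nat K * ?S"
  proof -
    have [measurable]: "(\<lambda>z. ennreal (cmod z ^ (2 * j)) * indicator (ball 0 r) z) \<in> borel_measurable (dA \<alpha>)" for j
      by (intro borel_measurable_times_ennreal borel_measurable_dA borel_measurable_indicator) auto
    show ?thesis
      unfolding sum_distrib_left by (simp add: nn_integral_sum nn_integral_cmult)
  qed
  finally show ?thesis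
    using False by (simp add: ennreal_mult_cancel_left)
qed simp

text \<open>Parseval's identity with values in [0, infinity]. One inequality is Fatou's lemma along
  the partial sums. For the other, dominated convergence applies on each disk of radius r < 1, and r
  then tends to 1 in finitely many terms at a time.\<close>

theorem nn_integral_dA_power_series:
  fixes F :: "complex \<Rightarrow> complex"
  assumes \<alpha>: "\<alpha> > -1" and F: "\<And>z. cmod z < 1 \<Longrightarrow> (\<lambda>j. c j * z ^ j) sums F z"
  shows "(\<integral>\<^sup>+z. ennreal ((cmod (F z))\<^sup>2) \<partial>dA \<alpha>) =
    (\<Sum>j. ennreal (fact j / pochhammer (\<alpha> + 2) j * (cmod (c j))\<^sup>2))" (is "?I = ?S")
proof (rule antisym)
  let ?P = "\<lambda>K z. (\<Sum>j<K. c j * z ^ j)"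
  let ?D = "\<lambda>j. fact j / pochhammer (\<alpha> + 2) j"
  let ?E = "\<lambda>j r. \<integral>\<^sup>+z. ennreal (cmod z ^ (2 * j)) * indicator (ball 0 r) z \<partial>dA \<alpha>"
  have D: "?D j \<ge> 0" for j
    using \<alpha> by (intro divide_nonneg_nonneg pochhammer_nonneg) auto
  have lim: "(\<lambda>K. ?P K z) \<longlonglongrightarrow> F z" if "z \<in> ball 0 1" for z
    using F[of z] that by (simp add: sums_def)
  have lim2: "(\<lambda>K. ennreal ((cmod (?P K z))\<^sup>2)) \<longlonglongrightarrow> ennreal ((cmod (F z))\<^sup>2)" if "z \<in> ball 0 1" for z
    using lim[OF that] by (intro tendsto_ennrealI tendsto_intros) auto
  have int_P: "(\<integral>\<^sup>+z. ennreal ((cmod (?P K z))\<^sup>2) \<partial>dA \<alpha>) = (\<Sum>j<K. ennreal (?D j * (cmod (c j))\<^sup>2))" for K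
  proof -
    have "(\<integral>\<^sup>+z. ennreal ((cmod (?P K z))\<^sup>2) \<partial>dA \<alpha>)
      = (\<integral>\<^sup>+z. ennreal ((cmod (?P K z))\<^sup>2) * indicator (ball 0 1) z \<partial>dA \<alpha>)"
      by (intro nn_integral_cong) simp
    also have "\<dots> = (\<Sum>j<K. ennreal ((cmod (c j))\<^sup>2) * ?E j 1)"
      by (rule nn_integral_dA_polynomial)
    also have "\<dots> = (\<Sum>j<K. ennreal (?D j * (cmod (c j))\<^sup>2))"
    proof (rule sum.cong)
      fix j
      have "?E j 1 = (\<integral>\<^sup>+z. ennreal (cmod z ^ (2 * j)) \<partial>dA \<alpha>)"
        by (intro nn_integral_cong) simp
      then show "ennreal ((cmod (c j))\<^sup>2) * ?E j 1 = ennreal (?D j * (cmod (c j))\<^sup>2)"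
        using D[of j] by (simp only: nn_integral_dA_moment[OF \<alpha>]) (simp add: ennreal_mult[symmetric] mult_ac)
    qed simp
    finally show ?thesis .
  qed
  have "?I = (\<integral>\<^sup>+z. liminf (\<lambda>K. ennreal ((cmod (?P K z))\<^sup>2)) \<partial>dA \<alpha>)"
    by (intro nn_integral_cong lim_imp_Liminf[symmetric] lim2) auto
  also have "\<dots> \<le> liminf (\<lambda>K. \<integral>\<^sup>+z. ennreal ((cmod (?P K z))\<^sup>2) \<partial>dA \<alpha>)"
    by (rule nn_integral_liminf) (auto intro!: borel_measurable_dA)
  also have "\<dots> = ?S"
    unfolding int_P by (intro lim_imp_Liminf summable_LIMSEQ) auto
  finally show "?I \<le> ?S" .
  have [measurable]: "F \<in> borel_measurable (dA \<alpha>)"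
    by (rule borel_measurable_LIMSEQ_metric[of ?P]) (auto intro!: borel_measurable_dA lim)
  have r_bound: "(\<Sum>j<N. ennreal ((cmod (c j))\<^sup>2) * ?E j r) \<le> ?I" if r: "0 < r" "r < 1" for r N
  proof -
    have summ: "summable (\<lambda>j. cmod (c j) * r ^ j)"
    proof -
      obtain s where s: "r < s" "s < 1" using r dense by blast
      have "summable (\<lambda>j. c j * of_real s ^ j)"
        using F[of "of_real s"] s r by (auto simp: sums_iff)
      then have "summable (\<lambda>j. norm (c j * of_real r ^ j))"
        using powser_insidea[of c "of_real s" "of_real r :: complex"] s r by simp
      then show ?thesis using r by (simp add: norm_mult norm_power)
    qed
    define M where "M = (\<Sum>j. cmod (c j) * r ^ j)"
    have PM: "cmod (?P K z) \<le> M" if "z \<in> ball 0 r" for K z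
    proof -
      have "cmod (?P K z) \<le> (\<Sum>j<K. cmod (c j * z ^ j))" by (rule norm_sum)
      also have "\<dots> \<le> (\<Sum>j<K. cmod (c j) * r ^ j)"
        using that by (intro sum_mono) (auto simp: norm_mult norm_power intro!: mult_left_mono power_mono)
      also have "\<dots> \<le> M"
        unfolding M_def using summ r by (intro sum_le_suminf) auto
      finally show ?thesis .
    qed
    have "(\<lambda>K. \<integral>\<^sup>+z. ennreal ((cmod (?P K z))\<^sup>2) * indicator (ball 0 r) z \<partial>dA \<alpha>) \<longlonglongrightarrow>
      (\<integral>\<^sup>+z. ennreal ((cmod (F z))\<^sup>2) * indicator (ball 0 r) z \<partial>dA \<alpha>)"
    proof (rule nn_integral_dominated_convergence[where w = "\<lambda>z. ennreal (M\<^sup>2)"])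
      show "AE z in dA \<alpha>. ennreal ((cmod (?P K z))\<^sup>2) * indicator (ball 0 r) z \<le> ennreal (M\<^sup>2)" for K
        using PM by (auto simp: indicator_def intro!: AE_I2 ennreal_leI power_mono)
      show "(\<integral>\<^sup>+z. ennreal (M\<^sup>2) \<partial>dA \<alpha>) < \<infinity>"
        by (simp add: emeasure_dA_ball[OF \<alpha>])
      show "AE z in dA \<alpha>. (\<lambda>K. ennreal ((cmod (?P K z))\<^sup>2) * indicator (ball 0 r) z) \<longlonglongrightarrow>
          ennreal ((cmod (F z))\<^sup>2) * indicator (ball 0 r) z"
        by (rule AE_I2) (use lim2 in \<open>auto simp: indicator_def\<close>)
      show "(\<lambda>z. ennreal ((cmod (F z))\<^sup>2) * indicator (ball 0 r) z) \<in> borel_measurable (dA \<alpha>)"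
        by (intro borel_measurable_times_ennreal borel_measurable_dA[OF borel_measurable_indicator]) auto
    qed (auto intro!: borel_measurable_times_ennreal borel_measurable_dA borel_measurable_indicator)
    then have "(\<lambda>K. \<Sum>j<K. ennreal ((cmod (c j))\<^sup>2) * ?E j r) \<longlonglongrightarrow>
      (\<integral>\<^sup>+z. ennreal ((cmod (F z))\<^sup>2) * indicator (ball 0 r) z \<partial>dA \<alpha>)"
      by (simp only: nn_integral_dA_polynomial)
    then have "(\<Sum>j<N. ennreal ((cmod (c j))\<^sup>2) * ?E j r) \<le>
       (\<integral>\<^sup>+z. ennreal ((cmod (F z))\<^sup>2) * indicator (ball 0 r) z \<partial>dA \<alpha>)"
      by (rule incseq_le[rotated]) (auto intro!: incseq_SucI)
    also have "\<dots> \<le> ?I"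
      by (intro nn_integral_mono) (auto simp: indicator_def)
    finally show ?thesis .
  qed
  have E_lim: "(\<lambda>n. ?E j (1 - 1 / real (Suc n))) \<longlonglongrightarrow> ennreal (?D j)" for j
  proof -
    let ?f = "\<lambda>n z. ennreal (cmod z ^ (2 * j)) * indicator (ball 0 (1 - 1 / real (Suc n))) z"
    have lims: "(\<lambda>n. ?f n z) \<longlonglongrightarrow> ennreal (cmod z ^ (2 * j))" if "z \<in> ball 0 1" for z
    proof (rule tendsto_eventually)
      have "(\<lambda>n. 1 - 1 / real (Suc n)) \<longlonglongrightarrow> 1 - 0"
        using LIMSEQ_inverse_real_of_nat by (intro tendsto_intros) (simp add: inverse_eq_divide)
      then have "\<forall>\<^sub>F n in sequentially. cmod z < 1 - 1 / real (Suc n)"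
        using that by (intro order_tendstoD) auto
      then show "\<forall>\<^sub>F n in sequentially. ?f n z = ennreal (cmod z ^ (2 * j))"
        by eventually_elim auto
    qed
    have "(\<lambda>n. \<integral>\<^sup>+z. ?f n z \<partial>dA \<alpha>) \<longlonglongrightarrow> (\<integral>\<^sup>+z. ennreal (cmod z ^ (2 * j)) \<partial>dA \<alpha>)"
    proof (rule nn_integral_dominated_convergence[where w = "\<lambda>z. ennreal (cmod z ^ (2 * j))"])
      show "(\<integral>\<^sup>+z. ennreal (cmod z ^ (2 * j)) \<partial>dA \<alpha>) < \<infinity>"
        by (simp add: nn_integral_dA_moment[OF \<alpha>])
      show "AE z in dA \<alpha>. (\<lambda>n. ?f n z) \<longlonglongrightarrow> ennreal (cmod z ^ (2 * j))"
        by (rule AE_I2, rule lims) simp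
    qed (auto simp: indicator_def intro!: AE_I2 borel_measurable_times_ennreal borel_measurable_dA borel_measurable_indicator)
    then show ?thesis by (simp only: nn_integral_dA_moment[OF \<alpha>])
  qed
  have "(\<Sum>j<N. ennreal (?D j * (cmod (c j))\<^sup>2)) \<le> ?I" for N
  proof (rule LIMSEQ_le_const2)
    have "(\<lambda>n. \<Sum>j<N. ennreal ((cmod (c j))\<^sup>2) * ?E j (1 - 1 / real (Suc n))) \<longlonglongrightarrow>
       (\<Sum>j<N. ennreal ((cmod (c j))\<^sup>2) * ennreal (?D j))"
      by (intro tendsto_sum ennreal_tendsto_cmult E_lim) auto
    then show "(\<lambda>n. \<Sum>j<N. ennreal ((cmod (c j))\<^sup>2) * ?E j (1 - 1 / real (Suc n))) \<longlonglongrightarrow>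
       (\<Sum>j<N. ennreal (?D j * (cmod (c j))\<^sup>2))"
      unfolding ennreal_mult[OF D zero_le_power2] by (simp only: mult.commute)
    show "\<exists>n0. \<forall>n\<ge>n0. (\<Sum>j<N. ennreal ((cmod (c j))\<^sup>2) * ?E j (1 - 1 / real (Suc n))) \<le> ?I"
      \<comment> \<open>For n = 0 the radius 1 - 1 / Suc n is 0, which \<open>r_bound\<close>
        excludes.\<close>
      by (rule exI[of _ 1]) (intro allI impI r_bound; simp)
  qed
  then show "?S \<le> ?I"
    by (intro suminf_le_const) auto
qed

section \<open>The quadratic forms\<close>

text \<open>By Gauss's product formula \<open>pochhammer x n\<close> grows like fact (n - 1) * n
  powr x / Gamma x. Two factors stand on either side so that the factorials cancel, and the quotient
  of the \<open>Gamma_series'\<close> terms is bounded because it converges.\<close>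

lemma pochhammer_ratio_bound:
  fixes x y u v :: real
  assumes pos: "x > 0" "y > 0" "u > 0" "v > 0"
  shows "\<exists>C>0. \<forall>n>0. pochhammer x n * pochhammer y n
    \<le> C * (pochhammer u n * pochhammer v n * real n powr (x + y - u - v))"
proof -
  let ?G = "Gamma_series' :: real \<Rightarrow> nat \<Rightarrow> real"
  let ?R = "\<lambda>n. (?G u n * ?G v n) / (?G x n * ?G y n)"
  have nz: "Gamma x \<noteq> 0" "Gamma y \<noteq> 0"
    using pos by (auto simp: Gamma_eq_zero_iff nonpos_Ints_def)
  have "?R \<longlonglongrightarrow> (Gamma u * Gamma v) / (Gamma x * Gamma y)"
    using nz by (intro tendsto_intros Gamma_series'_LIMSEQ) auto
  then have "Bseq ?R"
    by (intro convergent_imp_Bseq convergentI)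
  then obtain C where C: "C > 0" "\<And>n. norm (?R n) \<le> C"
    by (auto simp: Bseq_def)
  show ?thesis
  proof (intro exI[of _ C] conjI allI impI C)
    fix n :: nat assume n: "n > 0"
    let ?e = "\<lambda>t::real. real n powr t"
    have p: "pochhammer x n > 0" "pochhammer y n > 0" "pochhammer u n > 0" "pochhammer v n > 0"
      using pos by (auto intro: pochhammer_pos)
    have e': "exp (t * ln (real n)) = ?e t" for t :: real
      using n by (simp add: powr_def)
    have "?R n = (?e u * ?e v) / (?e x * ?e y) * (pochhammer x n * pochhammer y n) / (pochhammer u n * pochhammer v n)"
      using p n by (simp add: Gamma_series'_def e' field_simps)
    also have "(?e u * ?e v) / (?e x * ?e y) = 1 / ?e (x + y - u - v)"
      using n by (simp add: powr_diff powr_add)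
    finally have "(pochhammer x n * pochhammer y n) / (pochhammer u n * pochhammer v n * ?e (x + y - u - v)) \<le> C"
      using abs_le_D1[OF C(2)[of n, unfolded real_norm_def]] by (simp add: field_simps)
    then show "pochhammer x n * pochhammer y n \<le> C * (pochhammer u n * pochhammer v n * ?e (x + y - u - v))"
      using p n by (simp add: field_simps)
  qed
qed

section \<open>Binomial series and quadratic forms\<close>

lemma negative_binomial_real:
  fixes x d :: real
  assumes "\<bar>x\<bar> < 1"
  shows "(\<lambda>n. pochhammer d n / fact n * x ^ n) sums (1 - x) powr (- d)"
proof -
  have "(- d gchoose n) * (- x) ^ n = pochhammer d n / fact n * x ^ n" for n
    by (simp add: gbinomial_pochhammer power_minus[of x])
  then show ?thesis
    using gen_binomial_real[of "-x" "-d"] assms by simp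
qed

lemma negative_binomial_complex:
  fixes z :: complex and d :: real
  assumes "cmod z < 1"
  shows "(\<lambda>n. of_real (pochhammer d n / fact n) * z ^ n) sums (1 - z) powr (- of_real d)"
proof -
  have "(- complex_of_real d gchoose n) * (- z) ^ n = of_real (pochhammer d n / fact n) * z ^ n" for n
    by (simp add: gbinomial_pochhammer power_minus[of z] pochhammer_of_real)
  then show ?thesis
    using gen_binomial_complex[of "-z" "- of_real d"] assms by simp
qed

lemma negative_binomial_complex_nat:
  fixes z :: complex
  assumes "cmod z < 1"
  shows "(\<lambda>n. of_real (pochhammer (real M) n / fact n) * z ^ n) sums (1 / (1 - z) ^ M)"
proof -
  have "1 - z \<noteq> 0" using assms by auto
  then have "(1 - z) powr (- of_real (real M)) = 1 / (1 - z) ^ M"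
    by (simp add: powr_minus powr_nat' field_simps)
  then show ?thesis
    using negative_binomial_complex[OF assms, of "real M"] by simp
qed

lemma quad_form_of_real:
  "quad_form N M (\<lambda>j. complex_of_real (c j)) = of_real (\<Sum>j\<le>N. \<Sum>k\<le>N. c j * M j k * c k)"
  by (simp add: quad_form_def)

lemma Re_quad_form_of_real:
  "Re (quad_form N M (\<lambda>j. complex_of_real (c j))) = (\<Sum>j\<le>N. \<Sum>k\<le>N. c j * M j k * c k)"
  unfolding quad_form_of_real by simp

lemma quad_form_D_mat:
  "quad_form N (D_mat m a) c = of_real (\<Sum>j\<le>N. D_entry m a j * (cmod (c j))\<^sup>2)"
proof -
  have "quad_form N (D_mat m a) c = (\<Sum>j\<le>N. \<Sum>k\<le>N. if j = k then of_real (D_entry m a j) * (c j * cnj (c j)) else 0)"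
    unfolding quad_form_def D_mat_def by (intro sum.cong refl) (auto simp: mult_ac)
  also have "\<dots> = of_real (\<Sum>j\<le>N. D_entry m a j * (cmod (c j))\<^sup>2)"
    by (simp add: complex_norm_square del: of_real_power)
  finally show ?thesis .
qed

lemma Re_quad_form_le_abs:
  assumes "\<And>j k. j \<le> N \<Longrightarrow> k \<le> N \<Longrightarrow> 0 \<le> M j k"
  shows "Re (quad_form N M c) \<le> (\<Sum>j\<le>N. \<Sum>k\<le>N. cmod (c j) * M j k * cmod (c k))"
proof -
  have "Re (quad_form N M c) \<le> cmod (quad_form N M c)"
    by (rule complex_Re_le_cmod)
  also have "\<dots> \<le> (\<Sum>j\<le>N. \<Sum>k\<le>N. cmod (cnj (c j) * of_real (M j k) * c k))"
    unfolding quad_form_def by (intro sum_norm_le norm_sum)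
  also have "\<dots> = (\<Sum>j\<le>N. \<Sum>k\<le>N. cmod (c j) * M j k * cmod (c k))"
    using assms by (intro sum.cong refl) (auto simp: norm_mult)
  finally show ?thesis .
qed

text \<open>The condition on \<open>2 * real m * a\<close> says that the weight exponent
  \<open>2 * real m * a - 2\<close> exceeds -1.\<close>

locale hilbert_bergman =
  fixes m :: nat and a :: real
  assumes m: "m \<ge> 1" and a: "0 < a" "a < 1" and gam: "2 * real m * a > 1"
begin

abbreviation (input) "gam \<equiv> 2 * real m * a"

lemma gam_pos: "gam > 0" using m a by simp

lemma D_entry_pos: "D_entry m a j > 0"
  unfolding D_entry_def using gam_pos by (intro divide_pos_pos pochhammer_pos) auto

text \<open>The Taylor coefficients of the hypergeometric function 2F1(m + j, m + k; gam; x), which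
  \<open>B_mat\<close> evaluates at x = (1 - y)^2.\<close>

definition "B_term j k n = pochhammer (real (m + j)) n * pochhammer (real (m + k)) n / (pochhammer gam n * fact n)"

lemma B_term_nonneg: "B_term j k n \<ge> 0"
  unfolding B_term_def
  using gam_pos m by (intro divide_nonneg_nonneg mult_nonneg_nonneg pochhammer_nonneg) auto

lemma B_mat_eq: "B_mat m a y j k = y ^ (j + k) * (\<Sum>n. B_term j k n * (1 - y) ^ (2 * n))"
  unfolding B_mat_def B_term_def by simp

text \<open>The parameter 2 m + j + k - gam is the one for which both sides grow with the same power
  of n, so that the exponent in \<open>pochhammer_ratio_bound\<close> is 0. It is positive because a
  < 1. The hypergeometric series is thereby dominated by a binomial series.\<close>

lemma B_term_bound:
  "\<exists>C>0. \<forall>n. B_term j k n \<le> C * (pochhammer (2 * real m + real j + real k - gam) n / fact n)"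
proof -
  let ?d = "2 * real m + real j + real k - gam"
  have "2 * real m * a < 2 * real m * 1"
    using m a by (intro mult_strict_left_mono) auto
  then have d: "?d > 0" by linarith
  have pos: "real (m + j) > 0" "real (m + k) > 0" using m by auto
  obtain C where C: "C > 0" "\<forall>n>0. pochhammer (real (m + j)) n * pochhammer (real (m + k)) n
    \<le> C * (pochhammer gam n * pochhammer ?d n * real n powr (real (m + j) + real (m + k) - gam - ?d))"
    using pochhammer_ratio_bound[OF pos gam_pos d] by blast
  have *: "pochhammer (real (m + j)) n * pochhammer (real (m + k)) n \<le> max C 1 * (pochhammer gam n * pochhammer ?d n)" for n
  proof (cases "n = 0")
    case False
    have "pochhammer (real (m + j)) n * pochhammer (real (m + k)) n \<le> C * (pochhammer gam n * pochhammer ?d n)"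
      using C(2)[rule_format, of n] False by simp
    also have "\<dots> \<le> max C 1 * (pochhammer gam n * pochhammer ?d n)"
      using gam_pos d by (intro mult_right_mono mult_nonneg_nonneg pochhammer_nonneg) auto
    finally show ?thesis .
  qed simp
  have "pochhammer gam n > 0" for n
    using gam_pos by (rule pochhammer_pos)
  then have "B_term j k n \<le> max C 1 * (pochhammer ?d n / fact n)" for n
    using *[of n] by (simp add: B_term_def field_simps)
  then show ?thesis by (intro exI[of _ "max C 1"]) auto
qed

lemma B_series_summable:
  assumes "0 < y" "y < 1"
  shows "summable (\<lambda>n. B_term j k n * (1 - y) ^ (2 * n))"
proof -
  obtain C where C: "C > 0" "\<And>n. B_term j k n \<le> C * (pochhammer (2 * real m + real j + real k - gam) n / fact n)"
    using B_term_bound by blast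
  have "(1 - y)\<^sup>2 < 1" using assms by (simp add: abs_square_less_1)
  then have "summable (\<lambda>n. pochhammer (2 * real m + real j + real k - gam) n / fact n * ((1 - y)\<^sup>2) ^ n)"
    by (intro sums_summable[OF negative_binomial_real]) auto
  then have "summable (\<lambda>n. C * (pochhammer (2 * real m + real j + real k - gam) n / fact n * (1 - y) ^ (2 * n)))"
    by (intro summable_mult) (simp add: power_mult)
  then show ?thesis
  proof (rule summable_comparison_test_ev[rotated], intro always_eventually allI)
    fix n
    show "norm (B_term j k n * (1 - y) ^ (2 * n)) \<le> C * (pochhammer (2 * real m + real j + real k - gam) n / fact n * (1 - y) ^ (2 * n))"
      using mult_right_mono[OF C(2)[of n], of "(1 - y) ^ (2 * n)"] B_term_nonneg[of j k n] by (simp add: abs_mult mult.assoc)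
  qed
qed

text \<open>The binomial series has a singularity of order 2 m + j + k - gam at y = 0, since 1 - (1
  - y)^2 is at least y. The factor y ^ (j + k) removes j + k of this order, which leaves an exponent
  independent of the entry; after the power 1 / (2 m) it becomes a - 1, integrable at 0.\<close>

lemma B_mat_bound:
  "\<exists>C>0. \<forall>y. 0 < y \<longrightarrow> y < 1 \<longrightarrow> B_mat m a y j k \<le> C * y powr (- 2 * real m * (1 - a))"
proof -
  let ?d = "2 * real m + real j + real k - gam"
  obtain C where C: "C > 0" "\<And>n. B_term j k n \<le> C * (pochhammer ?d n / fact n)"
    using B_term_bound by blast
  have "2 * real m * a < 2 * real m * 1"
    using m a by (intro mult_strict_left_mono) auto
  then have d: "?d > 0" by linarith
  show ?thesis
  proof (intro exI[of _ C] conjI allI impI C)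
    fix y :: real assume y: "0 < y" "y < 1"
    have "(1 - y)\<^sup>2 < 1" using y by (simp add: abs_square_less_1)
    then have sm: "(\<lambda>n. pochhammer ?d n / fact n * ((1 - y)\<^sup>2) ^ n) sums (1 - (1 - y)\<^sup>2) powr (- ?d)"
      by (intro negative_binomial_real) auto
    have "(\<Sum>n. B_term j k n * (1 - y) ^ (2 * n)) \<le> (\<Sum>n. C * (pochhammer ?d n / fact n * ((1 - y)\<^sup>2) ^ n))"
    proof (rule suminf_le)
      show "summable (\<lambda>n. C * (pochhammer ?d n / fact n * ((1 - y)\<^sup>2) ^ n))"
        by (intro summable_mult sums_summable[OF sm])
      show "B_term j k n * (1 - y) ^ (2 * n) \<le> C * (pochhammer ?d n / fact n * ((1 - y)\<^sup>2) ^ n)" for n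
        using mult_right_mono[OF C(2)[of n], of "((1 - y)\<^sup>2) ^ n"] by (simp add: power_mult mult.assoc)
    qed (rule B_series_summable[OF y])
    also have "\<dots> = C * (1 - (1 - y)\<^sup>2) powr (- ?d)"
      by (rule sums_unique[OF sums_mult[OF sm], symmetric])
    also have "\<dots> \<le> C * y powr (- ?d)"
    proof -
      have "y * 1 \<le> y * (2 - y)" using y by (intro mult_left_mono) auto
      then have "y \<le> 1 - (1 - y)\<^sup>2" by (simp add: power2_eq_square algebra_simps)
      then show ?thesis
        using y d C(1) by (intro mult_left_mono powr_mono2') auto
    qed
    finally have "B_mat m a y j k \<le> y ^ (j + k) * (C * y powr (- ?d))"
      unfolding B_mat_eq using y by (intro mult_left_mono) auto
    also have "\<dots> = C * y powr (real (j + k) - ?d)"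
      using y by (simp add: powr_diff powr_minus powr_add powr_realpow[symmetric] field_simps)
    also have "real (j + k) - ?d = - 2 * real m * (1 - a)"
      by (simp add: algebra_simps)
    finally show "B_mat m a y j k \<le> C * y powr (- 2 * real m * (1 - a))" .
  qed
qed

lemma B_mat_pos:
  assumes "0 < y" "y < 1"
  shows "B_mat m a y j k > 0"
proof -
  have "(\<Sum>n. B_term j k n * (1 - y) ^ (2 * n)) > 0"
    by (rule suminf_pos2[where i = 0, OF B_series_summable[OF assms]])
       (use assms B_term_nonneg in \<open>auto simp: B_term_def[of _ _ 0]\<close>)
  then show ?thesis
    unfolding B_mat_eq using assms by (intro mult_pos_pos) auto
qed

lemma B_mat_commute: "B_mat m a y j k = B_mat m a y k j"
  by (simp add: B_mat_def add.commute mult.commute)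

lemma borel_measurable_B_mat [measurable]: "(\<lambda>y. B_mat m a y j k) \<in> borel_measurable borel"
  unfolding B_mat_def by measurable

text \<open>Each term of the hypergeometric series is \<open>D_entry m a n\<close> times a matrix of
  rank one, so the form is a weighted sum of squares. The squared numbers are the Taylor
  coefficients of \<open>weighted_comp y\<close> applied to the polynomial with coefficients
  \<open>c\<close>.\<close>

lemma B_form_sums:
  assumes y: "0 < y" "y < 1"
  shows "(\<lambda>n. D_entry m a n * (cmod (\<Sum>j\<le>N. c j * of_real (y ^ j * (pochhammer (real (m + j)) n / fact n) * (1 - y) ^ n)))\<^sup>2)
    sums Re (quad_form N (B_mat m a y) c)"
proof -
  let ?q = "\<lambda>j k n. y ^ (j + k) * (B_term j k n * (1 - y) ^ (2 * n))"
  have "(\<lambda>n. Re (\<Sum>j\<le>N. \<Sum>k\<le>N. cnj (c j) * of_real (?q j k n) * c k))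
     sums Re (\<Sum>j\<le>N. \<Sum>k\<le>N. cnj (c j) * of_real (B_mat m a y j k) * c k)"
    unfolding B_mat_eq
    by (intro sums_Re sums_sum sums_mult sums_mult2 sums_of_real summable_sums B_series_summable y)
  moreover have "Re (\<Sum>j\<le>N. \<Sum>k\<le>N. cnj (c j) * of_real (?q j k n) * c k) =
    D_entry m a n * (cmod (\<Sum>j\<le>N. c j * of_real (y ^ j * (pochhammer (real (m + j)) n / fact n) * (1 - y) ^ n)))\<^sup>2" (is "Re ?l = ?r") for n
  proof -
    let ?t = "\<lambda>j. y ^ j * (pochhammer (real (m + j)) n / fact n) * (1 - y) ^ n"
    have q: "?q j k n = D_entry m a n * (?t j * ?t k)" for j k
      by (simp add: D_entry_def B_term_def power_add power_mult power2_eq_square power_mult_distrib)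
    have "complex_of_real ?r = of_real (D_entry m a n) * ((\<Sum>k\<le>N. c k * of_real (?t k)) * cnj (\<Sum>j\<le>N. c j * of_real (?t j)))"
      by (simp only: of_real_mult complex_norm_square)
    also have "\<dots> = of_real (D_entry m a n) * (\<Sum>j\<le>N. \<Sum>k\<le>N. cnj (c j * of_real (?t j)) * (c k * of_real (?t k)))"
      by (subst mult.commute[of "\<Sum>k\<le>N. c k * of_real (?t k)"]) (simp only: cnj_sum sum_product)
    also have "\<dots> = ?l"
      unfolding q sum_distrib_left by (intro sum.cong refl) simp
    finally show ?thesis
      by (metis Re_complex_of_real)
  qed
  ultimately show ?thesis
    unfolding quad_form_def by simp
qed

lemma B_form_nonneg: "0 < y \<Longrightarrow> y < 1 \<Longrightarrow> 0 \<le> Re (quad_form N (B_mat m a y) c)"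
  by (rule sums_le[OF _ sums_zero B_form_sums]) (auto simp: less_imp_le D_entry_pos)

text \<open>For \<open>F = f ^ m\<close> this is the m-th power of the integrand obtained when
  \<open>hilbert_op f z\<close> is rewritten along the arc. Unlike that integrand it is linear in
  \<open>F\<close> and needs no m-th root of \<open>F\<close>.\<close>

definition weighted_comp :: "real \<Rightarrow> (complex \<Rightarrow> complex) \<Rightarrow> complex \<Rightarrow> complex" where
  "weighted_comp y F z = F (of_real y / (1 - of_real (1 - y) * z)) / (1 - of_real (1 - y) * z) ^ m"

lemma nn_integral_weighted_comp_poly:
  assumes y: "0 < y" "y < 1"
  shows "(\<integral>\<^sup>+z. ennreal ((cmod (weighted_comp y (\<lambda>w. \<Sum>j\<le>N. c j * w ^ j) z))\<^sup>2) \<partial>dA (2 * real m * a - 2))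
    = ennreal (Re (quad_form N (B_mat m a y) c))"
proof -
  \<comment> \<open>The image of w ^ j is y ^ j * (1 - (1 - y) z) ^ -(m + j); its binomial expansion
    gives the n-th Taylor coefficient \<open>e n\<close>.\<close>
  define e where "e n = (\<Sum>j\<le>N. c j * of_real (y ^ j * (pochhammer (real (m + j)) n / fact n) * (1 - y) ^ n))" for n
  have e: "(\<lambda>n. e n * z ^ n) sums weighted_comp y (\<lambda>w. \<Sum>j\<le>N. c j * w ^ j) z" if z: "cmod z < 1" for z
  proof -
    let ?v = "1 - of_real (1 - y) * z"
    have "cmod (of_real (1 - y) * z) < 1 * 1"
      unfolding norm_mult norm_of_real using y z by (intro mult_strict_mono') auto
    then have v: "cmod (of_real (1 - y) * z) < 1" by simp
    have "(\<lambda>n. \<Sum>j\<le>N. c j * of_real y ^ j * (of_real (pochhammer (real (m + j)) n / fact n) * (of_real (1 - y) * z) ^ n))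
      sums (\<Sum>j\<le>N. c j * of_real y ^ j * (1 / ?v ^ (m + j)))"
      by (intro sums_sum sums_mult negative_binomial_complex_nat v)
    moreover have "(\<Sum>j\<le>N. c j * of_real y ^ j * (of_real (pochhammer (real (m + j)) n / fact n) * (of_real (1 - y) * z) ^ n)) = e n * z ^ n" for n
      unfolding e_def sum_distrib_right by (intro sum.cong refl) (simp add: power_mult_distrib)
    moreover have "(\<Sum>j\<le>N. c j * of_real y ^ j * (1 / ?v ^ (m + j))) = weighted_comp y (\<lambda>w. \<Sum>j\<le>N. c j * w ^ j) z"
      by (simp add: weighted_comp_def sum_divide_distrib power_divide power_add mult_ac)
    ultimately show ?thesis by simp
  qed
  have "(\<integral>\<^sup>+z. ennreal ((cmod (weighted_comp y (\<lambda>w. \<Sum>j\<le>N. c j * w ^ j) z))\<^sup>2) \<partial>dA (2 * real m * a - 2))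
    = (\<Sum>n. ennreal (fact n / pochhammer (2 * real m * a - 2 + 2) n * (cmod (e n))\<^sup>2))"
    using gam by (intro nn_integral_dA_power_series e) auto
  also have "\<dots> = (\<Sum>n. ennreal (D_entry m a n * (cmod (e n))\<^sup>2))"
    by (simp add: D_entry_def)
  also have "\<dots> = ennreal (Re (quad_form N (B_mat m a y) c))"
    using B_form_sums[OF y, of c N, folded e_def] D_entry_pos
    by (intro suminf_ennreal_eq) (auto intro!: mult_nonneg_nonneg less_imp_le[OF D_entry_pos])
  finally show ?thesis .
qed

end

section \<open>The finite-section extremal problem\<close>

lemma powr_concave_tangent:
  fixes u v s :: real
  assumes "u > 0" "v \<ge> 0" "0 < s" "s \<le> 1"
  shows "v powr s \<le> u powr s + s * u powr (s - 1) * (v - u)"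
proof (cases "v = 0")
  case True
  have "u powr (s - 1) * u = u powr s"
    using assms by (simp add: powr_diff)
  then have "u powr s + s * u powr (s - 1) * (v - u) = (1 - s) * u powr s"
    using True by (simp add: algebra_simps)
  then show ?thesis using True assms by simp
next
  case False
  have "(v / u) powr s * 1 powr (1 - s) \<le> s * (v / u) + (1 - s) * 1"
    using assms False by (intro Youngs_inequality_0) auto
  then have "u powr s * ((v / u) powr s) \<le> u powr s * (s * (v / u) + (1 - s))"
    by (intro mult_left_mono) auto
  moreover have "u powr s * ((v / u) powr s) = v powr s"
    using assms by (simp add: powr_divide)
  moreover have "u powr s * (s * (v / u) + (1 - s)) = u powr s + s * (u powr s / u) * (v - u)"
    using assms by (simp add: field_simps)
  ultimately show ?thesis
    using assms by (simp add: powr_diff)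
qed

section \<open>Lebesgue measure on the open unit interval and Beta integrals\<close>

abbreviation "unit_measure \<equiv> restrict_space lborel {0<..<1::real}"

lemma space_unit_measure [simp]: "space unit_measure = {0<..<1}"
  by (simp add: space_restrict_space)

lemma finite_measure_unit: "finite_measure unit_measure"
  by (intro finite_measureI) (simp add: emeasure_restrict_space)

lemma LBINT_unit_measure: "(LBINT y:{0<..<1}. f y) = (\<integral>y. f y \<partial>unit_measure)"
  for f :: "real \<Rightarrow> 'a::{banach, second_countable_topology}"
  by (simp add: integral_restrict_space set_lebesgue_integral_def)

lemma Beta_real_pos: "0 < x \<Longrightarrow> 0 < y \<Longrightarrow> 0 < Beta x y" for x y :: real
  by (auto simp: Beta_def intro!: divide_pos_pos mult_pos_pos Gamma_real_pos)

lemma has_bochner_integral_Beta: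
  fixes x y :: real
  assumes "x > 0" "y > 0"
  shows "has_bochner_integral unit_measure (\<lambda>t. t powr (x - 1) * (1 - t) powr (y - 1)) (Beta x y)"
proof (rule has_bochner_integral_nn_integral)
  have "((\<lambda>t. t powr (x - 1) * (1 - t) powr (y - 1)) has_integral Beta x y) {0<..<1}"
    using has_integral_Beta_real[of x y] assms by (simp add: has_integral_Icc_iff_Ioo)
  then have "(\<integral>\<^sup>+t. ennreal (t powr (x - 1) * (1 - t) powr (y - 1)) * indicator {0<..<1} t \<partial>lborel) = ennreal (Beta x y)"
    by (intro nn_integral_has_integral_lebesgue') auto
  then show "(\<integral>\<^sup>+t. ennreal (t powr (x - 1) * (1 - t) powr (y - 1)) \<partial>unit_measure) = ennreal (Beta x y)"
    by (subst nn_integral_restrict_space) auto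
  show "0 \<le> Beta x y"
    using Beta_real_pos[OF assms] by simp
qed (auto intro!: measurable_restrict_space1)

lemma integrable_unit_measure_powr:
  assumes "r > -1"
  shows "integrable unit_measure (\<lambda>t. t powr r)" "integrable unit_measure (\<lambda>t. (1 - t) powr r)"
proof -
  have 1: "integrable unit_measure (\<lambda>t. t powr (r + 1 - 1) * (1 - t) powr (1 - 1))"
    using assms by (intro has_bochner_integral_Beta[THEN integrable.intros]) auto
  show "integrable unit_measure (\<lambda>t. t powr r)"
    by (rule Bochner_Integration.integrable_cong[THEN iffD1, OF refl _ 1]) auto
  have 2: "integrable unit_measure (\<lambda>t. t powr (1 - 1) * (1 - t) powr (r + 1 - 1))"
    using assms by (intro has_bochner_integral_Beta[THEN integrable.intros]) auto
  show "integrable unit_measure (\<lambda>t. (1 - t) powr r)"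
    by (rule Bochner_Integration.integrable_cong[THEN iffD1, OF refl _ 2]) auto
qed

lemma borel_measurable_unit_measure:
  fixes g :: "real \<Rightarrow> 'b::topological_space"
  assumes "continuous_on {0<..<1} g"
  shows "g \<in> borel_measurable unit_measure"
  using borel_measurable_continuous_on_restrict[OF assms]
  by (simp add: measurable_cong_sets[OF sets_restrict_space_cong[OF sets_lborel] refl])

lemma integral_unit_measure_pos:
  fixes f :: "real \<Rightarrow> real"
  assumes "integrable unit_measure f" "\<And>y. 0 < y \<Longrightarrow> y < 1 \<Longrightarrow> f y > 0"
  shows "(\<integral>y. f y \<partial>unit_measure) > 0"
proof -
  have "emeasure unit_measure {0<..<1} = 1"
    by (subst emeasure_restrict_space) auto
  then have nF: "\<not> (AE y in unit_measure. False)"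
    using sets.top[of unit_measure] by (subst AE_iff_null) (simp_all add: null_sets_def del: greaterThanLessThan_iff)
  have "\<not> (AE y in unit_measure. f y = 0)"
  proof
    assume "AE y in unit_measure. f y = 0"
    then have "AE y in unit_measure. False"
    proof (rule AE_mp, intro AE_I2 impI)
      fix y assume "y \<in> space unit_measure" "f y = 0"
      then show False using assms(2)[of y] by simp
    qed
    then show False using nF by simp
  qed
  moreover have nn: "AE y in unit_measure. 0 \<le> f y"
    using assms(2) by (auto intro!: AE_I2 less_imp_le)
  ultimately show ?thesis
    using integral_nonneg_eq_0_iff_AE[OF assms(1) nn] integral_nonneg_AE[OF nn] by linarith
qed

section \<open>The functional \<open>rPhi\<close> on nonnegative vectors\<close>

context hilbert_bergman
begin

definition "expo = 1 / (2 * real m)"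

lemma expo_bounds: "0 < expo" "expo \<le> 1" using m by (auto simp: expo_def)

definition rform :: "nat \<Rightarrow> (nat \<Rightarrow> real) \<Rightarrow> (nat \<Rightarrow> real) \<Rightarrow> real \<Rightarrow> real" where
  "rform N c d y = (\<Sum>j\<le>N. \<Sum>k\<le>N. c j * B_mat m a y j k * d k)"

definition dform :: "nat \<Rightarrow> (nat \<Rightarrow> real) \<Rightarrow> (nat \<Rightarrow> real) \<Rightarrow> real" where
  "dform N c d = (\<Sum>j\<le>N. D_entry m a j * c j * d j)"

lemma borel_measurable_rform [measurable]: "rform N c d \<in> borel_measurable borel"
  unfolding rform_def by measurable

lemma rform_measurable_unit [measurable]: "rform N c d \<in> borel_measurable unit_measure"
  by (rule measurable_restrict_space1) simp

lemma rform_commute: "rform N c d y = rform N d c y"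
  unfolding rform_def by (subst sum.swap) (simp add: B_mat_commute[of y] mult_ac)

lemma rform_mono:
  assumes "0 < y" "y < 1" "\<And>j. j \<le> N \<Longrightarrow> 0 \<le> c j" "\<And>j. j \<le> N \<Longrightarrow> c j \<le> c' j"
    "\<And>j. j \<le> N \<Longrightarrow> 0 \<le> d j" "\<And>j. j \<le> N \<Longrightarrow> d j \<le> d' j"
  shows "rform N c d y \<le> rform N c' d' y"
  unfolding rform_def using assms B_mat_pos[OF assms(1,2)]
  by (intro sum_mono mult_mono mult_nonneg_nonneg) (auto intro: less_imp_le order_trans)

lemma rform_nonneg:
  assumes "0 < y" "y < 1" "\<And>j. j \<le> N \<Longrightarrow> 0 \<le> c j" "\<And>j. j \<le> N \<Longrightarrow> 0 \<le> d j"
  shows "rform N c d y \<ge> 0"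
  unfolding rform_def using assms B_mat_pos[OF assms(1,2)]
  by (intro sum_nonneg mult_nonneg_nonneg) (auto intro: less_imp_le)

lemma rform_ge_entry:
  assumes y: "0 < y" "y < 1" and c: "\<And>j. j \<le> N \<Longrightarrow> 0 \<le> c j" "\<And>j. j \<le> N \<Longrightarrow> 0 \<le> d j" and jk: "j \<le> N" "k \<le> N"
  shows "c j * B_mat m a y j k * d k \<le> rform N c d y"
proof -
  have B: "B_mat m a y j k \<ge> 0" for j k
    using B_mat_pos[OF y] by (rule less_imp_le)
  have "c j * B_mat m a y j k * d k \<le> (\<Sum>k\<le>N. c j * B_mat m a y j k * d k)"
    using c jk B by (intro member_le_sum) (auto intro!: mult_nonneg_nonneg)
  also have "\<dots> \<le> rform N c d y"
    unfolding rform_def using c jk B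
    by (intro member_le_sum[where f = "\<lambda>j. \<Sum>k\<le>N. c j * B_mat m a y j k * d k"])
       (auto intro!: mult_nonneg_nonneg sum_nonneg)
  finally show ?thesis .
qed

lemma rform_pos:
  assumes y: "0 < y" "y < 1" and c: "\<And>j. j \<le> N \<Longrightarrow> 0 \<le> c j" "\<And>j. j \<le> N \<Longrightarrow> 0 \<le> d j"
    and jk: "j \<le> N" "k \<le> N" "c j > 0" "d k > 0"
  shows "rform N c d y > 0"
  using rform_ge_entry[OF y c jk(1,2)] B_mat_pos[OF y, of j k] jk
  by (meson less_le_trans mult_pos_pos)

lemma rform_add:
  "rform N (\<lambda>j. c j + t * d j) (\<lambda>j. c j + t * d j) y = rform N c c y + 2 * t * rform N d c y + t\<^sup>2 * rform N d d y"
proof -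
  have "rform N (\<lambda>j. c j + t * d j) (\<lambda>j. c j + t * d j) y
    = rform N c c y + t * rform N d c y + t * rform N c d y + t\<^sup>2 * rform N d d y"
    unfolding rform_def sum_distrib_left sum.distrib[symmetric]
    by (intro sum.cong refl) (simp add: algebra_simps power2_eq_square)
  then show ?thesis by (simp add: rform_commute[of N c d])
qed

lemma dform_add:
  "dform N (\<lambda>j. c j + t * d j) (\<lambda>j. c j + t * d j) = dform N c c + 2 * t * dform N d c + t\<^sup>2 * dform N d d"
  unfolding dform_def sum_distrib_left sum.distrib[symmetric]
  by (intro sum.cong refl) (simp add: algebra_simps power2_eq_square)

lemma rform_scale: "rform N (\<lambda>j. t * c j) (\<lambda>j. t * d j) y = t\<^sup>2 * rform N c d y"
  unfolding rform_def sum_distrib_left by (intro sum.cong refl) (simp add: power2_eq_square)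

lemma dform_scale: "dform N (\<lambda>j. t * c j) (\<lambda>j. t * d j) = t\<^sup>2 * dform N c d"
  unfolding dform_def sum_distrib_left by (intro sum.cong refl) (simp add: power2_eq_square)

lemma rform_cong: "(\<And>j. j \<le> N \<Longrightarrow> c j = c' j) \<Longrightarrow> (\<And>j. j \<le> N \<Longrightarrow> d j = d' j) \<Longrightarrow> rform N c d y = rform N c' d' y"
  unfolding rform_def by (intro sum.cong refl) auto

lemma dform_nonneg: "dform N c c \<ge> 0"
  unfolding dform_def using D_entry_pos by (intro sum_nonneg) (auto simp: mult.assoc less_imp_le)

lemma rform_bound:
  "\<exists>C>0. \<forall>y c R. 0 < y \<longrightarrow> y < 1 \<longrightarrow> (\<forall>j\<le>N. 0 \<le> c j \<and> c j \<le> R) \<longrightarrow>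
     rform N c c y \<le> C * R\<^sup>2 * y powr (- 2 * real m * (1 - a))"
proof -
  obtain C where C: "\<And>j k. C j k > 0" "\<And>j k y. 0 < y \<Longrightarrow> y < 1 \<Longrightarrow> B_mat m a y j k \<le> C j k * y powr (- 2 * real m * (1 - a))"
    using B_mat_bound by metis
  show ?thesis
  proof (intro exI[of _ "\<Sum>j\<le>N. \<Sum>k\<le>N. C j k"] conjI allI impI)
    show "(\<Sum>j\<le>N. \<Sum>k\<le>N. C j k) > 0"
      using C(1) by (intro sum_pos) auto
    fix y R :: real and c assume y: "0 < y" "y < 1" and c: "\<forall>j\<le>N. 0 \<le> c j \<and> c j \<le> R"
    have "rform N c c y \<le> (\<Sum>j\<le>N. \<Sum>k\<le>N. R * (C j k * y powr (- 2 * real m * (1 - a))) * R)"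
      unfolding rform_def using c C y B_mat_pos[OF y]
      by (intro sum_mono mult_mono mult_nonneg_nonneg) (auto intro: less_imp_le order_trans)
    also have "\<dots> = (\<Sum>j\<le>N. \<Sum>k\<le>N. C j k) * R\<^sup>2 * y powr (- 2 * real m * (1 - a))"
      by (simp add: sum_distrib_left sum_distrib_right power2_eq_square mult_ac)
    finally show "rform N c c y \<le> \<dots>" .
  qed
qed

text \<open>The dominating function is a multiple of y powr (a - 1). It is uniform over a box of
  vectors, as dominated convergence in \<open>continuous_on_rPhi\<close> requires.\<close>

lemma rform_powr_dominated:
  "\<exists>w. integrable unit_measure w \<and> (\<forall>(y::real) c. 0 < y \<longrightarrow> y < 1 \<longrightarrow> (\<forall>j\<le>N. 0 \<le> c j \<and> c j \<le> R) \<longrightarrow>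
     rform N c c y powr expo \<le> w y)"
proof -
  obtain C where C: "C > 0" "\<And>(y::real) c R. 0 < y \<Longrightarrow> y < 1 \<Longrightarrow> (\<forall>j\<le>N. 0 \<le> c j \<and> c j \<le> R) \<Longrightarrow>
     rform N c c y \<le> C * R\<^sup>2 * y powr (- 2 * real m * (1 - a))"
    using rform_bound by metis
  show ?thesis
  proof (intro exI[of _ "\<lambda>y. (C * R\<^sup>2) powr expo * y powr (a - 1)"] conjI allI impI)
    show "integrable unit_measure (\<lambda>y. (C * R\<^sup>2) powr expo * y powr (a - 1))"
      using a by (intro integrable_mult_right integrable_unit_measure_powr) auto
    fix y :: real and c assume y: "0 < y" "y < 1" and c: "\<forall>j\<le>N. 0 \<le> c j \<and> c j \<le> R"
    have "rform N c c y powr expo \<le> (C * R\<^sup>2 * y powr (- 2 * real m * (1 - a))) powr expo"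
      using y c expo_bounds by (intro powr_mono2 C(2) rform_nonneg) auto
    also have "\<dots> = (C * R\<^sup>2) powr expo * y powr (a - 1)"
      using C m by (simp add: powr_mult powr_powr expo_def)
    finally show "rform N c c y powr expo \<le> (C * R\<^sup>2) powr expo * y powr (a - 1)" .
  qed
qed

lemma rform_powr_integrable:
  assumes "\<And>j. j \<le> N \<Longrightarrow> 0 \<le> c j"
  shows "integrable unit_measure (\<lambda>y. rform N c c y powr expo)"
proof -
  define R where "R = (\<Sum>j\<le>N. c j)"
  have "\<forall>j\<le>N. 0 \<le> c j \<and> c j \<le> R"
    unfolding R_def using assms by (auto intro!: member_le_sum)
  then obtain w where w: "integrable unit_measure w" "\<And>y::real. 0 < y \<Longrightarrow> y < 1 \<Longrightarrow> rform N c c y powr expo \<le> w y"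
    using rform_powr_dominated[of N R] by metis
  show ?thesis
    by (rule Bochner_Integration.integrable_bound[OF w(1)])
       (auto intro!: AE_I2 order_trans[OF w(2)])
qed

definition rPhi :: "nat \<Rightarrow> (nat \<Rightarrow> real) \<Rightarrow> real" where
  "rPhi N c = (\<integral>y. rform N c c y powr expo \<partial>unit_measure)"

lemma Phi_of_real: "Phi m a N (\<lambda>j. of_real (c j)) = rPhi N c"
  by (simp add: Phi_def rPhi_def LBINT_unit_measure Re_quad_form_of_real rform_def expo_def)

lemma Phi_le_rPhi: "Phi m a N c \<le> rPhi N (\<lambda>j. cmod (c j))"
proof -
  have "(\<integral>y. Re (quad_form N (B_mat m a y) c) powr expo \<partial>unit_measure) \<le> rPhi N (\<lambda>j. cmod (c j))"
    unfolding rPhi_def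
  proof (rule integral_mono')
    fix y assume "y \<in> space unit_measure"
    then have y: "0 < y" "y < 1" by auto
    have "Re (quad_form N (B_mat m a y) c) \<le> rform N (\<lambda>j. cmod (c j)) (\<lambda>j. cmod (c j)) y"
      unfolding rform_def using B_mat_pos[OF y] by (intro Re_quad_form_le_abs) (auto intro: less_imp_le)
    then show "Re (quad_form N (B_mat m a y) c) powr expo \<le> rform N (\<lambda>j. cmod (c j)) (\<lambda>j. cmod (c j)) y powr expo"
      using expo_bounds B_form_nonneg[OF y] by (intro powr_mono2) auto
  qed (auto intro!: rform_powr_integrable)
  then show ?thesis by (simp add: Phi_def LBINT_unit_measure expo_def)
qed

lemma rPhi_scale:
  assumes "t \<ge> 0"
  shows "rPhi N (\<lambda>j. t * c j) = (t\<^sup>2) powr expo * rPhi N c"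
  unfolding rPhi_def rform_scale by (simp add: powr_mult)

lemma quad_form_D_eq_1: "quad_form N (D_mat m a) c = 1 \<longleftrightarrow> dform N (\<lambda>j. cmod (c j)) (\<lambda>j. cmod (c j)) = 1"
  unfolding quad_form_D_mat dform_def by (simp add: power2_eq_square mult_ac flip: of_real_mult of_real_sum)

text \<open>Setting the entries beyond \<open>N\<close> to 0 makes this set compact in the product
  topology on sequences: it is a closed subset of a product of compact intervals, of which all but
  finitely many are {0}.\<close>

definition feasible :: "nat \<Rightarrow> (nat \<Rightarrow> real) set" where
  "feasible N = {c. (\<forall>j\<le>N. 0 \<le> c j) \<and> (\<forall>j>N. c j = 0) \<and> dform N c c = 1}"

lemma feasible_le:
  assumes "c \<in> feasible N" "j \<le> N"
  shows "c j \<le> sqrt (1 / D_entry m a j)"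
proof -
  have "D_entry m a j * c j * c j \<le> dform N c c"
    unfolding dform_def using assms D_entry_pos
    by (intro member_le_sum) (auto simp: feasible_def intro!: mult_nonneg_nonneg less_imp_le[OF D_entry_pos])
  then have "(c j)\<^sup>2 \<le> 1 / D_entry m a j"
    using assms D_entry_pos[of j] by (simp add: feasible_def power2_eq_square field_simps)
  then show ?thesis by (rule real_le_rsqrt)
qed

lemma compact_feasible: "compact (feasible N)"
proof -
  let ?I = "\<lambda>j. if j \<le> N then {0..sqrt (1 / D_entry m a j)} else {0::real}"
  have "compactin (product_topology (\<lambda>_. euclidean) UNIV) (PiE UNIV ?I)"
    unfolding compactin_PiE by auto
  then have K: "compact (PiE UNIV ?I)"
    by (simp add: euclidean_product_topology compactin_euclidean_iff)
  have "continuous_on UNIV (\<lambda>c. dform N c c)"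
    unfolding dform_def by (intro continuous_intros continuous_on_product_coordinates)
  then have "closed {c. dform N c c = 1}"
    by (intro closed_Collect_eq continuous_intros)
  then have "compact (PiE UNIV ?I \<inter> {c. dform N c c = 1})"
    by (rule compact_Int_closed[OF K])
  also have "PiE UNIV ?I \<inter> {c. dform N c c = 1} = feasible N"
  proof (intro equalityI subsetI)
    fix c assume "c \<in> feasible N"
    then show "c \<in> PiE UNIV ?I \<inter> {c. dform N c c = 1}"
      using feasible_le[of c N] by (auto simp: feasible_def)
  next
    fix c assume c: "c \<in> PiE UNIV ?I \<inter> {c. dform N c c = 1}"
    then have cI: "c j \<in> ?I j" for j by (elim IntE PiE_mem) simp
    have "0 \<le> c j" if "j \<le> N" for j
      using cI[of j] that by simp
    moreover have "c j = 0" if "j > N" for j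
      using cI[of j] that by simp
    ultimately show "c \<in> feasible N"
      using c by (simp add: feasible_def)
  qed
  finally show ?thesis .
qed

lemma continuous_on_rPhi: "continuous_on (feasible N) (rPhi N)"
  unfolding continuous_on_sequentially
proof (intro ballI allI impI)
  fix x c assume "c \<in> feasible N" and "(\<forall>n. x n \<in> feasible N) \<and> x \<longlonglongrightarrow> c"
  then have x: "x n \<in> feasible N" and lim: "x \<longlonglongrightarrow> c" for n by auto
  have lim_j: "(\<lambda>n. x n j) \<longlonglongrightarrow> c j" for j
    using continuous_on_tendsto_compose[OF continuous_on_product_coordinates[of j] lim] by simp
  define R where "R = (\<Sum>j\<le>N. sqrt (1 / D_entry m a j))"
  have R: "\<forall>j\<le>N. 0 \<le> d j \<and> d j \<le> R" if "d \<in> feasible N" for d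
  proof (intro allI impI conjI)
    fix j assume j: "j \<le> N"
    show "0 \<le> d j" using that j by (simp add: feasible_def)
    have "d j \<le> sqrt (1 / D_entry m a j)" using feasible_le[OF that j] .
    also have "\<dots> \<le> R"
      unfolding R_def using j by (intro member_le_sum) (auto intro: less_imp_le[OF D_entry_pos])
    finally show "d j \<le> R" .
  qed
  obtain w where w: "integrable unit_measure w"
    "\<And>(y::real) c. 0 < y \<Longrightarrow> y < 1 \<Longrightarrow> (\<forall>j\<le>N. 0 \<le> c j \<and> c j \<le> R) \<Longrightarrow> rform N c c y powr expo \<le> w y"
    using rform_powr_dominated[of N R] by metis
  have "(\<lambda>n. \<integral>y. rform N (x n) (x n) y powr expo \<partial>unit_measure) \<longlonglongrightarrow> (\<integral>y. rform N c c y powr expo \<partial>unit_measure)"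
  proof (rule integral_dominated_convergence[where w = w])
    show "AE y in unit_measure. (\<lambda>n. rform N (x n) (x n) y powr expo) \<longlonglongrightarrow> rform N c c y powr expo"
    proof (rule AE_I2)
      fix y assume "y \<in> space unit_measure"
      then have y: "0 < y" "y < 1" by auto
      have "(\<lambda>n. rform N (x n) (x n) y) \<longlonglongrightarrow> rform N c c y"
        unfolding rform_def by (intro tendsto_intros lim_j)
      then show "(\<lambda>n. rform N (x n) (x n) y powr expo) \<longlonglongrightarrow> rform N c c y powr expo"
        using x y expo_bounds
        by (intro tendsto_powr2 tendsto_const always_eventually allI rform_nonneg) (auto simp: feasible_def)
    qed
    show "AE y in unit_measure. norm (rform N (x n) (x n) y powr expo) \<le> w y" for n
      using w(2) R[OF x[of n]] by (intro AE_I2) auto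
  qed (use w in auto)
  then show "(rPhi N \<circ> x) \<longlonglongrightarrow> rPhi N c"
    by (simp add: rPhi_def o_def)
qed

lemma feasible_nonempty: "feasible N \<noteq> {}"
proof -
  define c where "c j = (if j = 0 then 1 else 0 :: real)" for j :: nat
  have "dform N c c = (\<Sum>j\<le>N. if j = 0 then D_entry m a 0 else 0)"
    unfolding dform_def c_def by (intro sum.cong) auto
  then have "c \<in> feasible N"
    by (simp add: feasible_def c_def D_entry_def)
  then show ?thesis by auto
qed

text \<open>\<open>rPhi\<close> and \<open>dform N d d powr expo\<close> have the same degree of
  homogeneity, so the maximum over the compact set \<open>feasible N\<close> turns into an
  inequality for all nonnegative vectors. In this form perturbed vectors need not be
  renormalised.\<close>

lemma rPhi_maximizer:
  obtains c where "c \<in> feasible N" "\<And>d. (\<And>j. j \<le> N \<Longrightarrow> 0 \<le> d j) \<Longrightarrow> rPhi N d \<le> rPhi N c * dform N d d powr expo"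
proof -
  obtain c where c: "c \<in> feasible N" "\<And>d. d \<in> feasible N \<Longrightarrow> rPhi N d \<le> rPhi N c"
    using continuous_attains_sup[OF compact_feasible feasible_nonempty continuous_on_rPhi] by blast
  have "rPhi N d \<le> rPhi N c * dform N d d powr expo" if d: "\<And>j. j \<le> N \<Longrightarrow> 0 \<le> d j" for d
  proof (cases "dform N d d = 0")
    case True
    then have "d j = 0" if "j \<le> N" for j
      using that D_entry_pos
      by (subst (asm) dform_def, subst (asm) sum_nonneg_eq_0_iff)
         (auto simp: mult.assoc less_imp_le less_imp_neq[OF D_entry_pos, symmetric])
    then have "rform N d d y = 0" for y
      by (simp add: rform_def)
    then show ?thesis using True by (simp add: rPhi_def)
  next
    case False
    define t where "t = sqrt (dform N d d)"
    have t: "t > 0" "t\<^sup>2 = dform N d d"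
      using False dform_nonneg[of N d] by (auto simp: t_def)
    define e where "e j = (if j \<le> N then 1 / t * d j else 0)" for j
    have "dform N e e = dform N (\<lambda>j. 1 / t * d j) (\<lambda>j. 1 / t * d j)"
      unfolding dform_def e_def by (intro sum.cong) auto
    also have "\<dots> = 1"
      unfolding dform_scale t(2)[symmetric] using t(1) by (simp add: power_divide)
    finally have "e \<in> feasible N"
      using d t by (auto simp: feasible_def e_def)
    then have "rPhi N e \<le> rPhi N c" by (rule c)
    then have "(t\<^sup>2) powr expo * rPhi N e \<le> (t\<^sup>2) powr expo * rPhi N c"
      by (intro mult_left_mono) auto
    also have "(t\<^sup>2) powr expo * rPhi N e = rPhi N (\<lambda>j. t * e j)"
      using t by (intro rPhi_scale[symmetric]) auto
    also have "\<dots> = rPhi N d"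
    proof -
      have "rform N (\<lambda>j. t * e j) (\<lambda>j. t * e j) y = rform N d d y" for y
        using t by (intro rform_cong) (auto simp: e_def)
      then show ?thesis by (simp add: rPhi_def)
    qed
    finally show ?thesis using t by (simp add: mult.commute)
  qed
  then show ?thesis using c that by blast
qed

section \<open>First-order conditions at a maximizer\<close>

lemma bernoulli_powr: "x \<ge> -1 \<Longrightarrow> (1 + x) powr expo \<le> 1 + expo * x" for x :: real
  using powr_concave_tangent[of 1 "1 + x" expo] expo_bounds by simp

lemma feasible_pos_index:
  assumes "c \<in> feasible N" obtains i where "i \<le> N" "c i > 0"
proof -
  have "\<not> (\<forall>i\<le>N. c i = 0)"
  proof
    assume "\<forall>i\<le>N. c i = 0"
    then have "dform N c c = 0" unfolding dform_def by (intro sum.neutral) auto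
    then show False using assms by (simp add: feasible_def)
  qed
  then show ?thesis
    using assms that by (force simp: feasible_def)
qed

lemma rPhi_pos:
  assumes "c \<in> feasible N"
  shows "rPhi N c > 0"
proof -
  obtain i where i: "i \<le> N" "c i > 0" using assms by (rule feasible_pos_index)
  show ?thesis
    unfolding rPhi_def
  proof (rule integral_unit_measure_pos[OF rform_powr_integrable])
    fix y :: real assume "0 < y" "y < 1"
    then have "rform N c c y > 0"
      using assms i by (intro rform_pos[of y N c c i i]) (auto simp: feasible_def)
    then show "rform N c c y powr expo > 0" by simp
  qed (use assms in \<open>auto simp: feasible_def\<close>)
qed

text \<open>If \<open>c j = 0\<close>, then adding t times the j-th unit vector changes
  \<open>dform\<close> only by a term of order t^2, because that vector is orthogonal to
  \<open>c\<close> for the diagonal form. The forms \<open>rform\<close> grow linearly in t, since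
  the entries of \<open>B_mat\<close> are positive and \<open>c\<close> is not 0. Maximality would
  bound a positive integral by O(t).\<close>

lemma maximizer_positive:
  assumes c: "c \<in> feasible N"
    and max: "\<And>d. (\<And>j. j \<le> N \<Longrightarrow> 0 \<le> d j) \<Longrightarrow> rPhi N d \<le> rPhi N c * dform N d d powr expo"
    and j: "j \<le> N"
  shows "c j > 0"
proof (rule ccontr)
  assume "\<not> c j > 0"
  then have cj: "c j = 0"
    using c j by (auto simp: feasible_def not_less intro: antisym)
  obtain i where i: "i \<le> N" "c i > 0" using c by (rule feasible_pos_index)
  have c0: "\<And>j. j \<le> N \<Longrightarrow> 0 \<le> c j" and c1: "dform N c c = 1"
    using c by (auto simp: feasible_def)
  define e where "e k = (if k = j then 1 else 0 :: real)" for k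
  have e0: "0 \<le> e k" for k by (simp add: e_def)
  let ?c = "\<lambda>t k. c k + t * e k"
  have dce: "dform N e c = 0"
    unfolding dform_def using cj by (intro sum.neutral) (auto simp: e_def)
  have dee: "dform N e e = D_entry m a j"
  proof -
    have "dform N e e = (\<Sum>k\<le>N. if k = j then D_entry m a j else 0)"
      unfolding dform_def e_def by (intro sum.cong) auto
    then show ?thesis using j by simp
  qed
  \<comment> \<open>This bounds the derivative in t from below, up to a factor. As
    \<open>expo - 1\<close> is negative and the form increases with t, its power is smallest at t =
    1, so a single integrable function serves for all t up to 1.\<close>
  let ?X = "\<lambda>y. rform N (?c 1) (?c 1) y powr (expo - 1) * rform N e c y"
  have pos: "rform N c c y > 0" "rform N e c y > 0" "rform N e e y > 0" if y: "0 < y" "y < 1" for y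
  proof -
    have ej: "e j > 0" by (simp add: e_def)
    show "rform N c c y > 0"
      using y c0 i by (intro rform_pos[where j = i and k = i]) auto
    show "rform N e c y > 0"
      using y c0 e0 i j ej by (intro rform_pos[where j = j and k = i]) auto
    show "rform N e e y > 0"
      using y e0 j ej by (intro rform_pos[where j = j and k = j]) auto
  qed
  have pos1: "rform N (?c t) (?c t) y > 0" if y: "0 < y" "y < 1" and t: "0 \<le> t" for y t
  proof -
    have "0 \<le> 2 * t * rform N e c y"
      by (intro mult_nonneg_nonneg less_imp_le[OF pos(2)[OF y]]) (use t in auto)
    moreover have "0 \<le> t\<^sup>2 * rform N e e y"
      by (intro mult_nonneg_nonneg less_imp_le[OF pos(3)[OF y]]) auto
    ultimately show ?thesis
      unfolding rform_add using pos(1)[OF y] by linarith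
  qed
  have X_int: "integrable unit_measure ?X"
  proof (rule Bochner_Integration.integrable_bound)
    show "integrable unit_measure (\<lambda>y. rform N (?c 1) (?c 1) y powr expo)"
      using c0 e0 by (intro rform_powr_integrable) auto
    show "AE y in unit_measure. norm (?X y) \<le> norm (rform N (?c 1) (?c 1) y powr expo)"
    proof (rule AE_I2)
      fix y assume "y \<in> space unit_measure"
      then have y: "0 < y" "y < 1" by auto
      let ?u = "rform N (?c 1) (?c 1) y"
      have "rform N e c y \<le> rform N c c y + 2 * 1 * rform N e c y + 1\<^sup>2 * rform N e e y"
        using pos[OF y] by simp
      then have "rform N e c y \<le> ?u"
        unfolding rform_add .
      then have "?X y \<le> ?u powr (expo - 1) * ?u"
        by (intro mult_left_mono) auto
      also have "\<dots> = ?u powr expo"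
        using pos1[OF y, of 1] by (simp add: powr_diff)
      finally show "norm (?X y) \<le> norm (?u powr expo)"
        using pos[OF y] by simp
    qed
  qed (rule measurable_restrict_space1, simp)
  have X_pos: "integral\<^sup>L unit_measure ?X > 0"
  proof (rule integral_unit_measure_pos[OF X_int])
    fix y :: real assume y: "0 < y" "y < 1"
    have "rform N (?c 1) (?c 1) y \<noteq> 0"
      using pos1[OF y, of 1] by linarith
    then show "?X y > 0"
      by (intro mult_pos_pos pos(2)[OF y]) (simp only: powr_gt_zero not_False_eq_True)
  qed
  have main: "2 * integral\<^sup>L unit_measure ?X \<le> rPhi N c * t * D_entry m a j" if t: "0 < t" "t \<le> 1" for t
  proof -
    have I0: "integrable unit_measure (\<lambda>y. rform N c c y powr expo)"
      using c0 by (rule rform_powr_integrable)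
    have It: "integrable unit_measure (\<lambda>y. rform N (?c t) (?c t) y powr expo)"
      using t c0 e0 by (intro rform_powr_integrable) auto
    have IX: "integrable unit_measure (\<lambda>y. expo * (2 * t) * ?X y)"
      using X_int by (rule integrable_mult_right)
    have "rPhi N c + expo * (2 * t) * integral\<^sup>L unit_measure ?X = (\<integral>y. rform N c c y powr expo + expo * (2 * t) * ?X y \<partial>unit_measure)"
      unfolding rPhi_def Bochner_Integration.integral_add[OF I0 IX] by simp
    also have "\<dots> \<le> rPhi N (?c t)"
      unfolding rPhi_def
    proof (rule integral_mono[OF Bochner_Integration.integrable_add[OF I0 IX] It])
      fix y assume "y \<in> space unit_measure"
      then have y: "0 < y" "y < 1" by auto
      let ?u = "rform N (?c t) (?c t) y" and ?v = "rform N c c y"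
      have u: "?u > 0" using pos1[OF y] t by auto
      \<comment> \<open>The tangent is taken at the perturbed value \<open>?u\<close>, which yields
        a lower bound for \<open>?u powr expo\<close>; the tangent at \<open>?v\<close> would only
        yield an upper bound.\<close>
      have "?v powr expo \<le> ?u powr expo + expo * ?u powr (expo - 1) * (?v - ?u)"
        using u pos(1)[OF y] expo_bounds by (intro powr_concave_tangent) auto
      then have 1: "?v powr expo + expo * (?u powr (expo - 1) * (?u - ?v)) \<le> ?u powr expo"
        by (simp add: algebra_simps)
      have 2: "?u - ?v \<ge> 2 * t * rform N e c y"
        unfolding rform_add using pos(3)[OF y] t by simp
      have 3: "?u powr (expo - 1) \<ge> rform N (?c 1) (?c 1) y powr (expo - 1)"
        using u expo_bounds t e0 c0 y by (intro powr_mono2' rform_mono) (auto intro!: mult_right_le_one_le mult_left_le_one_le)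
      have "rform N (?c 1) (?c 1) y powr (expo - 1) * (2 * t * rform N e c y) \<le> ?u powr (expo - 1) * (?u - ?v)"
        using 2 3 pos(2)[OF y] t by (intro mult_mono) auto
      then have "expo * (2 * t * ?X y) \<le> expo * (?u powr (expo - 1) * (?u - ?v))"
        using expo_bounds by (intro mult_left_mono) (auto simp: mult_ac)
      then show "?v powr expo + expo * (2 * t) * ?X y \<le> ?u powr expo"
        using 1 by (simp add: mult.assoc)
    qed
    also have "\<dots> \<le> rPhi N c * dform N (?c t) (?c t) powr expo"
      using c0 e0 t by (intro max) auto
    also have "\<dots> = rPhi N c * (1 + t\<^sup>2 * D_entry m a j) powr expo"
      unfolding dform_add c1 dce dee by simp
    also have "\<dots> \<le> rPhi N c * (1 + expo * (t\<^sup>2 * D_entry m a j))"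
    proof (rule mult_left_mono[OF bernoulli_powr])
      have "0 \<le> t\<^sup>2 * D_entry m a j"
        by (intro mult_nonneg_nonneg less_imp_le[OF D_entry_pos]) simp
      then show "-1 \<le> t\<^sup>2 * D_entry m a j" by linarith
    qed (use rPhi_pos[OF c] in simp)
    finally have "(expo * t) * (2 * integral\<^sup>L unit_measure ?X) \<le> (expo * t) * (rPhi N c * t * D_entry m a j)"
      by (simp add: algebra_simps power2_eq_square)
    then show ?thesis
      using expo_bounds t by (subst (asm) mult_le_cancel_left_pos) auto
  qed
  have lim: "((\<lambda>t. rPhi N c * t * D_entry m a j) \<longlongrightarrow> rPhi N c * 0 * D_entry m a j) (at_right 0)"
    by (intro tendsto_intros)
  have "2 * integral\<^sup>L unit_measure ?X \<le> rPhi N c * 0 * D_entry m a j"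
    by (rule tendsto_lowerbound[OF lim])
       (use main in \<open>auto intro!: eventually_at_rightI[of 0 1]\<close>)
  then show False using X_pos by simp
qed

text \<open>\<open>Lambda\<close> is the maximum over complex vectors; passing to moduli brings each
  of them under the bound \<open>max\<close>, and \<open>c\<close> itself attains it.\<close>

lemma maximizer_boyd_extremizer:
  assumes c: "c \<in> feasible N"
    and max: "\<And>d. (\<And>j. j \<le> N \<Longrightarrow> 0 \<le> d j) \<Longrightarrow> rPhi N d \<le> rPhi N c * dform N d d powr expo"
  shows "boyd_extremizer m a N c"
proof -
  have c0: "\<And>j. j \<le> N \<Longrightarrow> 0 \<le> c j" and c1: "dform N c c = 1"
    using c by (auto simp: feasible_def)
  have "dform N (\<lambda>j. cmod (of_real (c j))) (\<lambda>j. cmod (of_real (c j))) = dform N c c"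
    unfolding dform_def using c0 by (intro sum.cong) auto
  then have q1: "quad_form N (D_mat m a) (\<lambda>j. of_real (c j)) = 1"
    unfolding quad_form_D_eq_1 using c1 by simp
  have "Lambda m a N = rPhi N c"
    unfolding Lambda_def
  proof (rule Greatest_equality)
    show "rPhi N c \<in> Phi m a N ` {c. quad_form N (D_mat m a) c = 1}"
      using q1 by (auto simp: Phi_of_real intro!: image_eqI[where x = "\<lambda>j. of_real (c j)"])
    fix y assume "y \<in> Phi m a N ` {c. quad_form N (D_mat m a) c = 1}"
    then obtain d where d: "quad_form N (D_mat m a) d = 1" "y = Phi m a N d" by auto
    have "y \<le> rPhi N (\<lambda>j. cmod (d j))" unfolding d by (rule Phi_le_rPhi)
    also have "\<dots> \<le> rPhi N c * dform N (\<lambda>j. cmod (d j)) (\<lambda>j. cmod (d j)) powr expo"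
      by (rule max) simp
    finally show "y \<le> rPhi N c"
      using d(1) by (simp add: quad_form_D_eq_1)
  qed
  then show ?thesis
    unfolding boyd_extremizer_def
    using q1 maximizer_positive[OF c max] by (simp add: Phi_of_real)
qed

text \<open>Stationarity would say L c = \<Lambda> D c. Paired with a positive vector
  \<open>g\<close>, its half \<Lambda> Y \<le> X is enough, and moving from \<open>c\<close> to c -
  t g yields exactly that half: \<open>dform\<close> drops by about 2 t Y, so by maximality
  \<open>rPhi\<close> must drop in proportion to \<Lambda> Y, whereas the tangent inequality bounds
  the drop by a multiple of X.\<close>

lemma maximizer_le_Beta:
  assumes S: "boyd_supersolutions m a"
    and c: "c \<in> feasible N"
    and max: "\<And>d. (\<And>j. j \<le> N \<Longrightarrow> 0 \<le> d j) \<Longrightarrow> rPhi N d \<le> rPhi N c * dform N d d powr expo"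
  shows "rPhi N c \<le> Beta a (1 - a)"
proof -
  let ?\<Lambda> = "rPhi N c"
  have c0: "\<And>j. j \<le> N \<Longrightarrow> 0 < c j"
    by (rule maximizer_positive[OF c max])
  have c0': "\<And>j. j \<le> N \<Longrightarrow> 0 \<le> c j" and c1: "dform N c c = 1"
    using c by (auto simp: feasible_def)
  obtain P where hpos: "\<forall>j. 0 < h_seq m P j"
    and hsup: "\<forall>j\<le>N. (\<Sum>k\<le>N. boyd_perron_mat m a N c j k * h_seq m P k) \<le> Beta a (1 - a) * D_entry m a j * h_seq m P j"
    using S maximizer_boyd_extremizer[OF c max] unfolding boyd_supersolutions_def by blast
  define h where "h = h_seq m P"
  \<comment> \<open>Scaling \<open>h\<close> below \<open>c\<close> ensures that c - t g is at least
    (1 - t) c for 0 < t < 1. This keeps the perturbed vector nonnegative and bounds its form from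
    below, which controls the negative power \<open>expo - 1\<close>.\<close>
  define \<kappa> where "\<kappa> = (MIN j\<in>{..N}. c j / h j)"
  have hp: "h j > 0" for j using hpos by (simp add: h_def)
  have \<kappa>: "\<kappa> > 0" "\<And>j. j \<le> N \<Longrightarrow> \<kappa> * h j \<le> c j"
  proof -
    show "\<kappa> > 0"
      unfolding \<kappa>_def using c0 hp by (subst Min_gr_iff) auto
    fix j assume j: "j \<le> N"
    then have "\<kappa> \<le> c j / h j"
      unfolding \<kappa>_def by (intro Min_le) auto
    then show "\<kappa> * h j \<le> c j"
      using hp[of j] by (simp add: field_simps)
  qed
  define g where "g j = \<kappa> * h j" for j
  have g0: "g j > 0" for j unfolding g_def using \<kappa> hp by simp
  have gc: "g j \<le> c j" if "j \<le> N" for j unfolding g_def using \<kappa> that by simp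
  let ?v = "rform N c c"
  have vpos: "?v y > 0" if "0 < y" "y < 1" for y
    using that c0 c0' by (intro rform_pos[where j = 0 and k = 0]) auto
  have gcpos: "rform N g c y > 0" if "0 < y" "y < 1" for y
    using that c0 c0' g0 by (intro rform_pos[where j = 0 and k = 0]) (auto intro: less_imp_le)
  have Iv: "integrable unit_measure (\<lambda>y. ?v y powr expo)"
    using c0' by (rule rform_powr_integrable)
  \<comment> \<open>Strict positivity of \<open>c\<close> gives B_jk \<le> v / (c_j c_k), so the
    negative power of the form is absorbed and the integrable v powr expo remains.\<close>
  have Ijk: "integrable unit_measure (\<lambda>y. ?v y powr (expo - 1) * B_mat m a y j k)" if jk: "j \<le> N" "k \<le> N" for j k
  proof (rule Bochner_Integration.integrable_bound)
    show "integrable unit_measure (\<lambda>y. 1 / (c j * c k) * (?v y powr expo))"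
      by (intro integrable_mult_right Iv)
    show "AE y in unit_measure. norm (?v y powr (expo - 1) * B_mat m a y j k) \<le> norm (1 / (c j * c k) * (?v y powr expo))"
    proof (rule AE_I2)
      fix y assume "y \<in> space unit_measure"
      then have y: "0 < y" "y < 1" by auto
      have cc: "c j > 0" "c k > 0" using c0 jk by auto
      have "c j * B_mat m a y j k * c k \<le> ?v y"
        using y c0' jk by (intro rform_ge_entry) auto
      then have "B_mat m a y j k \<le> ?v y / (c j * c k)"
        using cc by (simp add: field_simps)
      then have "?v y powr (expo - 1) * B_mat m a y j k \<le> ?v y powr (expo - 1) * (?v y / (c j * c k))"
        by (intro mult_left_mono) auto
      also have "\<dots> = 1 / (c j * c k) * (?v y powr expo)"
        using vpos[OF y] by (simp add: powr_diff)
      finally show "norm (?v y powr (expo - 1) * B_mat m a y j k) \<le> norm (1 / (c j * c k) * (?v y powr expo))"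
        using B_mat_pos[OF y, of j k] cc by (simp add: abs_mult)
    qed
  qed (rule measurable_restrict_space1, simp)
  have L: "boyd_perron_mat m a N c j k = (\<integral>y. ?v y powr (expo - 1) * B_mat m a y j k \<partial>unit_measure)" for j k
    by (simp add: boyd_perron_mat_def LBINT_unit_measure Re_quad_form_of_real rform_def expo_def)
  define X where "X = (\<integral>y. ?v y powr (expo - 1) * rform N g c y \<partial>unit_measure)"
  define Y where "Y = dform N g c"
  define Z where "Z = dform N g g"
  have expand: "?v y powr (expo - 1) * rform N g c y = (\<Sum>j\<le>N. \<Sum>k\<le>N. (g j * c k) * (?v y powr (expo - 1) * B_mat m a y j k))" for y
    unfolding rform_def sum_distrib_left by (intro sum.cong refl) (simp add: mult_ac)
  have IX: "integrable unit_measure (\<lambda>y. ?v y powr (expo - 1) * rform N g c y)"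
    unfolding expand by (intro Bochner_Integration.integrable_sum integrable_mult_right Ijk) auto
  have X_eq: "X = (\<Sum>j\<le>N. \<Sum>k\<le>N. (g j * c k) * boyd_perron_mat m a N c j k)"
    unfolding X_def expand L
    by (subst Bochner_Integration.integral_sum, (intro Bochner_Integration.integrable_sum integrable_mult_right Ijk; simp),
        intro sum.cong refl, subst Bochner_Integration.integral_sum, (intro integrable_mult_right Ijk; simp)) simp
  have Lsym: "boyd_perron_mat m a N c j k = boyd_perron_mat m a N c k j" for j k
    unfolding L by (simp add: B_mat_commute[of _ j k])
  have "X = (\<Sum>j\<le>N. \<Sum>k\<le>N. (g k * c j) * boyd_perron_mat m a N c k j)"
    unfolding X_eq by (rule sum.swap)
  also have "\<dots> = (\<Sum>j\<le>N. c j * \<kappa> * (\<Sum>k\<le>N. boyd_perron_mat m a N c j k * h k))"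
    unfolding sum_distrib_left g_def by (intro sum.cong refl) (simp add: Lsym mult_ac)
  also have "\<dots> \<le> (\<Sum>j\<le>N. c j * \<kappa> * (Beta a (1 - a) * D_entry m a j * h j))"
    using hsup c0' \<kappa>(1) unfolding h_def by (intro sum_mono mult_left_mono) auto
  also have "\<dots> = Beta a (1 - a) * Y"
    unfolding Y_def dform_def g_def sum_distrib_left by (intro sum.cong refl) simp
  finally have XY: "X \<le> Beta a (1 - a) * Y" .
  have Ypos: "Y > 0"
    unfolding Y_def dform_def using c0 g0 D_entry_pos by (intro sum_pos) auto
  have Zpos: "Z \<ge> 0" unfolding Z_def by (rule dform_nonneg)
  have main: "?\<Lambda> * (2 * Y - t * Z) \<le> 2 * ((1 - t)\<^sup>2) powr (expo - 1) * X" if t: "0 < t" "t < 1" for t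
  proof -
    let ?c = "\<lambda>j. c j + (- t) * g j"
    have c_lower: "(1 - t) * c j \<le> ?c j" if "j \<le> N" for j
      using mult_left_mono[OF gc[OF that], of t] t by (simp add: algebra_simps)
    have cn: "0 \<le> ?c j" if "j \<le> N" for j
      by (rule order_trans[OF _ c_lower[OF that]]) (use c0'[OF that] t in auto)
    have Iu: "integrable unit_measure (\<lambda>y. rform N ?c ?c y powr expo)"
      by (rule rform_powr_integrable[OF cn])
    have IX': "integrable unit_measure (\<lambda>y. expo * ((1 - t)\<^sup>2) powr (expo - 1) * (2 * t) * (?v y powr (expo - 1) * rform N g c y))"
      by (intro integrable_mult_right IX)
    have "?\<Lambda> \<le> (\<integral>y. rform N ?c ?c y powr expo + expo * ((1 - t)\<^sup>2) powr (expo - 1) * (2 * t) * (?v y powr (expo - 1) * rform N g c y) \<partial>unit_measure)"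
      unfolding rPhi_def
    proof (rule integral_mono[OF Iv Bochner_Integration.integrable_add[OF Iu IX']])
      fix y assume "y \<in> space unit_measure"
      then have y: "0 < y" "y < 1" by auto
      let ?u = "rform N ?c ?c y"
      have tv: "(1 - t)\<^sup>2 * ?v y > 0"
        using vpos[OF y] t by simp
      have "(1 - t)\<^sup>2 * ?v y = rform N (\<lambda>j. (1 - t) * c j) (\<lambda>j. (1 - t) * c j) y"
        by (simp only: rform_scale)
      also have "\<dots> \<le> ?u"
        using y t c0' c_lower by (intro rform_mono) auto
      finally have u_ge: "(1 - t)\<^sup>2 * ?v y \<le> ?u" .
      then have u: "?u > 0" using tv by linarith
      have "?v y powr expo \<le> ?u powr expo + expo * ?u powr (expo - 1) * (?v y - ?u)"
        using u vpos[OF y] expo_bounds by (intro powr_concave_tangent) auto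
      also have "expo * ?u powr (expo - 1) * (?v y - ?u) \<le> expo * ?u powr (expo - 1) * (2 * t * rform N g c y)"
      proof (rule mult_left_mono)
        have "0 \<le> (- t)\<^sup>2 * rform N g g y"
          using y g0 by (intro mult_nonneg_nonneg rform_nonneg) (auto intro: less_imp_le)
        then show "?v y - ?u \<le> 2 * t * rform N g c y"
          unfolding rform_add by simp
      qed (use expo_bounds in simp)
      also have "expo * ?u powr (expo - 1) * (2 * t * rform N g c y) \<le> expo * ((1 - t)\<^sup>2 * ?v y) powr (expo - 1) * (2 * t * rform N g c y)"
        using expo_bounds gcpos[OF y] t u_ge tv by (intro mult_right_mono mult_left_mono powr_mono2') auto
      also have "((1 - t)\<^sup>2 * ?v y) powr (expo - 1) = ((1 - t)\<^sup>2) powr (expo - 1) * ?v y powr (expo - 1)"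
        using vpos[OF y] by (simp add: powr_mult)
      finally show "?v y powr expo \<le> ?u powr expo + expo * ((1 - t)\<^sup>2) powr (expo - 1) * (2 * t) * (?v y powr (expo - 1) * rform N g c y)"
        using expo_bounds by (simp add: mult_ac)
    qed
    also have "\<dots> = rPhi N ?c + expo * ((1 - t)\<^sup>2) powr (expo - 1) * (2 * t) * X"
      unfolding Bochner_Integration.integral_add[OF Iu IX'] by (simp only: rPhi_def X_def integral_mult_right_zero)
    also have "rPhi N ?c \<le> ?\<Lambda> * dform N ?c ?c powr expo"
      by (rule max[OF cn])
    also have "dform N ?c ?c = 1 + (- 2 * t * Y + t\<^sup>2 * Z)"
      unfolding dform_add c1 Y_def Z_def by simp
    also have "?\<Lambda> * (1 + (- 2 * t * Y + t\<^sup>2 * Z)) powr expo \<le> ?\<Lambda> * (1 + expo * (- 2 * t * Y + t\<^sup>2 * Z))"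
    proof (rule mult_left_mono[OF bernoulli_powr])
      have "dform N ?c ?c \<ge> 0" by (rule dform_nonneg)
      then show "-1 \<le> - 2 * t * Y + t\<^sup>2 * Z"
        unfolding dform_add c1 Y_def Z_def by simp
    qed (use rPhi_pos[OF c] in simp)
    finally have "(expo * t) * (?\<Lambda> * (2 * Y - t * Z)) \<le> (expo * t) * (2 * ((1 - t)\<^sup>2) powr (expo - 1) * X)"
      using expo_bounds by (simp add: algebra_simps power2_eq_square)
    moreover have "expo * t > 0" using expo_bounds t by simp
    ultimately show ?thesis
      by (simp only: mult_le_cancel_left_pos)
  qed
  have lim1: "((\<lambda>t. ?\<Lambda> * (2 * Y - t * Z)) \<longlongrightarrow> ?\<Lambda> * (2 * Y - 0 * Z)) (at_right 0)"
    by (intro tendsto_intros)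
  have lim2: "((\<lambda>t. 2 * ((1 - t)\<^sup>2) powr (expo - 1) * X) \<longlongrightarrow> 2 * ((1 - 0)\<^sup>2) powr (expo - 1) * X) (at_right 0)"
    by (intro tendsto_intros) auto
  have "?\<Lambda> * (2 * Y - 0 * Z) \<le> 2 * ((1 - 0)\<^sup>2) powr (expo - 1) * X"
  proof (rule tendsto_le[OF _ lim2 lim1])
    show "\<forall>\<^sub>F t in at_right 0. ?\<Lambda> * (2 * Y - t * Z) \<le> 2 * ((1 - t)\<^sup>2) powr (expo - 1) * X"
      by (rule eventually_at_rightI[of 0 1]) (use main in auto)
  qed simp
  then have "?\<Lambda> * Y \<le> X" by simp
  with XY have "?\<Lambda> * Y \<le> Beta a (1 - a) * Y" by linarith
  then show ?thesis using Ypos by simp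
qed

theorem Phi_le_Beta:
  assumes "boyd_supersolutions m a"
  shows "Phi m a N c \<le> Beta a (1 - a) * (\<Sum>j\<le>N. D_entry m a j * (cmod (c j))\<^sup>2) powr expo"
proof -
  obtain d where d: "d \<in> feasible N"
    and max: "\<And>e. (\<And>j. j \<le> N \<Longrightarrow> 0 \<le> e j) \<Longrightarrow> rPhi N e \<le> rPhi N d * dform N e e powr expo"
    using rPhi_maximizer by blast
  let ?c = "\<lambda>j. cmod (c j)"
  have "Phi m a N c \<le> rPhi N ?c" by (rule Phi_le_rPhi)
  also have "\<dots> \<le> rPhi N d * dform N ?c ?c powr expo" by (rule max) simp
  also have "\<dots> \<le> Beta a (1 - a) * dform N ?c ?c powr expo"
    by (intro mult_right_mono maximizer_le_Beta[OF assms d max]) auto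
  also have "dform N ?c ?c = (\<Sum>j\<le>N. D_entry m a j * (cmod (c j))\<^sup>2)"
    unfolding dform_def by (simp add: power2_eq_square mult_ac)
  finally show ?thesis .
qed

end

section \<open>Minkowski's integral inequality\<close>

text \<open>The convex function x ^ (n + 1) lies above its tangent at A. In the induction the new
  difference is x times the old one plus (n + 1) A ^ n (x - A)^2.\<close>

lemma power_tangent:
  fixes A x :: real
  assumes "A \<ge> 0" "x \<ge> 0"
  shows "real (Suc n) * A ^ n * x \<le> x ^ Suc n + real n * A ^ Suc n"
proof (induction n)
  case (Suc n)
  have "0 \<le> real (Suc n) * A ^ n * (x - A)\<^sup>2"
    using assms by simp
  moreover have "0 \<le> x * (x ^ Suc n + real n * A ^ Suc n - real (Suc n) * A ^ n * x)"
    using assms Suc by (intro mult_nonneg_nonneg) auto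
  ultimately show ?case
    by (simp add: algebra_simps power2_eq_square)
qed simp

text \<open>Jensen's inequality for the probability density v / M bounds the power of the inner
  integral by M ^ n times the integral of u ^ (n + 1) / v ^ n. After Fubini the norm hypothesis
  leaves the integral of \<open>v\<close>, which is \<open>M\<close>. The division is the reason for
  demanding v > 0.\<close>

lemma nn_integral_Minkowski:
  fixes u :: "'a \<Rightarrow> 'b \<Rightarrow> real" and v :: "'a \<Rightarrow> real"
  assumes "sigma_finite_measure T" "sigma_finite_measure N"
    and u [measurable]: "(\<lambda>(t, z). u t z) \<in> borel_measurable (T \<Otimes>\<^sub>M N)" and v [measurable]: "v \<in> borel_measurable T"
    and u0: "\<And>t z. t \<in> space T \<Longrightarrow> z \<in> space N \<Longrightarrow> 0 \<le> u t z" and v0: "\<And>t. t \<in> space T \<Longrightarrow> 0 < v t"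
    and norm: "\<And>t. t \<in> space T \<Longrightarrow> (\<integral>\<^sup>+z. ennreal (u t z ^ Suc n) \<partial>N) \<le> ennreal (v t ^ Suc n)"
    and M: "(\<integral>\<^sup>+t. ennreal (v t) \<partial>T) = ennreal M" "M > 0"
    and fin: "\<And>z. z \<in> space N \<Longrightarrow> (\<integral>\<^sup>+t. ennreal (u t z) \<partial>T) < \<infinity>"
  shows "(\<integral>\<^sup>+z. (\<integral>\<^sup>+t. ennreal (u t z) \<partial>T) ^ Suc n \<partial>N) \<le> ennreal (M ^ Suc n)"
proof -
  interpret pair_sigma_finite T N
    using assms(1,2) by (simp add: pair_sigma_finite_def)
  have [measurable]: "(\<lambda>z. u t z) \<in> borel_measurable N" if "t \<in> space T" for t
    using measurable_compose[OF measurable_Pair1'[OF that] u] by simp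
  have [measurable]: "(\<lambda>t. u t z) \<in> borel_measurable T" if "z \<in> space N" for z
    using measurable_compose[OF measurable_Pair2'[OF that] u] by simp
  let ?k = "\<lambda>t z. ennreal (u t z ^ Suc n / v t ^ n)"
  \<comment> \<open>the tangent inequality for \<open>u / v\<close> at its mean \<open>A\<close> with respect to the weight \<open>v\<close>\<close>
  have pointwise: "(\<integral>\<^sup>+t. ennreal (u t z) \<partial>T) ^ Suc n \<le> ennreal (M ^ n) * (\<integral>\<^sup>+t. ?k t z \<partial>T)" if z: "z \<in> space N" for z
  proof -
    obtain G where G: "G \<ge> 0" "(\<integral>\<^sup>+t. ennreal (u t z) \<partial>T) = ennreal G"
      using fin[OF z] by (metis ennreal_cases infinity_ennreal_def less_irrefl)
    define A where "A = G / M"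
    have A: "A \<ge> 0" "G = A * M" using G M by (auto simp: A_def)
    have "ennreal (real (Suc n) * A ^ n) * ennreal G = (\<integral>\<^sup>+t. ennreal (real (Suc n) * A ^ n * u t z) \<partial>T)"
      unfolding G(2)[symmetric] using z A u0
      by (subst nn_integral_cmult[symmetric]) (auto intro!: nn_integral_cong simp: ennreal_mult)
    also have "\<dots> \<le> (\<integral>\<^sup>+t. ?k t z + ennreal (real n * A ^ Suc n) * ennreal (v t) \<partial>T)"
    proof (rule nn_integral_mono)
      fix t assume t: "t \<in> space T"
      have "real (Suc n) * A ^ n * (u t z / v t) \<le> (u t z / v t) ^ Suc n + real n * A ^ Suc n"
        using A u0[OF t z] v0[OF t] by (intro power_tangent) auto
      then have "real (Suc n) * A ^ n * (u t z / v t) * v t \<le> ((u t z / v t) ^ Suc n + real n * A ^ Suc n) * v t"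
        using v0[OF t] by (intro mult_right_mono) auto
      also have "\<dots> = u t z ^ Suc n / v t ^ n + real n * A ^ Suc n * v t"
        using v0[OF t] by (simp add: power_divide field_simps)
      finally have "real (Suc n) * A ^ n * u t z \<le> u t z ^ Suc n / v t ^ n + real n * A ^ Suc n * v t"
        using v0[OF t] by simp
      then show "ennreal (real (Suc n) * A ^ n * u t z) \<le> ?k t z + ennreal (real n * A ^ Suc n) * ennreal (v t)"
        using A u0[OF t z] v0[OF t]
        by (subst ennreal_mult[symmetric], simp, simp, subst ennreal_plus[symmetric], simp, simp, intro ennreal_leI)
    qed
    also have "\<dots> = (\<integral>\<^sup>+t. ?k t z \<partial>T) + ennreal (real n * A ^ Suc n) * ennreal M"
      unfolding M(1)[symmetric] using z by (subst nn_integral_add) (auto simp: nn_integral_cmult)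
    finally have le: "ennreal (real (Suc n) * A ^ n) * ennreal G \<le> (\<integral>\<^sup>+t. ?k t z \<partial>T) + ennreal (real n * A ^ Suc n) * ennreal M" .
    \<comment> \<open>As G = A M, the left side contains the second summand of \<open>le\<close>,
      which is finite and can be cancelled.\<close>
    have "ennreal (real (Suc n) * A ^ n) * ennreal G = ennreal (A ^ Suc n * M) + ennreal (real n * A ^ Suc n) * ennreal M"
      using A M by (simp add: ennreal_mult[symmetric] ennreal_plus[symmetric] algebra_simps del: ennreal_plus)
    with le have le': "ennreal (A ^ Suc n * M) \<le> (\<integral>\<^sup>+t. ?k t z \<partial>T)"
      by (simp add: add.commute ennreal_mult[symmetric] A M(2) less_imp_le)
    have "ennreal G ^ Suc n = ennreal (G ^ Suc n)"
      using G(1) by (rule ennreal_power)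
    also have "G ^ Suc n = M ^ n * (A ^ Suc n * M)"
      unfolding A(2) by (simp add: power_mult_distrib)
    also have "ennreal \<dots> = ennreal (M ^ n) * ennreal (A ^ Suc n * M)"
      using A M by (intro ennreal_mult) auto
    also have "\<dots> \<le> ennreal (M ^ n) * (\<integral>\<^sup>+t. ?k t z \<partial>T)"
      by (intro mult_left_mono le') simp
    finally show ?thesis unfolding G(2) .
  qed
  have km: "(\<lambda>(t, z). ?k t z) \<in> borel_measurable (T \<Otimes>\<^sub>M N)"
    by measurable
  have "(\<integral>\<^sup>+z. (\<integral>\<^sup>+t. ennreal (u t z) \<partial>T) ^ Suc n \<partial>N) \<le> (\<integral>\<^sup>+z. ennreal (M ^ n) * (\<integral>\<^sup>+t. ?k t z \<partial>T) \<partial>N)"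
    by (intro nn_integral_mono pointwise)
  also have "\<dots> = ennreal (M ^ n) * (\<integral>\<^sup>+z. (\<integral>\<^sup>+t. ?k t z \<partial>T) \<partial>N)"
    by (rule nn_integral_cmult) measurable
  also have "(\<integral>\<^sup>+z. (\<integral>\<^sup>+t. ?k t z \<partial>T) \<partial>N) = (\<integral>\<^sup>+t. (\<integral>\<^sup>+z. ?k t z \<partial>N) \<partial>T)"
    using km by (intro Fubini') simp
  also have "\<dots> \<le> (\<integral>\<^sup>+t. ennreal (v t) \<partial>T)"
  proof (rule nn_integral_mono)
    fix t assume t: "t \<in> space T"
    have "(\<integral>\<^sup>+z. ?k t z \<partial>N) = (\<integral>\<^sup>+z. ennreal (1 / v t ^ n) * ennreal (u t z ^ Suc n) \<partial>N)"
      using v0[OF t] u0[OF t] by (intro nn_integral_cong) (simp add: ennreal_mult[symmetric])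
    also have "\<dots> = ennreal (1 / v t ^ n) * (\<integral>\<^sup>+z. ennreal (u t z ^ Suc n) \<partial>N)"
      using t by (intro nn_integral_cmult) auto
    also have "\<dots> \<le> ennreal (1 / v t ^ n) * ennreal (v t ^ Suc n)"
      by (intro mult_left_mono norm t) simp
    also have "\<dots> = ennreal (v t)"
      using v0[OF t] by (subst ennreal_mult[symmetric]) auto
    finally show "(\<integral>\<^sup>+z. ?k t z \<partial>N) \<le> ennreal (v t)" .
  qed
  also have "ennreal (M ^ n) * (\<integral>\<^sup>+t. ennreal (v t) \<partial>T) = ennreal (M ^ Suc n)"
    unfolding M(1) using M(2) by (simp add: ennreal_mult[symmetric] mult.commute)
  finally show ?thesis
    by (simp add: mult_left_mono)
qed

section \<open>The Hilbert operator as an average over arcs\<close>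

lemma ball_power_series_sums:
  assumes "F holomorphic_on ball 0 1" "cmod z < 1"
  shows "(\<lambda>n. (deriv ^^ n) F 0 / fact n * z ^ n) sums F z"
  using holomorphic_power_series[OF assms(1), of z] assms(2) by simp

lemma measurable_disk_real:
  assumes "f holomorphic_on ball 0 1"
  shows "(\<lambda>t. f (of_real t)) \<in> borel_measurable unit_measure"
  by (intro borel_measurable_unit_measure
      continuous_on_compose2[OF holomorphic_on_imp_continuous_on[OF assms]] continuous_intros) auto

text \<open>Growth of order a < 1 at the circle is all that is used of the Bergman space here: it
  makes \<open>f\<close> integrable along the radius and along the arcs.\<close>

locale radial_growth =
  fixes f :: "complex \<Rightarrow> complex" and C a :: real
  assumes holo: "f holomorphic_on ball 0 1"
    and growth: "\<And>z. cmod z < 1 \<Longrightarrow> cmod (f z) \<le> C * (1 - cmod z) powr (- a)"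
    and a01: "0 < a" "a < 1"
begin

lemma C_nonneg: "C \<ge> 0"
  using order_trans[OF norm_ge_zero growth[of 0]] by simp

lemma integrable_radial: "integrable unit_measure (\<lambda>t. f (of_real t))"
proof (rule Bochner_Integration.integrable_bound)
  show "integrable unit_measure (\<lambda>t. C * (1 - t) powr (- a))"
    using a01 by (intro integrable_mult_right integrable_unit_measure_powr) auto
  show "AE t in unit_measure. norm (f (of_real t)) \<le> norm (C * (1 - t) powr (- a))"
  proof (rule AE_I2)
    fix t assume "t \<in> space unit_measure"
    then show "norm (f (of_real t)) \<le> norm (C * (1 - t) powr (- a))"
      using growth[of "of_real t"] C_nonneg by simp
  qed
qed (rule measurable_disk_real[OF holo])

text \<open>Termwise integration of the geometric series, dominated by |f(t)| |z|^n. Besides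
  analyticity of the image it supplies the Taylor coefficients of the images of the test
  functions.\<close>

lemma hilbert_op_sums:
  assumes z: "cmod z < 1"
  shows "(\<lambda>n. (\<integral>t. f (of_real t) * of_real t ^ n \<partial>unit_measure) * z ^ n) sums hilbert_op f z"
proof -
  let ?f = "\<lambda>n t. f (of_real t) * of_real t ^ n * z ^ n"
  have int: "integrable unit_measure (\<lambda>t. f (of_real t) * of_real t ^ n)" for n
  proof (rule Bochner_Integration.integrable_bound[OF integrable_radial])
    show "AE t in unit_measure. norm (f (of_real t) * of_real t ^ n) \<le> norm (f (of_real t))"
      by (rule AE_I2) (auto simp: norm_mult norm_power power_le_one intro!: mult_right_le_one_le)
    show "(\<lambda>t. f (of_real t) * of_real t ^ n) \<in> borel_measurable unit_measure"
      using measurable_disk_real[OF holo] by (intro borel_measurable_times) (auto intro!: measurable_restrict_space1)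
  qed
  have geo: "(\<lambda>n. ?f n t) sums (f (of_real t) / (1 - of_real t * z))" if t: "0 < t" "t < 1" for t
  proof -
    have "cmod (of_real t * z) \<le> 1 * cmod z"
      unfolding norm_mult using t by (intro mult_right_mono) auto
    then have "(\<lambda>n. (of_real t * z) ^ n) sums (1 / (1 - of_real t * z))"
      using z by (intro geometric_sums) simp
    from sums_mult[OF this, of "f (of_real t)"] show ?thesis
      by (simp add: power_mult_distrib mult.assoc)
  qed
  have "(\<lambda>n. \<integral>t. ?f n t \<partial>unit_measure) sums (\<integral>t. (\<Sum>n. ?f n t) \<partial>unit_measure)"
  proof (rule sums_integral)
    show "integrable unit_measure (?f n)" for n
      by (intro integrable_mult_left int)
    show "AE t in unit_measure. summable (\<lambda>n. norm (?f n t))"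
    proof (rule AE_I2)
      fix t assume "t \<in> space unit_measure"
      then have t: "0 < t" "t < 1" by auto
      have "t * cmod z < 1"
        using t z by (smt (verit) mult_less_cancel_right2 norm_ge_zero zero_less_mult_pos)
      then have "summable (\<lambda>n. cmod (f (of_real t)) * (t * cmod z) ^ n)"
        using t by (intro summable_mult summable_geometric) auto
      then show "summable (\<lambda>n. norm (?f n t))"
        using t by (simp add: norm_mult norm_power power_mult_distrib mult.assoc)
    qed
    show "summable (\<lambda>n. \<integral>t. norm (?f n t) \<partial>unit_measure)"
    proof (rule summable_comparison_test')
      show "summable (\<lambda>n. (\<integral>t. norm (f (of_real t)) \<partial>unit_measure) * cmod z ^ n)"
        using z by (intro summable_mult summable_geometric) auto
      fix n
      have "(\<integral>t. norm (?f n t) \<partial>unit_measure) \<le> (\<integral>t. norm (f (of_real t)) * cmod z ^ n \<partial>unit_measure)"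
      proof (rule integral_mono)
        show "integrable unit_measure (\<lambda>t. norm (?f n t))"
          by (intro integrable_norm integrable_mult_left int)
        show "integrable unit_measure (\<lambda>t. norm (f (of_real t)) * cmod z ^ n)"
          by (intro integrable_norm integrable_mult_left integrable_radial)
        fix t assume "t \<in> space unit_measure"
        then show "norm (?f n t) \<le> norm (f (of_real t)) * cmod z ^ n"
          by (auto simp: norm_mult norm_power power_le_one intro!: mult_right_mono mult_right_le_one_le)
      qed
      also have "\<dots> = (\<integral>t. norm (f (of_real t)) \<partial>unit_measure) * cmod z ^ n"
        by simp
      finally show "norm (\<integral>t. norm (?f n t) \<partial>unit_measure) \<le> (\<integral>t. norm (f (of_real t)) \<partial>unit_measure) * cmod z ^ n"
        by simp
    qed
  qed
  also have "(\<integral>t. (\<Sum>n. ?f n t) \<partial>unit_measure) = hilbert_op f z"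
    unfolding hilbert_op_def LBINT_unit_measure
    by (intro Bochner_Integration.integral_cong refl) (use geo in \<open>auto simp: sums_iff\<close>)
  finally show ?thesis by simp
qed

lemma holomorphic_hilbert_op: "hilbert_op f holomorphic_on ball 0 1"
  by (rule power_series_holomorphic[where a = "\<lambda>n. \<integral>t. f (of_real t) * of_real t ^ n \<partial>unit_measure"])
     (use hilbert_op_sums in auto)

section \<open>Moving the path of integration to the arcs\<close>

definition arc :: "complex \<Rightarrow> real \<Rightarrow> complex" where
  "arc z t = of_real t / (1 - of_real (1 - t) * z)"

text \<open>The pull-back of f(w) / (1 - w z) dw along the arc: with D = 1 - (1 - t) z the
  derivative of the arc is (1 - z) / D^2, and 1 - w z = (1 - z) / D there, so that only 1 / D
  remains.\<close>

definition kernel :: "complex \<Rightarrow> real \<Rightarrow> complex" where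
  "kernel z t = f (arc z t) / (1 - of_real (1 - t) * z)"

context
  fixes z :: complex
  assumes z: "cmod z < 1"
begin

lemma denom_ge:
  assumes "0 \<le> t" "t \<le> 1"
  shows "cmod (1 - of_real (1 - t) * z) \<ge> 1 - (1 - t) * cmod z" "1 - (1 - t) * cmod z \<ge> 1 - cmod z"
    "1 - (1 - t) * cmod z > 0"
proof -
  have "cmod (of_real (1 - t) * z) = (1 - t) * cmod z"
    unfolding norm_mult norm_of_real using assms by simp
  then show "cmod (1 - of_real (1 - t) * z) \<ge> 1 - (1 - t) * cmod z"
    using norm_triangle_ineq2[of 1 "of_real (1 - t) * z"] by simp
  have "(1 - t) * cmod z \<le> 1 * cmod z"
    using assms by (intro mult_right_mono) auto
  then show "1 - (1 - t) * cmod z \<ge> 1 - cmod z" by simp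
  then show "1 - (1 - t) * cmod z > 0" using z by linarith
qed

text \<open>The distance of the arc from the circle is at least a multiple of 1 - t, so
  \<open>f\<close> is O((1 - t) powr (- a)) along it and the kernel is integrable.\<close>

lemma norm_arc_le:
  assumes t: "0 \<le> t" "t \<le> 1"
  shows "(1 - t) * (1 - cmod z) \<le> 1 - cmod (arc z t)"
proof -
  let ?d = "1 - (1 - t) * cmod z"
  have "cmod (arc z t) \<le> t / ?d"
    unfolding arc_def norm_divide using t denom_ge[OF t] by (intro frac_le) auto
  also have "\<dots> = 1 - (1 - t) * (1 - cmod z) / ?d"
    using denom_ge[OF t] by (simp add: field_simps)
  finally have "(1 - t) * (1 - cmod z) / ?d \<le> 1 - cmod (arc z t)" by simp
  moreover have "(1 - t) * (1 - cmod z) / 1 \<le> (1 - t) * (1 - cmod z) / ?d"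
    using t z denom_ge(3)[OF t] by (intro divide_left_mono) auto
  ultimately show ?thesis by simp
qed

lemma arc_in_ball: "0 \<le> t \<Longrightarrow> t < 1 \<Longrightarrow> cmod (arc z t) < 1"
  using norm_arc_le[of t] z by (smt (verit) mult_pos_pos)

lemma norm_kernel_le:
  assumes t: "0 \<le> t" "t < 1"
  shows "cmod (kernel z t) \<le> C * (1 - cmod z) powr (- a) / (1 - cmod z) * (1 - t) powr (- a)"
proof -
  have "cmod (f (arc z t)) \<le> C * (1 - cmod (arc z t)) powr (- a)"
    by (rule growth[OF arc_in_ball[OF t]])
  also have "\<dots> \<le> C * ((1 - t) * (1 - cmod z)) powr (- a)"
    using t z norm_arc_le[of t] a01 C_nonneg by (intro mult_left_mono powr_mono2') auto
  also have "\<dots> = C * (1 - cmod z) powr (- a) * (1 - t) powr (- a)"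
    using t z by (simp add: powr_mult)
  finally have "cmod (f (arc z t)) \<le> C * (1 - cmod z) powr (- a) * (1 - t) powr (- a)" .
  moreover have "1 - cmod z \<le> cmod (1 - of_real (1 - t) * z)"
    using denom_ge[of t] t by linarith
  ultimately have "cmod (kernel z t) \<le> C * (1 - cmod z) powr (- a) * (1 - t) powr (- a) / (1 - cmod z)"
    unfolding kernel_def norm_divide using z C_nonneg by (intro frac_le) auto
  then show ?thesis by simp
qed

lemma continuous_arc: "continuous_on {0..1} (arc z)"
  unfolding arc_def using denom_ge z by (intro continuous_intros) force

lemma continuous_kernel: "continuous_on {0..<1} (kernel z)"
proof -
  have arc: "continuous_on {0..<1} (arc z)"
    by (rule continuous_on_subset[OF continuous_arc]) auto
  have "continuous_on {0..<1} (\<lambda>t. f (arc z t))"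
    by (rule continuous_on_compose2[OF holomorphic_on_imp_continuous_on[OF holo] arc])
       (use arc_in_ball in auto)
  moreover have "1 - of_real (1 - t) * z \<noteq> 0" if "t \<in> {0..<1}" for t
    using denom_ge[of t] that z by force
  ultimately show ?thesis
    unfolding kernel_def by (intro continuous_intros) auto
qed

lemma integrable_kernel: "integrable unit_measure (kernel z)"
proof (rule Bochner_Integration.integrable_bound)
  show "integrable unit_measure (\<lambda>t. C * (1 - cmod z) powr (- a) / (1 - cmod z) * (1 - t) powr (- a))"
    using a01 by (intro integrable_mult_right integrable_unit_measure_powr) auto
  show "AE t in unit_measure. norm (kernel z t) \<le> norm (C * (1 - cmod z) powr (- a) / (1 - cmod z) * (1 - t) powr (- a))"
  proof (rule AE_I2)
    fix t assume "t \<in> space unit_measure"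
    then have t: "0 \<le> t" "t < 1" by auto
    show "norm (kernel z t) \<le> norm (C * (1 - cmod z) powr (- a) / (1 - cmod z) * (1 - t) powr (- a))"
      by (rule order_trans[OF norm_kernel_le[OF t]]) (simp only: real_norm_def abs_ge_self)
  qed
qed (rule borel_measurable_unit_measure[OF continuous_on_subset[OF continuous_kernel]], auto)

text \<open>Primitives are available only inside the disk, so the fundamental theorem is applied up
  to x n < 1 and the endpoint is reached by dominated convergence.\<close>

lemma unit_integral_limit:
  fixes g :: "real \<Rightarrow> complex"
  assumes g: "integrable unit_measure g" and x: "x \<longlonglongrightarrow> 1" "\<And>n. 0 < x n" "\<And>n. x n < 1"
  shows "(\<lambda>n. \<integral>t. indicator {0..x n} t *\<^sub>R g t \<partial>lborel) \<longlonglongrightarrow> (\<integral>t. g t \<partial>unit_measure)"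
proof -
  have "(\<lambda>n. \<integral>t. indicator {0..x n} t *\<^sub>R g t \<partial>unit_measure) \<longlonglongrightarrow> (\<integral>t. g t \<partial>unit_measure)"
  proof (rule integral_dominated_convergence[where w = "\<lambda>t. norm (g t)"])
    show "AE t in unit_measure. (\<lambda>n. indicator {0..x n} t *\<^sub>R g t) \<longlonglongrightarrow> g t"
    proof (rule AE_I2)
      fix t assume "t \<in> space unit_measure"
      then have t: "0 < t" "t < 1" by auto
      have "\<forall>\<^sub>F n in sequentially. t < x n"
        using order_tendstoD(1)[OF x(1) t(2)] .
      then have "\<forall>\<^sub>F n in sequentially. indicator {0..x n} t *\<^sub>R g t = g t"
        by eventually_elim (use t in \<open>auto simp: indicator_def\<close>)
      then show "(\<lambda>n. indicator {0..x n} t *\<^sub>R g t) \<longlonglongrightarrow> g t"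
        by (rule tendsto_eventually)
    qed
    show "(\<lambda>t. indicator {0..x n} t *\<^sub>R g t) \<in> borel_measurable unit_measure" for n
      by (intro borel_measurable_scaleR borel_measurable_integrable[OF g] measurable_restrict_space1) auto
  qed (use g in \<open>auto intro!: AE_I2 simp: indicator_def\<close>)
  moreover have "(\<integral>t. indicator {0..x n} t *\<^sub>R g t \<partial>unit_measure) = (\<integral>t. indicator {0..x n} t *\<^sub>R g t \<partial>lborel)" for n
  proof -
    have "(\<integral>t. indicator {0..x n} t *\<^sub>R g t \<partial>unit_measure) = (\<integral>t. indicator {0<..<1} t *\<^sub>R indicator {0..x n} t *\<^sub>R g t \<partial>lborel)"
      by (subst integral_restrict_space) auto
    also have "\<dots> = (\<integral>t. indicator {0..x n} t *\<^sub>R g t \<partial>lborel)"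
    proof (rule integral_cong_AE)
      have "(\<lambda>t. indicator {0<..<1} t *\<^sub>R g t) \<in> borel_measurable lborel"
        using borel_measurable_integrable[OF g] by (subst (asm) borel_measurable_restrict_space_iff) auto
      then have m: "(\<lambda>t. indicator {0..x n} t *\<^sub>R (indicator {0<..<1} t *\<^sub>R g t)) \<in> borel_measurable lborel"
        by measurable
      then show "(\<lambda>t. indicator {0<..<1} t *\<^sub>R indicator {0..x n} t *\<^sub>R g t) \<in> borel_measurable lborel"
        by (simp add: mult.commute)
      \<comment> \<open>Measurability of \<open>g\<close> is known on the open interval only; the
        endpoint 0 is put back as a single value.\<close>
      have "(\<lambda>t. indicator {0..x n} t *\<^sub>R (indicator {0<..<1} t *\<^sub>R g t) + indicator {0} t *\<^sub>R g 0) \<in> borel_measurable lborel"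
        using m by measurable
      also have "(\<lambda>t. indicator {0..x n} t *\<^sub>R (indicator {0<..<1} t *\<^sub>R g t) + indicator {0} t *\<^sub>R g 0) = (\<lambda>t. indicator {0..x n} t *\<^sub>R g t)"
        using x(2,3)[of n] by (auto simp: fun_eq_iff indicator_def)
      finally show "(\<lambda>t. indicator {0..x n} t *\<^sub>R g t) \<in> borel_measurable lborel" .
      show "AE t in lborel. indicator {0<..<1} t *\<^sub>R indicator {0..x n} t *\<^sub>R g t = indicator {0..x n} t *\<^sub>R g t"
        by (rule AE_mp[OF AE_lborel_singleton[of 0]]) (use x(2,3)[of n] in \<open>auto intro!: AE_I2 simp: indicator_def\<close>)
    qed
    finally show ?thesis .
  qed
  ultimately show ?thesis by simp
qed

text \<open>
  The segment from \<open>t\<close> to \<open>arc z t\<close> has length \<open>O(1 - t)\<close> and keeps a distance comparable to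
  \<open>1 - t\<close> from the unit circle, where the integrand is \<open>O((1 - t) powr (- a))\<close>; as \<open>a < 1\<close> the two
  paths from 0 to 1 give the same integral.
\<close>

lemma hilbert_op_eq_kernel: "hilbert_op f z = (\<integral>t. kernel z t \<partial>unit_measure)"
proof -
  define q where "q w = f w / (1 - w * z)" for w
  have wz: "cmod (1 - w * z) \<ge> 1 - cmod z" if "cmod w \<le> 1" for w
  proof -
    have "cmod (w * z) \<le> 1 * cmod z"
      unfolding norm_mult using that by (intro mult_right_mono) auto
    then show ?thesis using norm_triangle_ineq2[of 1 "w * z"] by simp
  qed
  have nz: "1 - w * z \<noteq> 0" if "w \<in> ball 0 1" for w
  proof
    assume "1 - w * z = 0"
    then show False using wz[of w] that z by simp
  qed
  have q_holo: "q holomorphic_on ball 0 1"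
    unfolding q_def using holo nz by (intro holomorphic_intros)
  obtain G where G: "\<And>w. w \<in> ball 0 1 \<Longrightarrow> (G has_field_derivative q w) (at w within ball 0 1)"
    using holomorphic_convex_primitive'[OF convex_ball open_ball q_holo] by blast
  have G': "(G has_field_derivative q w) (at w)" if "cmod w < 1" for w
    using G[of w] that at_within_open[of w "ball 0 1"] by simp
  have q_int: "integrable unit_measure (\<lambda>t. q (of_real t))"
  proof (rule Bochner_Integration.integrable_bound)
    show "integrable unit_measure (\<lambda>t. 1 / (1 - cmod z) * norm (f (of_real t)))"
      by (intro integrable_mult_right integrable_norm integrable_radial)
    show "(\<lambda>t. q (of_real t)) \<in> borel_measurable unit_measure"
      by (rule measurable_disk_real[OF q_holo])
    show "AE t in unit_measure. norm (q (of_real t)) \<le> norm (1 / (1 - cmod z) * norm (f (of_real t)))"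
    proof (rule AE_I2)
      fix t assume "t \<in> space unit_measure"
      then have "norm (q (of_real t)) \<le> norm (f (of_real t)) / (1 - cmod z)"
        unfolding q_def norm_divide using wz[of "of_real t"] nz[of "of_real t"] z
        by (intro divide_left_mono mult_pos_pos) auto
      then show "norm (q (of_real t)) \<le> norm (1 / (1 - cmod z) * norm (f (of_real t)))"
        using z by simp
    qed
  qed
  define x where "x n = 1 - 1 / real (n + 2)" for n
  have x01: "0 < x n" "x n < 1" for n by (auto simp: x_def field_simps)
  have x_lim: "x \<longlonglongrightarrow> 1"
  proof -
    have "(\<lambda>n. 1 / real (n + 2)) \<longlonglongrightarrow> 0"
      using LIMSEQ_ignore_initial_segment[OF lim_1_over_n, of 2] by simp
    from tendsto_diff[OF tendsto_const[of 1] this] show ?thesis by (simp add: x_def[abs_def])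
  qed
  have I1: "(\<integral>t. indicator {0..x n} t *\<^sub>R q (of_real t) \<partial>lborel) = G (of_real (x n)) - G 0" for n
  proof -
    have "(\<integral>t. indicator {0..x n} t *\<^sub>R q (of_real t) \<partial>lborel) = G (of_real (x n)) - G (of_real 0)"
    proof (rule integral_FTC_Icc[where F = "\<lambda>t. G (of_real t)"])
      show "continuous_on {0..x n} (\<lambda>t. q (of_real t))"
        by (rule continuous_on_compose2[OF holomorphic_on_imp_continuous_on[OF q_holo]])
           (use x01[of n] in \<open>auto intro!: continuous_intros\<close>)
      fix t assume "0 \<le> t" "t \<le> x n"
      then have "(G has_field_derivative q (of_real t)) (at (of_real t))"
        using x01[of n] by (intro G') auto
      from field_vector_diff_chain_within[OF has_vector_derivative_of_real[OF DERIV_ident[THEN has_field_derivative_at_within]] this[THEN has_field_derivative_at_within]]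
      show "((\<lambda>t. G (of_real t)) has_vector_derivative q (of_real t)) (at t within {0..x n})"
        by (simp add: o_def)
    qed (use x01[of n] in auto)
    then show ?thesis by simp
  qed
  have I2: "(\<integral>t. indicator {0..x n} t *\<^sub>R kernel z t \<partial>lborel) = G (arc z (x n)) - G 0" for n
  proof -
    have "(\<integral>t. indicator {0..x n} t *\<^sub>R kernel z t \<partial>lborel) = G (arc z (x n)) - G (arc z 0)"
    proof (rule integral_FTC_Icc[where F = "\<lambda>t. G (arc z t)"])
      show "continuous_on {0..x n} (kernel z)"
        by (rule continuous_on_subset[OF continuous_kernel]) (use x01[of n] in auto)
      fix t assume "0 \<le> t" "t \<le> x n"
      then have t: "0 \<le> t" "t < 1" using x01[of n] by auto
      have nz: "1 - of_real (1 - t) * z \<noteq> 0"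
        using denom_ge[of t] t z by force
      have z1: "1 - z \<noteq> 0" using z by auto
      define D where "D = 1 - of_real (1 - t) * z"
      have Dnz: "D \<noteq> 0" using nz by (simp add: D_def)
      have arcD: "((\<lambda>w. w / (1 - (1 - w) * z)) has_field_derivative (1 - z) / D\<^sup>2) (at (of_real t))"
      proof -
        have "((\<lambda>w. 1 - (1 - w) * z) has_field_derivative z) (at (of_real t))"
          by (auto intro!: derivative_eq_intros)
        from DERIV_divide[OF DERIV_ident this] Dnz show ?thesis
          by (simp add: D_def power2_eq_square algebra_simps)
      qed
      have a1: "(arc z has_vector_derivative (1 - z) / D\<^sup>2) (at t within {0..x n})"
        using field_vector_diff_chain_within[OF has_vector_derivative_of_real[OF DERIV_ident[THEN has_field_derivative_at_within]] arcD[THEN has_field_derivative_at_within]]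
        by (simp add: o_def arc_def[abs_def])
      have "(G has_field_derivative q (arc z t)) (at (arc z t))"
        using arc_in_ball[OF t] by (rule G')
      from field_vector_diff_chain_within[OF a1 this[THEN has_field_derivative_at_within]]
      have "((\<lambda>t. G (arc z t)) has_vector_derivative ((1 - z) / D\<^sup>2 * q (arc z t))) (at t within {0..x n})"
        by (simp add: o_def)
      moreover have "(1 - z) / D\<^sup>2 * q (arc z t) = kernel z t"
      proof -
        have "1 - arc z t * z = (1 - z) / D"
          using Dnz unfolding arc_def D_def[symmetric] by (simp add: field_simps) (simp add: D_def algebra_simps)
        then show ?thesis
          using Dnz z1 unfolding q_def kernel_def D_def[symmetric] by (simp add: power2_eq_square)
      qed
      ultimately show "((\<lambda>t. G (arc z t)) has_vector_derivative kernel z t) (at t within {0..x n})"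
        by simp
    qed (use x01[of n] in auto)
    then show ?thesis by (simp add: arc_def)
  qed
  define \<rho> where "\<rho> = 1 - cmod z"
  have \<rho>: "0 < \<rho>" "\<rho> \<le> 1" using z by (auto simp: \<rho>_def)
  have diff: "cmod (G (of_real (x n)) - G (arc z (x n))) \<le> C * \<rho> powr (- a) / (\<rho> * \<rho>) * (1 - x n) powr (1 - a)" for n
  proof -
    \<comment> \<open>By \<open>norm_arc_le\<close> the disk of radius \<open>?r\<close> contains
      both end points. It is convex, so the growth bound on it and the mean value inequality
      estimate the difference of the primitives.\<close>
    let ?r = "1 - (1 - x n) * \<rho>"
    have r1: "?r < 1" using x01[of n] \<rho> by simp
    have "cmod (G (of_real (x n)) - G (arc z (x n))) \<le> C * ((1 - x n) * \<rho>) powr (- a) / \<rho> * cmod (of_real (x n) - arc z (x n))"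
    proof (rule field_differentiable_bound[of "cball 0 ?r" G q])
      fix w :: complex assume "w \<in> cball 0 ?r"
      then have w: "cmod w \<le> ?r" "cmod w < 1" using r1 by auto
      show "(G has_field_derivative q w) (at w within cball 0 ?r)"
        by (rule has_field_derivative_at_within[OF G'[OF w(2)]])
      have "cmod (f w) \<le> C * (1 - cmod w) powr (- a)" by (rule growth[OF w(2)])
      also have "\<dots> \<le> C * ((1 - x n) * \<rho>) powr (- a)"
        using w x01[of n] \<rho> a01 C_nonneg by (intro mult_left_mono powr_mono2') auto
      finally show "cmod (q w) \<le> C * ((1 - x n) * \<rho>) powr (- a) / \<rho>"
        unfolding q_def norm_divide using wz[of w] w \<rho> C_nonneg by (intro frac_le) (auto simp: \<rho>_def)
    next
      have "(1 - x n) * \<rho> \<le> 1 - x n"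
        using x01[of n] \<rho> by (intro mult_left_le) auto
      then have "x n \<le> ?r"
        by (simp only: le_diff_eq add.commute)
      then show "of_real (x n) \<in> cball (0::complex) ?r" using x01[of n] by (simp add: less_imp_le)
      show "arc z (x n) \<in> cball 0 ?r"
        using norm_arc_le[of "x n"] x01[of n] by (simp add: \<rho>_def)
    qed simp
    also have "C * ((1 - x n) * \<rho>) powr (- a) / \<rho> * cmod (of_real (x n) - arc z (x n))
      \<le> C * ((1 - x n) * \<rho>) powr (- a) / \<rho> * ((1 - x n) / \<rho>)"
    proof (rule mult_left_mono)
      let ?t = "x n"
      have t: "0 \<le> ?t" "?t \<le> 1" using x01[of n] by auto
      have nz: "1 - of_real (1 - ?t) * z \<noteq> 0"
        using denom_ge[OF t] by force
      have "of_real ?t - arc z ?t = - of_real (?t * (1 - ?t)) * z / (1 - of_real (1 - ?t) * z)"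
        using nz unfolding arc_def by (simp add: field_simps)
      also have "cmod \<dots> = ?t * (1 - ?t) * cmod z / cmod (1 - of_real (1 - ?t) * z)"
        unfolding norm_divide norm_mult norm_minus_cancel norm_of_real using t by simp
      also have "\<dots> \<le> (1 - ?t) / \<rho>"
      proof (rule frac_le)
        have "?t * (1 - ?t) * cmod z \<le> 1 * (1 - ?t) * 1"
          using t z by (intro mult_mono) auto
        then show "?t * (1 - ?t) * cmod z \<le> 1 - ?t" by simp
        show "\<rho> \<le> cmod (1 - of_real (1 - ?t) * z)"
          using denom_ge[OF t] by (simp add: \<rho>_def)
      qed (use t \<rho> in auto)
      finally show "cmod (of_real ?t - arc z ?t) \<le> (1 - ?t) / \<rho>" .
    qed (use C_nonneg \<rho> in simp)
    also have "C * ((1 - x n) * \<rho>) powr (- a) / \<rho> * ((1 - x n) / \<rho>) = C * \<rho> powr (- a) / (\<rho> * \<rho>) * (1 - x n) powr (1 - a)"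
    proof -
      have "C * (u * \<rho>) powr (- a) / \<rho> * (u / \<rho>) = C * \<rho> powr (- a) / (\<rho> * \<rho>) * u powr (1 - a)" if "u > 0" for u
        using that \<rho> by (simp add: powr_mult powr_diff powr_minus field_simps)
      then show ?thesis using x01[of n] by simp
    qed
    finally show ?thesis .
  qed
  have "(\<lambda>n. C * \<rho> powr (- a) / (\<rho> * \<rho>) * (1 - x n) powr (1 - a)) \<longlonglongrightarrow> C * \<rho> powr (- a) / (\<rho> * \<rho>) * (1 - 1) powr (1 - a)"
    using x01 a01 by (intro tendsto_intros tendsto_powr2 x_lim) (auto intro!: always_eventually less_imp_le)
  then have "(\<lambda>n. C * \<rho> powr (- a) / (\<rho> * \<rho>) * (1 - x n) powr (1 - a)) \<longlonglongrightarrow> 0"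
    by simp
  then have diff_lim: "(\<lambda>n. G (of_real (x n)) - G (arc z (x n))) \<longlonglongrightarrow> 0"
    by (rule Lim_null_comparison[OF always_eventually, rotated]) (use diff in auto)
  have "(\<lambda>n. (G (of_real (x n)) - G 0) - (G (arc z (x n)) - G 0)) \<longlonglongrightarrow>
     (\<integral>t. q (of_real t) \<partial>unit_measure) - (\<integral>t. kernel z t \<partial>unit_measure)"
    using unit_integral_limit[OF q_int x_lim x01] unit_integral_limit[OF integrable_kernel x_lim x01]
    unfolding I1 I2 by (rule tendsto_diff)
  then have "(\<lambda>n. G (of_real (x n)) - G (arc z (x n))) \<longlonglongrightarrow>
     (\<integral>t. q (of_real t) \<partial>unit_measure) - (\<integral>t. kernel z t \<partial>unit_measure)"
    by simp
  from LIMSEQ_unique[OF this diff_lim] show ?thesis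
    by (simp add: hilbert_op_def LBINT_unit_measure q_def)
qed

end

end

section \<open>The upper bound\<close>

context hilbert_bergman
begin

abbreviation (input) "disk \<equiv> dA (2 * real m * a - 2)"
abbreviation (input) "bspace \<equiv> bergman_space (2 * real m) (2 * real m * a - 2)"
abbreviation (input) "bnorm \<equiv> bergman_norm (2 * real m) (2 * real m * a - 2)"

lemma weight_gt: "2 * real m * a - 2 > -1" using gam by simp

lemma emeasure_disk: "emeasure disk (ball 0 1) = 1"
  by (rule emeasure_dA_ball[OF weight_gt])

lemma finite_measure_disk: "finite_measure disk"
  using emeasure_disk by (intro finite_measureI) simp

lemma powr_2m: "x \<ge> 0 \<Longrightarrow> x powr (2 * real m) = x ^ (2 * m)"
  using m by (cases "x = 0") (auto simp: powr_realpow[symmetric])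

lemma power_2m_expo: "x \<ge> 0 \<Longrightarrow> (x ^ (2 * m)) powr expo = x"
  using m by (cases "x = 0") (auto simp: powr_realpow[symmetric] powr_powr expo_def)

lemma holomorphic_measurable:
  assumes "f holomorphic_on ball 0 1"
  shows "f \<in> borel_measurable (dA \<alpha>)"
  using borel_measurable_continuous_on_restrict[OF holomorphic_on_imp_continuous_on[OF assms]]
  by (simp add: measurable_cong_sets[OF sets_dA refl])

lemma bergman_space_iff:
  "f \<in> bspace \<longleftrightarrow>
    f holomorphic_on ball 0 1 \<and> (\<integral>\<^sup>+z. ennreal (cmod (f z) ^ (2 * m)) \<partial>disk) < \<infinity>"
proof -
  have "integrable disk (\<lambda>z. cmod (f z) ^ (2 * m)) \<longleftrightarrow> (\<integral>\<^sup>+z. ennreal (cmod (f z) ^ (2 * m)) \<partial>disk) < \<infinity>"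
    if "f holomorphic_on ball 0 1"
    using holomorphic_measurable[OF that, of "2 * real m * a - 2"] by (simp add: integrable_iff_bounded)
  then show ?thesis
    by (auto simp: bergman_space_def powr_2m)
qed

lemma nn_integral_bergman_norm:
  assumes "f \<in> bspace"
  shows "(\<integral>\<^sup>+z. ennreal (cmod (f z) ^ (2 * m)) \<partial>disk)
    = ennreal (bnorm f ^ (2 * m))"
proof -
  let ?I = "\<integral>z. cmod (f z) powr (2 * real m) \<partial>disk"
  have "(\<integral>\<^sup>+z. ennreal (cmod (f z) powr (2 * real m)) \<partial>disk) = ennreal ?I"
    using assms by (intro nn_integral_eq_integral) (auto simp: bergman_space_def)
  moreover have "(?I powr (1 / (2 * real m))) ^ (2 * m) = ?I"
  proof -
    have "?I \<ge> 0" by (rule Bochner_Integration.integral_nonneg) simp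
    then show ?thesis
      using m by (subst powr_2m[symmetric]) (auto simp: powr_powr)
  qed
  ultimately show ?thesis
    by (simp add: bergman_norm_def powr_2m)
qed

lemma bergman_norm_nonneg: "bergman_norm p \<alpha> f \<ge> 0"
  by (simp add: bergman_norm_def)

lemma coeff_sum_eq:
  assumes f: "f \<in> bspace"
  defines "c \<equiv> \<lambda>n. (deriv ^^ n) (\<lambda>z. f z ^ m) 0 / fact n"
  shows "\<And>z. cmod z < 1 \<Longrightarrow> (\<lambda>n. c n * z ^ n) sums (f z ^ m)"
    and "(\<Sum>j<N. D_entry m a j * (cmod (c j))\<^sup>2) \<le> bnorm f ^ (2 * m)"
proof -
  have holo: "f holomorphic_on ball 0 1" using f by (simp add: bergman_space_def)
  show sums: "(\<lambda>n. c n * z ^ n) sums (f z ^ m)" if "cmod z < 1" for z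
    unfolding c_def using holo that by (intro ball_power_series_sums holomorphic_intros)
  have "(\<Sum>j<N. ennreal (D_entry m a j * (cmod (c j))\<^sup>2)) \<le> (\<Sum>j. ennreal (D_entry m a j * (cmod (c j))\<^sup>2))"
    by (intro sum_le_suminf) auto
  also have "\<dots> = (\<integral>\<^sup>+z. ennreal ((cmod (f z ^ m))\<^sup>2) \<partial>disk)"
    by (subst nn_integral_dA_power_series[OF weight_gt sums]) (simp_all add: D_entry_def)
  also have "\<dots> = ennreal (bnorm f ^ (2 * m))"
    using nn_integral_bergman_norm[OF f] by (simp add: norm_power power_mult[symmetric] mult.commute)
  finally show "(\<Sum>j<N. D_entry m a j * (cmod (c j))\<^sup>2) \<le> bnorm f ^ (2 * m)"
    using D_entry_pos bergman_norm_nonneg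
    by (subst (asm) sum_ennreal) (auto simp: ennreal_le_iff intro!: mult_nonneg_nonneg less_imp_le[OF D_entry_pos])
qed

text \<open>Cauchy-Schwarz for the Taylor series of f ^ m with weights \<open>D_entry m a j\<close>.
  The sum of |z|^(2 j) / D_j is the reproducing kernel on the diagonal, (1 - |z|^2) powr (- gam),
  and the 2m-th root turns gam into \<open>a\<close>.\<close>

lemma bergman_growth:
  assumes f: "f \<in> bspace" and z: "cmod z < 1"
  shows "cmod (f z) \<le> bnorm f * (1 - cmod z) powr (- a)"
proof -
  let ?n = "bnorm f"
  define c where "c n = (deriv ^^ n) (\<lambda>z. f z ^ m) 0 / fact n" for n
  note c = coeff_sum_eq[OF f, folded c_def]
  have z2: "(cmod z)\<^sup>2 < 1" using z by (simp add: abs_square_less_1)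
  have bin: "(\<lambda>j. pochhammer (2 * real m * a) j / fact j * ((cmod z)\<^sup>2) ^ j) sums (1 - (cmod z)\<^sup>2) powr (- (2 * real m * a))"
    using z2 by (intro negative_binomial_real) auto
  have le: "(cmod (\<Sum>j<N. c j * z ^ j))\<^sup>2 \<le> ?n ^ (2 * m) * (1 - (cmod z)\<^sup>2) powr (- (2 * real m * a))" for N
  proof -
    let ?D = "D_entry m a"
    have "cmod (\<Sum>j<N. c j * z ^ j) \<le> (\<Sum>j<N. (sqrt (?D j) * cmod (c j)) * (cmod z ^ j / sqrt (?D j)))"
      by (rule sum_norm_le) (use D_entry_pos in \<open>auto simp: norm_mult norm_power less_imp_neq[OF D_entry_pos, symmetric]\<close>)
    then have "(cmod (\<Sum>j<N. c j * z ^ j))\<^sup>2 \<le> (\<Sum>j<N. (sqrt (?D j) * cmod (c j)) * (cmod z ^ j / sqrt (?D j)))\<^sup>2"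
      by (intro power_mono) auto
    also have "\<dots> \<le> (\<Sum>j<N. (sqrt (?D j) * cmod (c j))\<^sup>2) * (\<Sum>j<N. (cmod z ^ j / sqrt (?D j))\<^sup>2)"
      by (rule Cauchy_Schwarz_ineq_sum)
    also have "(\<Sum>j<N. (sqrt (?D j) * cmod (c j))\<^sup>2) = (\<Sum>j<N. ?D j * (cmod (c j))\<^sup>2)"
      using D_entry_pos by (intro sum.cong) (auto simp: power_mult_distrib less_imp_le)
    also have "(\<Sum>j<N. (cmod z ^ j / sqrt (?D j))\<^sup>2) = (\<Sum>j<N. pochhammer (2 * real m * a) j / fact j * ((cmod z)\<^sup>2) ^ j)"
      by (intro sum.cong refl) (simp add: power_divide less_imp_le[OF D_entry_pos] D_entry_def[symmetric] power_mult[symmetric] mult.commute, simp add: D_entry_def mult_ac)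
    also have "(\<Sum>j<N. ?D j * (cmod (c j))\<^sup>2) * (\<Sum>j<N. pochhammer (2 * real m * a) j / fact j * ((cmod z)\<^sup>2) ^ j)
       \<le> ?n ^ (2 * m) * (1 - (cmod z)\<^sup>2) powr (- (2 * real m * a))"
    proof (rule mult_mono[OF c(2)])
      show "(\<Sum>j<N. pochhammer (2 * real m * a) j / fact j * ((cmod z)\<^sup>2) ^ j) \<le> (1 - (cmod z)\<^sup>2) powr (- (2 * real m * a))"
        unfolding sums_unique[OF bin] using gam_pos
        by (intro sum_le_suminf sums_summable[OF bin]) (auto intro!: mult_nonneg_nonneg divide_nonneg_nonneg pochhammer_nonneg)
      show "0 \<le> (\<Sum>j<N. pochhammer (2 * real m * a) j / fact j * ((cmod z)\<^sup>2) ^ j)"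
        using gam_pos by (intro sum_nonneg mult_nonneg_nonneg divide_nonneg_nonneg pochhammer_nonneg) auto
    qed (use bergman_norm_nonneg in auto)
    finally show ?thesis .
  qed
  have "(\<lambda>N. (cmod (\<Sum>j<N. c j * z ^ j))\<^sup>2) \<longlonglongrightarrow> (cmod (f z ^ m))\<^sup>2"
    using c(1)[OF z] unfolding sums_def by (intro tendsto_intros)
  then have "(cmod (f z ^ m))\<^sup>2 \<le> ?n ^ (2 * m) * (1 - (cmod z)\<^sup>2) powr (- (2 * real m * a))"
    by (rule LIMSEQ_le_const2) (use le in auto)
  then have "cmod (f z) ^ (2 * m) \<le> ?n ^ (2 * m) * (1 - (cmod z)\<^sup>2) powr (- (2 * real m * a))"
    by (simp add: norm_power power_mult[symmetric] mult.commute)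
  then have "(cmod (f z) ^ (2 * m)) powr expo \<le> (?n ^ (2 * m) * (1 - (cmod z)\<^sup>2) powr (- (2 * real m * a))) powr expo"
    using expo_bounds by (intro powr_mono2) auto
  also have "\<dots> = ?n * (1 - (cmod z)\<^sup>2) powr (- a)"
    using bergman_norm_nonneg m by (simp add: powr_mult power_2m_expo powr_powr) (simp add: expo_def)
  also have "(1 - (cmod z)\<^sup>2) powr (- a) \<le> (1 - cmod z) powr (- a)"
  proof -
    have "(cmod z)\<^sup>2 \<le> 1 * cmod z"
      unfolding power2_eq_square using z by (intro mult_right_mono) auto
    then show ?thesis using z a by (intro powr_mono2') auto
  qed
  finally show ?thesis
    using bergman_norm_nonneg by (simp add: power_2m_expo mult_left_mono)
qed

lemma radial_growth_bergman:
  assumes "f \<in> bspace"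
  shows "radial_growth f (bnorm f) a"
  using assms bergman_growth[OF assms] a
  by unfold_locales (auto simp: bergman_space_def)

lemma weighted_comp_norm_bound:
  assumes t: "0 < t" "t < 1" and z: "cmod z < 1"
  shows "cmod (weighted_comp t (\<lambda>w. \<Sum>j\<le>N. c j * w ^ j) z) \<le> (\<Sum>j\<le>N. cmod (c j)) / (1 - cmod z) ^ m"
proof -
  \<comment> \<open>The arc and its estimates do not depend on the function, so the zero function
    gives access to them.\<close>
  interpret radial_growth "\<lambda>_. 0" 0 "1/2" by unfold_locales auto
  have arc: "cmod (arc z t) \<le> 1" using arc_in_ball[OF z, of t] t by simp
  have "cmod (\<Sum>j\<le>N. c j * arc z t ^ j) \<le> (\<Sum>j\<le>N. cmod (c j))"
    using arc by (intro sum_norm_le) (auto simp: norm_mult norm_power power_le_one intro!: mult_right_le_one_le)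
  moreover have "(1 - cmod z) ^ m \<le> cmod ((1 - of_real (1 - t) * z) ^ m)"
    unfolding norm_power using denom_ge[OF z, of t] t z by (intro power_mono) auto
  ultimately show ?thesis
    unfolding weighted_comp_def arc_def norm_divide using z by (intro frac_le) (auto intro: sum_nonneg)
qed

text \<open>Minkowski's inequality in \<open>t\<close>: the slice at \<open>t\<close> has a 2m-th
  power norm equal to a form of \<open>B_mat\<close>, and integrating its root over \<open>t\<close>
  gives at most \<open>rPhi\<close> of the moduli. The number \<eta> makes the weight
  \<open>v\<close> strictly positive even when \<open>c\<close> vanishes; it is sent to 0 in
  \<open>hilbert_op_bound\<close>.\<close>

lemma section_inequality:
  assumes S: "boyd_supersolutions m a"
  defines "g \<equiv> \<lambda>N c z. \<integral>\<^sup>+t. ennreal (cmod (weighted_comp t (\<lambda>w. \<Sum>j\<le>N. c j * w ^ j) z) powr (1 / real m)) \<partial>unit_measure"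
  assumes L: "(\<Sum>j\<le>N. D_entry m a j * (cmod (c j))\<^sup>2) \<le> L ^ (2 * m)" "L \<ge> 0" and \<eta>: "\<eta> > 0"
  shows "(\<integral>\<^sup>+z. g N c z ^ (2 * m) \<partial>disk) \<le> ennreal ((Beta a (1 - a) * L + \<eta>) ^ (2 * m))"
proof -
  define u where "u t z = cmod (weighted_comp t (\<lambda>w. \<Sum>j\<le>N. c j * w ^ j) z) powr (1 / real m)" for t z
  define v where "v t = rform N (\<lambda>j. cmod (c j)) (\<lambda>j. cmod (c j)) t powr expo + \<eta>" for t
  define M where "M = rPhi N (\<lambda>j. cmod (c j)) + \<eta>"
  obtain n where n: "2 * m = Suc n" using m by (cases "2 * m") auto
  have unit1: "emeasure unit_measure {0<..<1} = 1"
    by (subst emeasure_restrict_space) auto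
  have rn: "rPhi N (\<lambda>j. cmod (c j)) \<ge> 0"
    unfolding rPhi_def by (rule Bochner_Integration.integral_nonneg) simp
  have Mpos: "M > 0" using rn \<eta> by (simp add: M_def)
  have Beta_nn: "Beta a (1 - a) \<ge> 0"
    using a by (intro less_imp_le Beta_real_pos) auto
  have "rPhi N (\<lambda>j. cmod (c j)) \<le> Beta a (1 - a) * (\<Sum>j\<le>N. D_entry m a j * (cmod (c j))\<^sup>2) powr expo"
    using Phi_le_Beta[OF S, of N "\<lambda>j. of_real (cmod (c j))"] by (simp add: Phi_of_real)
  also have "\<dots> \<le> Beta a (1 - a) * (L ^ (2 * m)) powr expo"
    using L expo_bounds Beta_nn
    by (intro mult_left_mono powr_mono2) (auto intro!: sum_nonneg mult_nonneg_nonneg less_imp_le[OF D_entry_pos])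
  finally have M_le: "M \<le> Beta a (1 - a) * L + \<eta>"
    using L by (simp add: M_def power_2m_expo)
  have "(\<integral>\<^sup>+z. (\<integral>\<^sup>+t. ennreal (u t z) \<partial>unit_measure) ^ Suc n \<partial>disk) \<le> ennreal (M ^ Suc n)"
  proof (rule nn_integral_Minkowski[where v = v])
    show "sigma_finite_measure unit_measure"
      by (rule finite_measure.axioms(1)[OF finite_measure_unit])
    show "sigma_finite_measure disk"
      by (rule finite_measure.axioms(1)[OF finite_measure_disk])
    have fst_m: "fst \<in> unit_measure \<Otimes>\<^sub>M disk \<rightarrow>\<^sub>M borel"
      by (rule measurable_compose[OF measurable_fst measurable_restrict_space1]) simp
    have snd_m: "snd \<in> unit_measure \<Otimes>\<^sub>M disk \<rightarrow>\<^sub>M borel"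
      by (rule measurable_compose[OF measurable_snd borel_measurable_dA]) simp
    have "(\<lambda>x. u (fst x) (snd x)) \<in> borel_measurable (borel \<Otimes>\<^sub>M borel)"
      unfolding u_def weighted_comp_def by measurable
    from measurable_compose[OF measurable_Pair[OF fst_m snd_m] this]
    show "(\<lambda>(t, z). u t z) \<in> borel_measurable (unit_measure \<Otimes>\<^sub>M disk)"
      by (simp add: case_prod_unfold)
    show "v \<in> borel_measurable unit_measure"
      unfolding v_def by (rule measurable_restrict_space1) simp
    show "0 \<le> u t z" for t z by (simp add: u_def)
    show "0 < v t" for t using \<eta> by (simp add: v_def add_nonneg_pos)
    show "(\<integral>\<^sup>+z. ennreal (u t z ^ Suc n) \<partial>disk) \<le> ennreal (v t ^ Suc n)" if "t \<in> space unit_measure" for t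
    proof -
      from that have t: "0 < t" "t < 1" by auto
      let ?r = "rform N (\<lambda>j. cmod (c j)) (\<lambda>j. cmod (c j)) t"
      have "u t z ^ Suc n = (cmod (weighted_comp t (\<lambda>w. \<Sum>j\<le>N. c j * w ^ j) z))\<^sup>2" for z
      proof -
        have "u t z ^ (2 * m) = ((cmod (weighted_comp t (\<lambda>w. \<Sum>j\<le>N. c j * w ^ j) z)) powr (1 / real m)) powr (2 * real m)"
          unfolding u_def by (rule powr_2m[symmetric]) simp
        also have "\<dots> = cmod (weighted_comp t (\<lambda>w. \<Sum>j\<le>N. c j * w ^ j) z) powr 2"
          using m by (simp add: powr_powr)
        also have "\<dots> = (cmod (weighted_comp t (\<lambda>w. \<Sum>j\<le>N. c j * w ^ j) z))\<^sup>2"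
          by (rule powr_numeral) simp
        finally show ?thesis by (simp add: n)
      qed
      then have "(\<integral>\<^sup>+z. ennreal (u t z ^ Suc n) \<partial>disk) = ennreal (Re (quad_form N (B_mat m a t) c))"
        using nn_integral_weighted_comp_poly[OF t, of c N] by simp
      also have "\<dots> \<le> ennreal ?r"
        unfolding rform_def using B_mat_pos[OF t]
        by (intro ennreal_leI Re_quad_form_le_abs) (auto intro: less_imp_le)
      also have "?r = (?r powr expo) ^ Suc n"
      proof -
        have "?r \<ge> 0" using t by (intro rform_nonneg) auto
        then show ?thesis
          unfolding n[symmetric] using m by (subst powr_2m[symmetric]) (auto simp: powr_powr expo_def)
      qed
      also have "ennreal \<dots> \<le> ennreal (v t ^ Suc n)"
        using \<eta> by (intro ennreal_leI power_mono) (auto simp: v_def)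
      finally show ?thesis .
    qed
    have int: "integrable unit_measure v"
      unfolding v_def
      by (intro Bochner_Integration.integrable_add rform_powr_integrable finite_measure.integrable_const finite_measure_unit) simp
    have "(\<integral>\<^sup>+t. ennreal (v t) \<partial>unit_measure) = ennreal (integral\<^sup>L unit_measure v)"
      by (rule nn_integral_eq_integral[OF int]) (use \<eta> in \<open>auto simp: v_def\<close>)
    also have "integral\<^sup>L unit_measure v = M"
    proof -
      have "integral\<^sup>L unit_measure v = rPhi N (\<lambda>j. cmod (c j)) + (\<integral>t. \<eta> \<partial>unit_measure)"
        unfolding v_def rPhi_def
        by (intro Bochner_Integration.integral_add rform_powr_integrable finite_measure.integrable_const finite_measure_unit) simp
      then show ?thesis
        using unit1 by (simp add: M_def measure_def)
    qed
    finally show "(\<integral>\<^sup>+t. ennreal (v t) \<partial>unit_measure) = ennreal M" .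
    show "M > 0" by (rule Mpos)
    show "(\<integral>\<^sup>+t. ennreal (u t z) \<partial>unit_measure) < \<infinity>" if "z \<in> space disk" for z
    proof -
      have z: "cmod z < 1" using that by simp
      have "(\<integral>\<^sup>+t. ennreal (u t z) \<partial>unit_measure) \<le> (\<integral>\<^sup>+t. ennreal (((\<Sum>j\<le>N. cmod (c j)) / (1 - cmod z) ^ m) powr (1 / real m)) \<partial>unit_measure)"
        using weighted_comp_norm_bound[OF _ _ z]
        by (intro nn_integral_mono ennreal_leI) (auto simp: u_def intro!: powr_mono2)
      also have "\<dots> < \<infinity>"
        using unit1 by simp
      finally show ?thesis .
    qed
  qed
  also have "\<dots> \<le> ennreal ((Beta a (1 - a) * L + \<eta>) ^ (2 * m))"
    unfolding n using M_le Mpos by (intro ennreal_leI power_mono) auto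
  finally show ?thesis
    by (simp add: g_def u_def n)
qed

lemma liminf_power_ge:
  fixes g :: "nat \<Rightarrow> ennreal"
  assumes "r \<ge> 0" "ennreal r \<le> liminf g" "n > 0"
  shows "ennreal (r ^ n) \<le> liminf (\<lambda>N. g N ^ n)"
  unfolding le_Liminf_iff
proof (intro allI impI)
  fix y assume y: "y < ennreal (r ^ n)"
  then obtain y' where y': "y = ennreal y'" "0 \<le> y'" "y' < r ^ n"
    by (cases y) (auto simp: ennreal_less_iff)
  define s where "s = root n y'"
  have s: "s \<ge> 0" "s ^ n = y'" using y' assms(3) by (auto simp: s_def)
  then have "s < r"
    using y'(3) assms(1) by (metis power_less_imp_less_base)
  then have "ennreal s < liminf g"
    using assms(2) s by (meson ennreal_lessI less_le_trans le_less_trans order.strict_trans1)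
  then have "\<forall>\<^sub>F N in sequentially. ennreal s < g N"
    by (rule less_LiminfD)
  then show "\<forall>\<^sub>F N in sequentially. y < g N ^ n"
  proof eventually_elim
    case (elim N)
    show ?case
    proof (cases "g N")
      case (real x)
      then have "s < x" using elim s by (simp add: ennreal_less_iff)
      then have "s ^ n < x ^ n" using s assms(3) by (intro power_strict_mono) auto
      then show ?thesis
        using real s y' by (simp add: ennreal_power ennreal_less_iff)
    next
      case top
      then show ?thesis using assms(3) y' by simp
    qed
  qed
qed

text \<open>Fatou's lemma enters twice: in \<open>t\<close>, where the truncations converge to the
  modulus of the kernel, and in \<open>z\<close>, where it carries the bound of
  \<open>section_inequality\<close> over to the image.\<close>

theorem hilbert_op_bound:
  assumes S: "boyd_supersolutions m a"
    and f: "f \<in> bspace"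
  shows "hilbert_op f \<in> bspace"
    and "bnorm (hilbert_op f)
       \<le> Beta a (1 - a) * bnorm f"
proof -
  let ?L = "bnorm f" and ?B = "Beta a (1 - a)"
  interpret radial_growth f ?L a by (rule radial_growth_bergman[OF f])
  define c where "c n = (deriv ^^ n) (\<lambda>z. f z ^ m) 0 / fact n" for n
  note c = coeff_sum_eq[OF f, folded c_def]
  define g where "g N z = (\<integral>\<^sup>+t. ennreal (cmod (weighted_comp t (\<lambda>w. \<Sum>j\<le>N. c j * w ^ j) z) powr (1 / real m)) \<partial>unit_measure)" for N z
  have L: "?L \<ge> 0" by (rule bergman_norm_nonneg)
  have B: "?B \<ge> 0"
    using a by (intro less_imp_le Beta_real_pos) auto
  have g_le: "(\<integral>\<^sup>+z. g N z ^ (2 * m) \<partial>disk) \<le> ennreal ((?B * ?L + \<eta>) ^ (2 * m))" if "\<eta> > 0" for \<eta> N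
    unfolding g_def using c(2)[of "Suc N"] L that
    by (intro section_inequality[OF S]) (auto simp: lessThan_Suc_atMost)
  have g_meas: "g N \<in> borel_measurable disk" for N
  proof -
    have "sigma_finite_measure unit_measure"
      by (rule finite_measure.axioms(1)[OF finite_measure_unit])
    moreover have "(\<lambda>x. ennreal (cmod (weighted_comp (snd x) (\<lambda>w. \<Sum>j\<le>N. c j * w ^ j) (fst x)) powr (1 / real m))) \<in> borel_measurable (disk \<Otimes>\<^sub>M unit_measure)"
    proof -
      have fst_m: "fst \<in> disk \<Otimes>\<^sub>M unit_measure \<rightarrow>\<^sub>M borel"
        by (rule measurable_compose[OF measurable_fst borel_measurable_dA]) simp
      have snd_m: "snd \<in> disk \<Otimes>\<^sub>M unit_measure \<rightarrow>\<^sub>M borel"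
        by (rule measurable_compose[OF measurable_snd measurable_restrict_space1]) simp
      have "(\<lambda>x. ennreal (cmod (weighted_comp (snd x) (\<lambda>w. \<Sum>j\<le>N. c j * w ^ j) (fst x)) powr (1 / real m))) \<in> borel_measurable (borel \<Otimes>\<^sub>M borel)"
        unfolding weighted_comp_def by measurable
      from measurable_compose[OF measurable_Pair[OF fst_m snd_m] this] show ?thesis by simp
    qed
    ultimately show ?thesis
      unfolding g_def by (intro sigma_finite_measure.borel_measurable_nn_integral) (simp_all add: case_prod_unfold)
  qed
  have pointwise: "ennreal (cmod (hilbert_op f z)) \<le> liminf (\<lambda>N. g N z)" if z: "cmod z < 1" for z
  proof -
    have "ennreal (cmod (hilbert_op f z)) \<le> (\<integral>\<^sup>+t. ennreal (cmod (kernel z t)) \<partial>unit_measure)"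
      unfolding hilbert_op_eq_kernel[OF z]
      using integral_norm_bound_ennreal[OF integrable_kernel[OF z]] by simp
    also have "\<dots> = (\<integral>\<^sup>+t. liminf (\<lambda>N. ennreal (cmod (weighted_comp t (\<lambda>w. \<Sum>j\<le>N. c j * w ^ j) z) powr (1 / real m))) \<partial>unit_measure)"
    proof (intro nn_integral_cong lim_imp_Liminf[symmetric] tendsto_ennrealI)
      fix t assume "t \<in> space unit_measure"
      then have t: "0 \<le> t" "t < 1" by auto
      have "(\<lambda>n. c n * arc z t ^ n) sums (f (arc z t) ^ m)"
        by (rule c(1)[OF arc_in_ball[OF z t]])
      then have "(\<lambda>N. \<Sum>j\<le>N. c j * arc z t ^ j) \<longlonglongrightarrow> f (arc z t) ^ m"
        by (simp add: sums_def_le)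
      then have "(\<lambda>N. cmod (weighted_comp t (\<lambda>w. \<Sum>j\<le>N. c j * w ^ j) z) powr (1 / real m)) \<longlonglongrightarrow>
          cmod (f (arc z t) ^ m / (1 - of_real (1 - t) * z) ^ m) powr (1 / real m)"
        unfolding weighted_comp_def arc_def[symmetric]
        using denom_ge[OF z, of t] t m
        by (intro tendsto_powr2 tendsto_norm tendsto_divide tendsto_const) auto
      also have "cmod (f (arc z t) ^ m / (1 - of_real (1 - t) * z) ^ m) powr (1 / real m) = cmod (kernel z t)"
      proof -
        have "cmod (f (arc z t) ^ m / (1 - of_real (1 - t) * z) ^ m) = cmod (kernel z t) ^ m"
          unfolding kernel_def by (simp add: power_divide flip: norm_power)
        moreover have "(x ^ m) powr (1 / real m) = x" if "x \<ge> 0" for x :: real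
          using m that by (cases "x = 0") (auto simp: powr_realpow[symmetric] powr_powr)
        ultimately show ?thesis by simp
      qed
      finally show "(\<lambda>N. cmod (weighted_comp t (\<lambda>w. \<Sum>j\<le>N. c j * w ^ j) z) powr (1 / real m)) \<longlonglongrightarrow> cmod (kernel z t)" .
    qed simp
    also have "\<dots> \<le> liminf (\<lambda>N. g N z)"
      unfolding g_def weighted_comp_def
      by (intro nn_integral_liminf measurable_restrict_space1) measurable
    finally show ?thesis .
  qed
  have m2: "2 * m > 0" using m by simp
  have main: "(\<integral>\<^sup>+z. ennreal (cmod (hilbert_op f z) ^ (2 * m)) \<partial>disk) \<le> ennreal ((?B * ?L + \<eta>) ^ (2 * m))" if "\<eta> > 0" for \<eta>
  proof -
    have "(\<integral>\<^sup>+z. ennreal (cmod (hilbert_op f z) ^ (2 * m)) \<partial>disk) \<le> (\<integral>\<^sup>+z. liminf (\<lambda>N. g N z ^ (2 * m)) \<partial>disk)"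
      by (intro nn_integral_mono liminf_power_ge pointwise m2) auto
    also have "\<dots> \<le> liminf (\<lambda>N. \<integral>\<^sup>+z. g N z ^ (2 * m) \<partial>disk)"
      using g_meas by (intro nn_integral_liminf borel_measurable_power_ennreal)
    also have "\<dots> \<le> liminf (\<lambda>N::nat. ennreal ((?B * ?L + \<eta>) ^ (2 * m)))"
      using g_le[OF that] by (intro Liminf_mono always_eventually allI)
    also have "\<dots> = ennreal ((?B * ?L + \<eta>) ^ (2 * m))"
      by (rule Liminf_const) simp
    finally show ?thesis .
  qed
  show mem: "hilbert_op f \<in> bspace"
    unfolding bergman_space_iff using main[of 1] holomorphic_hilbert_op
    by (auto intro: le_less_trans)
  let ?H = "bnorm (hilbert_op f)"
  have "?H \<le> ?B * ?L + \<eta>" if "\<eta> > 0" for \<eta>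
  proof (rule power_le_imp_le_base)
    have "ennreal (?H ^ (2 * m)) \<le> ennreal ((?B * ?L + \<eta>) ^ (2 * m))"
      using main[OF that] unfolding nn_integral_bergman_norm[OF mem] .
    then have "?H ^ (2 * m) \<le> (?B * ?L + \<eta>) ^ (2 * m)"
      using B L that by (subst (asm) ennreal_le_iff) auto
    then show "?H ^ Suc (2 * m - 1) \<le> (?B * ?L + \<eta>) ^ Suc (2 * m - 1)"
      using m by simp
  qed (use B L that in auto)
  then show "?H \<le> ?B * ?L"
    by (rule field_le_epsilon)
qed

end

section \<open>The lower bound\<close>

lemma Gamma_add_le_powr:
  fixes x s :: real
  assumes x: "x > 0" and s: "0 \<le> s" "s \<le> 1"
  shows "Gamma (x + s) \<le> x powr s * Gamma x"
proof -
  have G: "Gamma x > 0" "Gamma (x + s) > 0"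
    using x s by (auto intro!: Gamma_real_pos)
  have "(ln \<circ> Gamma) ((1 - s) *\<^sub>R x + s *\<^sub>R (x + 1)) \<le> (1 - s) * (ln \<circ> Gamma) x + s * (ln \<circ> Gamma) (x + 1)"
    using x s by (intro convex_onD[OF log_convex_Gamma_real]) auto
  also have "(1 - s) *\<^sub>R x + s *\<^sub>R (x + 1) = x + s"
    by (simp add: algebra_simps)
  also have "Gamma (x + 1) = x * Gamma x"
    using x by (intro Gamma_plus1) (auto simp: nonpos_Ints_def)
  then have "(1 - s) * (ln \<circ> Gamma) x + s * (ln \<circ> Gamma) (x + 1) = ln (x powr s * Gamma x)"
    using x G by (simp add: ln_mult ln_powr algebra_simps)
  finally show ?thesis
    using x G by (simp add: ln_le_cancel_iff)
qed

text \<open>This compares the n-th Taylor coefficients of \<open>hilbert_op (test_fun b)\<close> and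
  of \<open>test_fun b\<close>. The loss n / (n + 1) does not depend on \<open>b\<close>, which
  later allows one index for all \<open>b\<close>. It comes from applying
  \<open>Gamma_add_le_powr\<close> to both Gamma(n + b) and Gamma(n + 2 - b), whose powers combine
  to n + 1.\<close>

lemma Beta_ge_pochhammer:
  fixes b :: real
  assumes b: "0 < b" "b < 1"
  shows "Beta (real n + 1) (1 - b) \<ge> real n / (real n + 1) * (Beta b (1 - b) * (pochhammer b n / fact n))"
proof (cases "n = 0")
  case True
  have "Beta 1 (1 - b) \<ge> 0"
    using b by (intro less_imp_le Beta_real_pos) auto
  then show ?thesis using True by simp
next
  case False
  then have n: "real n > 0" by simp
  have pos: "Gamma b > 0" "Gamma (1 - b) > 0" "Gamma (real n + b) > 0" "Gamma (real n + 2 - b) > 0"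
    using b n by (auto intro!: Gamma_real_pos)
  have f: "Gamma (real n + 1) = fact n"
    using Gamma_fact[of n, where 'a = real] by (simp add: add_ac)
  have "Gamma (real n + b) \<le> real n powr b * Gamma (real n)"
    using b n by (intro Gamma_add_le_powr) auto
  also have "Gamma (real n) = fact n / real n"
    using Gamma_plus1[of "real n"] n f by (auto simp: field_simps nonpos_Ints_def)
  finally have 1: "Gamma (real n + b) \<le> real n powr b * (fact n / real n)" .
  have "Gamma ((real n + 1) + (1 - b)) \<le> (real n + 1) powr (1 - b) * Gamma (real n + 1)"
    using b n by (intro Gamma_add_le_powr) auto
  then have 2: "Gamma (real n + 2 - b) \<le> (real n + 1) powr (1 - b) * fact n"
    unfolding f by (simp add: algebra_simps)
  have "Gamma (real n + b) * Gamma (real n + 2 - b) \<le> (real n powr b * (fact n / real n)) * ((real n + 1) powr (1 - b) * fact n)"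
    using 1 2 pos n by (intro mult_mono) auto
  also have "\<dots> = real n powr b * (real n + 1) powr (1 - b) * ((fact n)\<^sup>2 / real n)"
    by (simp add: power2_eq_square)
  also have "\<dots> \<le> (real n + 1) powr b * (real n + 1) powr (1 - b) * ((fact n)\<^sup>2 / real n)"
    using b n by (intro mult_right_mono powr_mono2) auto
  also have "(real n + 1) powr b * (real n + 1) powr (1 - b) = real n + 1"
    using n by (simp flip: powr_add)
  finally have main: "real n * (Gamma (real n + b) * Gamma (real n + 2 - b)) \<le> (real n + 1) * (fact n)\<^sup>2"
    using n by (simp add: field_simps)
  have poch: "pochhammer b n = Gamma (real n + b) / Gamma b"
    using b by (subst pochhammer_Gamma) (auto simp: nonpos_Ints_def add.commute)
  have "Beta b (1 - b) = Gamma b * Gamma (1 - b)"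
    by (simp add: Beta_def)
  then have "real n / (real n + 1) * (Beta b (1 - b) * (pochhammer b n / fact n))
    = real n / (real n + 1) * (Gamma (1 - b) * Gamma (real n + b) / fact n)"
    using pos by (simp add: poch)
  also have "\<dots> \<le> fact n * Gamma (1 - b) / Gamma (real n + 2 - b)"
  proof -
    have "x / (x + 1) * (G * A / F) \<le> F * G / B"
      if "x * (A * B) \<le> (x + 1) * F\<^sup>2" "x > 0" "A > 0" "B > 0" "F > 0" "G > 0" for x A B F G :: real
    proof -
      have "x / (x + 1) * (G * A / F) * B = (x * (A * B)) * (G / ((x + 1) * F))"
        by simp
      also have "\<dots> \<le> ((x + 1) * F\<^sup>2) * (G / ((x + 1) * F))"
        using that by (intro mult_right_mono) auto
      also have "\<dots> = F * G"
        using that by (simp add: power2_eq_square)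
      finally show ?thesis
        using that by (simp add: pos_le_divide_eq)
    qed
    from this[OF main n pos(3,4) _ pos(2)] show ?thesis by simp
  qed
  also have "\<dots> = Beta (real n + 1) (1 - b)"
    unfolding Beta_def f by (simp add: algebra_simps)
  finally show ?thesis .
qed

section \<open>Powers of series with nonnegative coefficients\<close>

lemma fps_power_of_real:
  "fps_nth (Abs_fps (\<lambda>n. complex_of_real (b n)) ^ m) n = of_real (fps_nth (Abs_fps b ^ m) n)"
  by (induction m arbitrary: n) (auto simp: fps_mult_nth)

lemma fps_power_mono:
  fixes b c :: "nat \<Rightarrow> real"
  assumes "\<And>n. 0 \<le> b n" "\<And>n. b n \<le> c n"
  shows "0 \<le> fps_nth (Abs_fps b ^ m) n \<and> fps_nth (Abs_fps b ^ m) n \<le> fps_nth (Abs_fps c ^ m) n"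
proof (induction m arbitrary: n)
  case (Suc m)
  then show ?case
    using assms by (auto simp: fps_mult_nth intro!: sum_nonneg mult_nonneg_nonneg sum_mono mult_mono intro: order_trans)
qed auto

lemma sums_fps_power:
  fixes c :: "nat \<Rightarrow> complex"
  assumes "\<And>z. cmod z < 1 \<Longrightarrow> (\<lambda>n. c n * z ^ n) sums F z" and z: "cmod z < 1"
  shows "(\<lambda>n. fps_nth (Abs_fps c ^ m) n * z ^ n) sums (F z ^ m)"
proof -
  have r: "fps_conv_radius (Abs_fps c) \<ge> 1"
    unfolding fps_conv_radius_def
  proof (rule conv_radius_geI_ex)
    fix r :: real assume r: "0 < r" "ereal r < 1"
    then show "\<exists>z. norm z = r \<and> summable (\<lambda>n. fps_nth (Abs_fps c) n * z ^ n)"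
      using assms(1)[of "of_real r"] by (intro exI[of _ "of_real r"]) (auto simp: sums_iff)
  qed
  have zr: "ereal (norm z) < fps_conv_radius (Abs_fps c)"
    using r z by (metis ereal_less(3) less_le_trans)
  then have zm: "ereal (norm z) < fps_conv_radius (Abs_fps c ^ m)"
    using fps_conv_radius_power[of "Abs_fps c" m] by (rule less_le_trans)
  have "eval_fps (Abs_fps c) z = F z"
    using assms(1)[OF z] by (simp add: eval_fps_def sums_iff)
  then have "eval_fps (Abs_fps c ^ m) z = F z ^ m"
    using eval_fps_power[OF zr] by simp
  then show ?thesis
    using sums_eval_fps[OF zm] by simp
qed

text \<open>The sum is the convex combination (1 - e) (x / (1 - e)) + e (y / e), hence at most the
  larger of the two quotients. The main term keeps a factor close to 1, and the large factor falls
  on the bounded term.\<close>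

lemma power_add_le:
  fixes x y e :: real
  assumes "x \<ge> 0" "y \<ge> 0" "0 < e" "e < 1"
  shows "(x + y) ^ n \<le> (x / (1 - e)) ^ n + (y / e) ^ n"
proof (cases "x + y \<le> x / (1 - e)")
  case True
  then have "(x + y) ^ n \<le> (x / (1 - e)) ^ n"
    using assms by (intro power_mono) auto
  moreover have "0 \<le> (y / e) ^ n" using assms by simp
  ultimately show ?thesis by linarith
next
  case False
  then have "x + y \<le> y / e"
    using assms by (simp add: field_simps)
  then have "(x + y) ^ n \<le> (y / e) ^ n"
    using assms by (intro power_mono) auto
  moreover have "0 \<le> (x / (1 - e)) ^ n" using assms by simp
  ultimately show ?thesis by linarith
qed

context hilbert_bergman
begin

text \<open>Cauchy products preserve inequalities between nonnegative sequences, so domination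
  passes to the coefficients of the m-th powers and through Parseval's identity to the
  norms.\<close>

lemma nn_integral_power_mono_coeff:
  fixes b c :: "nat \<Rightarrow> real"
  assumes b: "\<And>n. 0 \<le> b n" "\<And>n. b n \<le> c n"
    and F: "\<And>z. cmod z < 1 \<Longrightarrow> (\<lambda>n. of_real (b n) * z ^ n) sums F z"
    and G: "\<And>z. cmod z < 1 \<Longrightarrow> (\<lambda>n. of_real (c n) * z ^ n) sums G z"
  shows "(\<integral>\<^sup>+z. ennreal (cmod (F z) ^ (2 * m)) \<partial>disk) \<le> (\<integral>\<^sup>+z. ennreal (cmod (G z) ^ (2 * m)) \<partial>disk)"
proof -
  have eq: "(\<integral>\<^sup>+z. ennreal (cmod (H z) ^ (2 * m)) \<partial>disk)
      = (\<Sum>n. ennreal (D_entry m a n * (fps_nth (Abs_fps d ^ m) n)\<^sup>2))"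
    if H: "\<And>z. cmod z < 1 \<Longrightarrow> (\<lambda>n. of_real (d n) * z ^ n) sums H z" for d H
  proof -
    have "(\<integral>\<^sup>+z. ennreal (cmod (H z) ^ (2 * m)) \<partial>disk) = (\<integral>\<^sup>+z. ennreal ((cmod (H z ^ m))\<^sup>2) \<partial>disk)"
      by (simp add: norm_power power_mult[symmetric] mult.commute)
    also have "\<dots> = (\<Sum>n. ennreal (D_entry m a n * (cmod (fps_nth (Abs_fps (\<lambda>n. complex_of_real (d n)) ^ m) n))\<^sup>2))"
      by (subst nn_integral_dA_power_series[OF weight_gt sums_fps_power[OF H]]) (simp_all add: D_entry_def)
    finally show ?thesis
      by (simp add: fps_power_of_real)
  qed
  have "(\<Sum>n. ennreal (D_entry m a n * (fps_nth (Abs_fps b ^ m) n)\<^sup>2))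
    \<le> (\<Sum>n. ennreal (D_entry m a n * (fps_nth (Abs_fps c ^ m) n)\<^sup>2))"
  proof (intro suminf_le ennreal_leI mult_left_mono power_mono)
    show "fps_nth (Abs_fps b ^ m) n \<le> fps_nth (Abs_fps c ^ m) n" "0 \<le> fps_nth (Abs_fps b ^ m) n" for n
      using fps_power_mono[of b c m n] b by auto
  qed (auto intro: less_imp_le[OF D_entry_pos])
  moreover have "(\<integral>\<^sup>+z. ennreal (cmod (F z) ^ (2 * m)) \<partial>disk) = (\<Sum>n. ennreal (D_entry m a n * (fps_nth (Abs_fps b ^ m) n)\<^sup>2))"
    by (rule eq) (rule F)
  moreover have "(\<integral>\<^sup>+z. ennreal (cmod (G z) ^ (2 * m)) \<partial>disk) = (\<Sum>n. ennreal (D_entry m a n * (fps_nth (Abs_fps c ^ m) n)\<^sup>2))"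
    by (rule eq) (rule G)
  ultimately show ?thesis by simp
qed

section \<open>The test functions and their images\<close>

definition test_fun :: "real \<Rightarrow> complex \<Rightarrow> complex" where
  "test_fun b z = (1 - z) powr (- of_real b)"

lemma test_fun_sums:
  "cmod z < 1 \<Longrightarrow> (\<lambda>n. of_real (pochhammer b n / fact n) * z ^ n) sums test_fun b z"
  unfolding test_fun_def by (rule negative_binomial_complex)

lemma test_fun_power: "cmod z < 1 \<Longrightarrow> test_fun b z ^ m = test_fun (real m * b) z"
proof -
  assume "cmod z < 1"
  then have "1 - z \<noteq> 0" by auto
  then show ?thesis
    by (simp add: test_fun_def powr_def exp_of_nat_mult[symmetric] mult_ac)
qed

lemma test_fun_holomorphic: "test_fun b holomorphic_on ball 0 1"
  by (rule power_series_holomorphic[where a = "\<lambda>n. of_real (pochhammer b n / fact n)"])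
     (use test_fun_sums in auto)

text \<open>The n-th Parseval term of the m-th power of \<open>test_fun b\<close>. Its order is n
  powr (2 m (b - a) - 1), summable exactly for b < a.\<close>

definition test_term :: "real \<Rightarrow> nat \<Rightarrow> real" where
  "test_term b n = D_entry m a n * (pochhammer (real m * b) n / fact n)\<^sup>2"

lemma test_term_nonneg: "test_term b n \<ge> 0"
  unfolding test_term_def by (intro mult_nonneg_nonneg less_imp_le[OF D_entry_pos]) auto

lemma nn_integral_test_fun:
  "(\<integral>\<^sup>+z. ennreal (cmod (test_fun b z) ^ (2 * m)) \<partial>disk) = (\<Sum>n. ennreal (test_term b n))"
proof -
  have "(\<integral>\<^sup>+z. ennreal (cmod (test_fun b z) ^ (2 * m)) \<partial>disk) = (\<integral>\<^sup>+z. ennreal ((cmod (test_fun (real m * b) z))\<^sup>2) \<partial>disk)"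
  proof (rule nn_integral_cong)
    fix z assume "z \<in> space disk"
    then have "test_fun (real m * b) z = test_fun b z ^ m" by (simp add: test_fun_power)
    then show "ennreal (cmod (test_fun b z) ^ (2 * m)) = ennreal ((cmod (test_fun (real m * b) z))\<^sup>2)"
      by (simp add: norm_power mult.commute flip: power_mult)
  qed
  also have "\<dots> = (\<Sum>n. ennreal (D_entry m a n * (cmod (of_real (pochhammer (real m * b) n / fact n)))\<^sup>2))"
    by (subst nn_integral_dA_power_series[OF weight_gt test_fun_sums]) (simp_all add: D_entry_def)
  finally show ?thesis
    unfolding test_term_def norm_of_real power2_abs .
qed

lemma summable_test_term:
  assumes b: "0 < b" "b < a"
  shows "summable (test_term b)"
proof -
  have mb: "real m * b > 0" using b m by simp
  obtain C where C: "C > 0" "\<And>n. n > 0 \<Longrightarrow> pochhammer (real m * b) n * pochhammer (real m * b) n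
    \<le> C * (pochhammer 1 n * pochhammer (2 * real m * a) n * real n powr (real m * b + real m * b - 1 - 2 * real m * a))"
    using pochhammer_ratio_bound[OF mb mb zero_less_one gam_pos] by blast
  have "summable (\<lambda>n. real n powr (real m * b + real m * b - 1 - 2 * real m * a))"
  proof -
    have "real m * b < real m * a" using b m by simp
    then have "real m * b + real m * b - 1 - 2 * real m * a < -1" by linarith
    then show ?thesis by (simp only: summable_real_powr_iff)
  qed
  then have "summable (\<lambda>n. C * real n powr (real m * b + real m * b - 1 - 2 * real m * a))"
    by (rule summable_mult)
  then show ?thesis
  proof (rule summable_comparison_test_ev[rotated])
    show "\<forall>\<^sub>F n in sequentially. norm (test_term b n) \<le> C * real n powr (real m * b + real m * b - 1 - 2 * real m * a)"
      using eventually_gt_at_top[of 0]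
    proof eventually_elim
      case (elim n)
      have p: "pochhammer (2 * real m * a) n > 0" using gam_pos by (rule pochhammer_pos)
      have "test_term b n = pochhammer (real m * b) n * pochhammer (real m * b) n / (pochhammer 1 n * pochhammer (2 * real m * a) n)"
        by (simp add: test_term_def D_entry_def power2_eq_square pochhammer_fact[symmetric])
      also have "\<dots> \<le> C * real n powr (real m * b + real m * b - 1 - 2 * real m * a)"
        using C(2)[OF elim] p by (simp add: pochhammer_fact[symmetric] field_simps)
      finally show ?case using test_term_nonneg[of b n] by simp
    qed
  qed
qed

lemma not_summable_test_term: "\<not> summable (test_term a)"
proof
  assume summ: "summable (test_term a)"
  let ?x = "real m * a"
  have x: "?x > 0" using m a by simp
  then have x1: "?x + 1 > 0" by simp
  \<comment> \<open>Taking \<open>?x + 1\<close> instead of a second \<open>?x\<close> makes the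
    exponent 0; the price is the factor (?x + n) / ?x, which produces the harmonic series.\<close>
  obtain C where C: "C > 0" "\<And>n. n > 0 \<Longrightarrow> pochhammer 1 n * pochhammer (2 * real m * a) n
    \<le> C * (pochhammer ?x n * pochhammer (?x + 1) n * real n powr (1 + 2 * real m * a - ?x - (?x + 1)))"
    using pochhammer_ratio_bound[OF zero_less_one gam_pos x x1] by blast
  have "summable (\<lambda>n. inverse (real n))"
  proof (rule summable_comparison_test_ev[rotated])
    show "summable (\<lambda>n. (C * (?x + 1) / ?x) * test_term a n)"
      by (rule summable_mult[OF summ])
    show "\<forall>\<^sub>F n in sequentially. norm (inverse (real n)) \<le> (C * (?x + 1) / ?x) * test_term a n"
      using eventually_gt_at_top[of 0]
    proof eventually_elim
      case (elim n)
      have p: "pochhammer (2 * real m * a) n > 0" "pochhammer ?x n > 0"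
        using gam_pos x by (auto intro: pochhammer_pos)
      have rec: "?x * pochhammer (?x + 1) n = pochhammer ?x n * (?x + real n)"
        using pochhammer_rec[of ?x n] pochhammer_Suc[of ?x n] by simp
      have "fact n * pochhammer (2 * real m * a) n \<le> C * (pochhammer ?x n * pochhammer (?x + 1) n)"
        using C(2)[OF elim] elim by (simp add: pochhammer_fact[symmetric])
      then have "?x * (fact n * pochhammer (2 * real m * a) n) \<le> ?x * (C * (pochhammer ?x n * pochhammer (?x + 1) n))"
        using x by (intro mult_left_mono) auto
      also have "\<dots> = C * pochhammer ?x n * (?x * pochhammer (?x + 1) n)"
        by simp
      also have "\<dots> = C * (pochhammer ?x n)\<^sup>2 * (?x + real n)"
        unfolding rec by (simp add: power2_eq_square)
      also have "\<dots> \<le> C * (pochhammer ?x n)\<^sup>2 * ((?x + 1) * real n)"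
      proof (rule mult_left_mono)
        have "?x * 1 \<le> ?x * real n" using x elim by (intro mult_left_mono) auto
        then show "?x + real n \<le> (?x + 1) * real n" by (simp add: algebra_simps)
      qed (use C in simp)
      finally have "?x * (fact n * pochhammer (2 * real m * a) n) \<le> C * (pochhammer ?x n)\<^sup>2 * ((?x + 1) * real n)" .
      then have "1 \<le> C * (pochhammer ?x n)\<^sup>2 * ((?x + 1) * real n) / (?x * (fact n * pochhammer (2 * real m * a) n))"
        using x p by (subst le_divide_eq_1_pos) auto
      also have "\<dots> = (C * (?x + 1) / ?x) * ((pochhammer ?x n)\<^sup>2 / (fact n * pochhammer (2 * real m * a) n)) * real n"
        by (simp only: times_divide_times_eq times_divide_eq_left times_divide_eq_right divide_divide_eq_left mult_ac)
      also have "(pochhammer ?x n)\<^sup>2 / (fact n * pochhammer (2 * real m * a) n) = test_term a n"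
        by (simp add: test_term_def D_entry_def power2_eq_square)
      finally show ?case using elim by (simp add: field_simps)
    qed
  qed
  then show False using not_summable_harmonic[where 'a = real] by simp
qed

lemma test_fun_in_bergman_space:
  assumes "0 < b" "b < a"
  shows "test_fun b \<in> bspace"
  unfolding bergman_space_iff nn_integral_test_fun
  using test_fun_holomorphic summable_test_term[OF assms] test_term_nonneg
  by (simp add: suminf_ennreal_eq[OF test_term_nonneg summable_sums])

lemma hilbert_op_test_fun_sums:
  assumes b: "0 < b" "b < a" and z: "cmod z < 1"
  shows "(\<lambda>n. of_real (Beta (real n + 1) (1 - b)) * z ^ n) sums hilbert_op (test_fun b) z"
proof -
  interpret radial_growth "test_fun b" "bnorm (test_fun b)" a
    by (rule radial_growth_bergman[OF test_fun_in_bergman_space[OF b]])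
  have "(\<integral>t. test_fun b (of_real t) * of_real t ^ n \<partial>unit_measure) = of_real (Beta (real n + 1) (1 - b))" for n
  proof -
    have "(\<integral>t. test_fun b (of_real t) * of_real t ^ n \<partial>unit_measure)
      = (\<integral>t. complex_of_real (t powr (real n + 1 - 1) * (1 - t) powr (1 - b - 1)) \<partial>unit_measure)"
    proof (rule Bochner_Integration.integral_cong)
      fix t assume "t \<in> space unit_measure"
      then have t: "0 < t" "t < 1" by auto
      have "test_fun b (of_real t) = of_real ((1 - t) powr (- b))"
        unfolding test_fun_def using t powr_of_real[of "1 - t" "- b"] by simp
      then show "test_fun b (of_real t) * of_real t ^ n = complex_of_real (t powr (real n + 1 - 1) * (1 - t) powr (1 - b - 1))"
        using t by (simp add: powr_realpow mult.commute)
    qed simp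
    also have "\<dots> = of_real (\<integral>t. t powr (real n + 1 - 1) * (1 - t) powr (1 - b - 1) \<partial>unit_measure)"
      by (rule integral_complex_of_real)
    also have "(\<integral>t. t powr (real n + 1 - 1) * (1 - t) powr (1 - b - 1) \<partial>unit_measure) = Beta (real n + 1) (1 - b)"
      using b a by (intro has_bochner_integral_integral_eq has_bochner_integral_Beta) auto
    finally show ?thesis .
  qed
  then show ?thesis using hilbert_op_sums[OF z] by simp
qed

text \<open>
  The Taylor coefficients of \<open>hilbert_op (test_fun b)\<close> exceed \<open>(1 - e) * Beta b (1 - b)\<close> times those
  of \<open>test_fun b\<close> from an index \<open>n0\<close> on that does not depend on \<open>b\<close>. Adding a polynomial of degree
  less than \<open>n0\<close> extends this to all coefficients, hence to the coefficients of the \<open>m\<close>-th powers,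
  which determine the norm.
\<close>

lemma test_fun_lower_bound:
  assumes C: "C \<ge> 0" "\<And>f. f \<in> bspace \<Longrightarrow>
      hilbert_op f \<in> bspace \<and>
      bnorm (hilbert_op f) \<le> C * bnorm f"
    and b: "0 < b" "b < a" and e: "0 < e" "e < 1" and n0: "\<And>n. n \<ge> n0 \<Longrightarrow> real n / (real n + 1) \<ge> 1 - e"
  defines "\<kappa> \<equiv> (1 - e) * Beta b (1 - b)"
  shows "\<kappa> ^ (2 * m) * (\<Sum>n. test_term b n) \<le> (C / (1 - e)) ^ (2 * m) * (\<Sum>n. test_term b n) + (\<kappa> * real n0 / e) ^ (2 * m)"
proof -
  let ?f = "test_fun b" and ?H = "hilbert_op (test_fun b)"
  define X where "X = (\<Sum>n. test_term b n)"
  have f: "?f \<in> bspace"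
    by (rule test_fun_in_bergman_space[OF b])
  have X0: "X \<ge> 0"
    unfolding X_def by (intro suminf_nonneg summable_test_term b test_term_nonneg)
  have int_f: "(\<integral>\<^sup>+z. ennreal (cmod (?f z) ^ (2 * m)) \<partial>disk) = ennreal X"
    unfolding nn_integral_test_fun X_def
    by (rule suminf_ennreal_eq[OF test_term_nonneg summable_sums[OF summable_test_term[OF b]]])
  then have nf: "bnorm ?f ^ (2 * m) = X"
    using nn_integral_bergman_norm[OF f] X0 bergman_norm_nonneg by simp
  have int_H: "(\<integral>\<^sup>+z. ennreal (cmod (?H z) ^ (2 * m)) \<partial>disk) \<le> ennreal (C ^ (2 * m) * X)"
  proof -
    have "(\<integral>\<^sup>+z. ennreal (cmod (?H z) ^ (2 * m)) \<partial>disk) = ennreal (bnorm ?H ^ (2 * m))"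
      using C(2)[OF f] by (intro nn_integral_bergman_norm) auto
    also have "\<dots> \<le> ennreal ((C * bnorm ?f) ^ (2 * m))"
      using C(2)[OF f] bergman_norm_nonneg by (intro ennreal_leI power_mono) auto
    finally show ?thesis by (simp add: power_mult_distrib nf)
  qed
  have b1: "b < 1" using b a by simp
  have \<kappa>: "\<kappa> \<ge> 0" using e Beta_real_pos[of b "1 - b"] b b1 by (simp add: \<kappa>_def)
  define p where "p n = pochhammer b n / fact n" for n
  \<comment> \<open>For b < 1 the coefficients are at most 1, so the correcting polynomial
    \<open>Q\<close> is bounded on the disk by \<kappa> times its number of terms.\<close>
  have p: "0 \<le> p n" "p n \<le> 1" for n
  proof -
    show "0 \<le> p n" unfolding p_def using b by (intro divide_nonneg_nonneg pochhammer_nonneg) auto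
    have "pochhammer b n \<le> fact n"
    proof (induction n)
      case (Suc n)
      have "pochhammer b n * (b + real n) \<le> fact n * (1 + real n)"
        using Suc b b1 by (intro mult_mono) auto
      then show ?case by (simp add: pochhammer_Suc algebra_simps)
    qed simp
    then show "p n \<le> 1" by (simp add: p_def)
  qed
  define Q where "Q z = (\<Sum>n<n0. of_real (\<kappa> * p n) * z ^ n)" for z :: complex
  define d where "d n = Beta (real n + 1) (1 - b) + (if n < n0 then \<kappa> * p n else 0)" for n
  have sum_kf: "(\<lambda>n. of_real (\<kappa> * p n) * z ^ n) sums (of_real \<kappa> * ?f z)" if "cmod z < 1" for z
    using sums_mult[OF test_fun_sums[OF that, of b], of "of_real \<kappa>"] by (simp add: p_def mult.assoc)
  have sum_HQ: "(\<lambda>n. of_real (d n) * z ^ n) sums (?H z + Q z)" if "cmod z < 1" for z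
  proof -
    have "(\<lambda>n. if n \<in> {..<n0} then of_real (\<kappa> * p n) * z ^ n else 0) sums Q z"
      unfolding Q_def by (rule sums_If_finite_set) simp
    from sums_add[OF hilbert_op_test_fun_sums[OF b that] this] show ?thesis
      by (rule sums_cong[THEN iffD1, rotated]) (simp add: d_def algebra_simps)
  qed
  have Bn: "Beta (real n + 1) (1 - b) \<ge> real n / (real n + 1) * (Beta b (1 - b) * p n)" for n
    using Beta_ge_pochhammer[OF b(1) b1] by (simp add: p_def)
  have coeff: "\<kappa> * p n \<le> d n" for n
  proof (cases "n < n0")
    case True
    have "0 \<le> real n / (real n + 1) * (Beta b (1 - b) * p n)"
      using Beta_real_pos[of b "1 - b"] b b1 p by simp
    then show ?thesis using True Bn[of n] by (simp add: d_def)
  next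
    case False
    have "(1 - e) * (Beta b (1 - b) * p n) \<le> real n / (real n + 1) * (Beta b (1 - b) * p n)"
      using n0[of n] False Beta_real_pos[of b "1 - b"] b b1 p by (intro mult_right_mono) auto
    then show ?thesis using False Bn[of n] by (simp add: d_def \<kappa>_def)
  qed
  have Q_le: "cmod (Q z) \<le> \<kappa> * real n0" if "cmod z < 1" for z
  proof -
    have "cmod (Q z) \<le> (\<Sum>n<n0. \<kappa> * 1)"
      unfolding Q_def
    proof (rule sum_norm_le)
      fix n
      have "cmod (of_real (\<kappa> * p n) * z ^ n) = \<kappa> * (p n * cmod z ^ n)"
        using \<kappa> p by (simp add: norm_mult norm_power)
      also have "\<dots> \<le> \<kappa> * (1 * 1)"
        using \<kappa> p that by (intro mult_left_mono mult_mono power_le_one) auto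
      finally show "cmod (of_real (\<kappa> * p n) * z ^ n) \<le> \<kappa> * 1" by simp
    qed
    then show ?thesis by (simp add: mult.commute)
  qed
  have "ennreal (\<kappa> ^ (2 * m) * X) = (\<integral>\<^sup>+z. ennreal (cmod (of_real \<kappa> * ?f z) ^ (2 * m)) \<partial>disk)"
  proof -
    have "(\<integral>\<^sup>+z. ennreal (cmod (of_real \<kappa> * ?f z) ^ (2 * m)) \<partial>disk) = (\<integral>\<^sup>+z. ennreal (\<kappa> ^ (2 * m)) * ennreal (cmod (?f z) ^ (2 * m)) \<partial>disk)"
      using \<kappa> by (intro nn_integral_cong) (simp add: norm_mult power_mult_distrib ennreal_mult)
    also have "\<dots> = ennreal (\<kappa> ^ (2 * m)) * ennreal X"
      using holomorphic_measurable[OF test_fun_holomorphic[of b], of "2 * real m * a - 2"]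
      by (subst nn_integral_cmult) (auto simp: int_f)
    finally show ?thesis using \<kappa> X0 by (simp add: ennreal_mult)
  qed
  also have "\<dots> \<le> (\<integral>\<^sup>+z. ennreal (cmod (?H z + Q z) ^ (2 * m)) \<partial>disk)"
    using \<kappa> p coeff by (intro nn_integral_power_mono_coeff[OF _ _ sum_kf sum_HQ]) auto
  also have "\<dots> \<le> (\<integral>\<^sup>+z. ennreal ((1 / (1 - e)) ^ (2 * m)) * ennreal (cmod (?H z) ^ (2 * m)) + ennreal ((\<kappa> * real n0 / e) ^ (2 * m)) \<partial>disk)"
  proof (rule nn_integral_mono)
    fix z assume "z \<in> space disk"
    then have z: "cmod z < 1" by simp
    have "cmod (?H z + Q z) ^ (2 * m) \<le> (cmod (?H z) + \<kappa> * real n0) ^ (2 * m)"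
      using Q_le[OF z] norm_triangle_ineq[of "?H z" "Q z"] by (intro power_mono) auto
    also have "\<dots> \<le> (cmod (?H z) / (1 - e)) ^ (2 * m) + (\<kappa> * real n0 / e) ^ (2 * m)"
      using e \<kappa> by (intro power_add_le) auto
    also have "(cmod (?H z) / (1 - e)) ^ (2 * m) = (1 / (1 - e)) ^ (2 * m) * cmod (?H z) ^ (2 * m)"
      by (simp add: power_divide)
    finally show "ennreal (cmod (?H z + Q z) ^ (2 * m)) \<le> ennreal ((1 / (1 - e)) ^ (2 * m)) * ennreal (cmod (?H z) ^ (2 * m)) + ennreal ((\<kappa> * real n0 / e) ^ (2 * m))"
      using e \<kappa> by (subst ennreal_mult[symmetric], simp, simp, subst ennreal_plus[symmetric], simp, simp, intro ennreal_leI)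
  qed
  also have "\<dots> = ennreal ((1 / (1 - e)) ^ (2 * m)) * (\<integral>\<^sup>+z. ennreal (cmod (?H z) ^ (2 * m)) \<partial>disk) + ennreal ((\<kappa> * real n0 / e) ^ (2 * m))"
  proof -
    have "?H holomorphic_on ball 0 1" using C(2)[OF f] by (simp add: bergman_space_def)
    from holomorphic_measurable[OF this, of "2 * real m * a - 2"] show ?thesis
      by (subst nn_integral_add) (auto simp: nn_integral_cmult emeasure_disk)
  qed
  also have "\<dots> \<le> ennreal ((1 / (1 - e)) ^ (2 * m)) * ennreal (C ^ (2 * m) * X) + ennreal ((\<kappa> * real n0 / e) ^ (2 * m))"
    by (intro add_right_mono mult_left_mono int_H) simp
  also have "\<dots> = ennreal ((C / (1 - e)) ^ (2 * m) * X + (\<kappa> * real n0 / e) ^ (2 * m))"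
    using e \<kappa> C(1) X0 by (simp add: ennreal_mult[symmetric] ennreal_plus[symmetric] power_divide del: ennreal_plus)
  finally show ?thesis
    unfolding X_def[symmetric] using e \<kappa> C(1) X0 by (subst (asm) ennreal_le_iff) auto
qed

text \<open>As b increases to \<open>a\<close>, the norm sum X tends to infinity while the error
  term of \<open>test_fun_lower_bound\<close> stays bounded. Dividing by X removes it, and letting e
  tend to 0 removes the factors 1 - e.\<close>

theorem hilbert_op_norm_ge:
  assumes C: "C \<ge> 0" "\<And>f. f \<in> bspace \<Longrightarrow>
      hilbert_op f \<in> bspace \<and>
      bnorm (hilbert_op f) \<le> C * bnorm f"
  shows "Beta a (1 - a) \<le> C"
proof -
  define b where "b k = a - a / real (k + 2)" for k
  have b: "0 < b k" "b k < a" for k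
  proof -
    have "a * 1 < a * real (k + 2)"
      using a by (intro mult_strict_left_mono) auto
    then have "a / real (k + 2) < a"
      by (subst pos_divide_less_eq) auto
    moreover have "a / real (k + 2) > 0"
      using a by simp
    ultimately show "0 < b k" "b k < a" by (auto simp: b_def)
  qed
  have b_lim: "b \<longlonglongrightarrow> a"
  proof -
    have "(\<lambda>k. 1 / real (k + 2)) \<longlonglongrightarrow> 0"
      using LIMSEQ_ignore_initial_segment[OF lim_1_over_n, of 2] by simp
    from tendsto_diff[OF tendsto_const[of a] tendsto_mult[OF tendsto_const[of a] this]]
    show ?thesis by (simp add: b_def[abs_def])
  qed
  define X where "X k = (\<Sum>n. test_term (b k) n)" for k
  \<comment> \<open>A fixed partial sum is continuous in \<open>b\<close>, and at b = a the partial
    sums are unbounded. Nonnegativity of the remaining terms does the rest.\<close>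
  have X_lim: "filterlim X at_top sequentially"
    unfolding filterlim_at_top
  proof
    fix R
    have "\<exists>K. (\<Sum>n<K. test_term a n) > R"
      using not_summable_test_term summableI_nonneg_bounded[of "test_term a" R] test_term_nonneg
      by (meson not_le)
    then obtain K where K: "(\<Sum>n<K. test_term a n) > R" by blast
    have "(\<lambda>k. \<Sum>n<K. test_term (b k) n) \<longlonglongrightarrow> (\<Sum>n<K. test_term a n)"
      unfolding test_term_def pochhammer_prod by (intro tendsto_intros b_lim) auto
    from order_tendstoD(1)[OF this K]
    show "\<forall>\<^sub>F k in sequentially. R \<le> X k"
    proof eventually_elim
      case (elim k)
      have "(\<Sum>n<K. test_term (b k) n) \<le> X k"
        unfolding X_def by (intro sum_le_suminf summable_test_term b) (auto simp: test_term_nonneg)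
      then show ?case using elim by simp
    qed
  qed
  have Beta_lim: "(\<lambda>k. Beta (b k) (1 - b k)) \<longlonglongrightarrow> Beta a (1 - a)"
  proof -
    have "a \<notin> \<int>\<^sub>\<le>\<^sub>0" "1 - a \<notin> \<int>\<^sub>\<le>\<^sub>0" using a by (auto dest: nonpos_Ints_nonpos)
    then have "(\<lambda>k. Gamma (b k) * Gamma (1 - b k)) \<longlonglongrightarrow> Gamma a * Gamma (1 - a)"
      by (intro tendsto_intros b_lim) auto
    then show ?thesis by (simp add: Beta_def)
  qed
  have main: "(1 - e) * Beta a (1 - a) \<le> C / (1 - e)" if e: "0 < e" "e < 1" for e
  proof -
    obtain n0 :: nat where n0: "real n0 \<ge> 1 / e" using real_arch_simple by blast
    have n0': "real n / (real n + 1) \<ge> 1 - e" if "n \<ge> n0" for n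
    proof -
      have "1 / e \<le> real n" using n0 that by linarith
      then have "1 \<le> e * (real n + 1)" using e by (simp add: field_simps)
      then show ?thesis by (simp add: field_simps)
    qed
    let ?k = "\<lambda>k. (1 - e) * Beta (b k) (1 - b k)"
    have "\<forall>\<^sub>F k in sequentially. ?k k ^ (2 * m) \<le> (C / (1 - e)) ^ (2 * m) + (?k k * real n0 / e) ^ (2 * m) / X k"
      using filterlim_at_top_dense[THEN iffD1, OF X_lim, rule_format, of 0]
    proof eventually_elim
      case (elim k)
      have "?k k ^ (2 * m) * X k \<le> (C / (1 - e)) ^ (2 * m) * X k + (?k k * real n0 / e) ^ (2 * m)"
        unfolding X_def by (rule test_fun_lower_bound[OF C b[of k] e n0'])
      then have "?k k ^ (2 * m) \<le> ((C / (1 - e)) ^ (2 * m) * X k + (?k k * real n0 / e) ^ (2 * m)) / X k"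
        using elim by (subst pos_le_divide_eq) auto
      then show ?case
        using elim by (simp only: add_divide_distrib) simp
    qed
    moreover have "(\<lambda>k. ?k k ^ (2 * m)) \<longlonglongrightarrow> ((1 - e) * Beta a (1 - a)) ^ (2 * m)"
      by (intro tendsto_intros Beta_lim)
    moreover have "(\<lambda>k. (C / (1 - e)) ^ (2 * m) + (?k k * real n0 / e) ^ (2 * m) / X k) \<longlonglongrightarrow> (C / (1 - e)) ^ (2 * m) + 0"
    proof (intro tendsto_add tendsto_const real_tendsto_divide_at_top[OF _ X_lim])
      show "(\<lambda>k. (?k k * real n0 / e) ^ (2 * m)) \<longlonglongrightarrow> ((1 - e) * Beta a (1 - a) * real n0 / e) ^ (2 * m)"
        using e by (intro tendsto_power tendsto_divide tendsto_mult tendsto_const Beta_lim) auto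
    qed
    ultimately have "((1 - e) * Beta a (1 - a)) ^ (2 * m) \<le> (C / (1 - e)) ^ (2 * m) + 0"
      by (intro tendsto_le[OF sequentially_bot])
    then have "((1 - e) * Beta a (1 - a)) ^ Suc (2 * m - 1) \<le> (C / (1 - e)) ^ Suc (2 * m - 1)"
      using m by simp
    then show ?thesis
      by (rule power_le_imp_le_base) (use C e in simp)
  qed
  have lim1: "((\<lambda>e. (1 - e) * Beta a (1 - a)) \<longlongrightarrow> (1 - 0) * Beta a (1 - a)) (at_right 0)"
    by (intro tendsto_intros)
  have lim2: "((\<lambda>e. C / (1 - e)) \<longlongrightarrow> C / (1 - 0)) (at_right 0)"
    by (intro tendsto_intros) auto
  have "(1 - 0) * Beta a (1 - a) \<le> C / (1 - 0)"
  proof (rule tendsto_le[OF _ lim2 lim1])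
    show "\<forall>\<^sub>F e in at_right 0. (1 - e) * Beta a (1 - a) \<le> C / (1 - e)"
      by (rule eventually_at_rightI[of 0 1]) (use main in auto)
  qed simp
  then show ?thesis by simp
qed

theorem bergman_opnorm_hilbert_op:
  assumes "boyd_supersolutions m a"
  shows "bergman_opnorm (2 * real m) (2 * real m * a - 2) hilbert_op = ennreal (Beta a (1 - a))"
  unfolding bergman_opnorm_def
proof (intro antisym Inf_lower Inf_greatest)
  show "ennreal (Beta a (1 - a)) \<in> ennreal ` {C. 0 \<le> C \<and> (\<forall>f\<in>bspace.
      hilbert_op f \<in> bspace \<and>
      bnorm (hilbert_op f) \<le> C * bnorm f)}"
    using hilbert_op_bound[OF assms] Beta_real_pos[of a "1 - a"] a by auto
next
  fix x assume "x \<in> ennreal ` {C. 0 \<le> C \<and> (\<forall>f\<in>bspace.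
      hilbert_op f \<in> bspace \<and>
      bnorm (hilbert_op f) \<le> C * bnorm f)}"
  then show "ennreal (Beta a (1 - a)) \<le> x"
    by (auto intro!: ennreal_leI hilbert_op_norm_ge)
qed

end

theorem theorem1p5:
  fixes m :: nat
  assumes "m \<ge> 2"
  shows "(\<forall>a::real. 0 < a \<and> a < 1 \<and> 2 * real m * a - 2 > -1 \<and> boyd_supersolutions m a \<longrightarrow>
            bergman_opnorm (2 * real m) (2 * real m * a - 2) hilbert_op = ennreal (Beta a (1 - a)))
       \<and> (\<forall>I::real set. is_interval I \<and>
            (\<forall>a\<in>I. 0 < a \<and> a < 1 \<and> 2 * real m * a - 2 > -1 \<and> boyd_supersolutions m a) \<longrightarrow>
            (\<forall>a\<in>I. bergman_opnorm (2 * real m) (2 * real m * a - 2) hilbert_op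
                      = ennreal (Beta a (1 - a))))"
proof -
  have "bergman_opnorm (2 * real m) (2 * real m * a - 2) hilbert_op = ennreal (Beta a (1 - a))"
    if "0 < a" "a < 1" "2 * real m * a - 2 > -1" "boyd_supersolutions m a" for a
  proof -
    interpret hilbert_bergman m a
      using assms that by unfold_locales auto
    show ?thesis
      using that(4) by (rule bergman_opnorm_hilbert_op)
  qed
  then show ?thesis by blast
qed

end
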